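(* Let $D\subset\mathbb{C}^2$ be an open polydisc centred at the origin, let $R^k_{ij}$ ($k\in\{1,2,3\}$, $i,j\in\{1,2\}$) be differential operators with holomorphic coefficients on $D$ having properties (1)–(3) listed in the context, and let $\mathcal{M}=\operatorname{coker}\phi$ be the associated left $\mathcal{D}$-module on $D$ defined in the context. Then the characteristic variety $V$ of $\mathcal{M}$ satisfies, over $D$, $$V\setminus\{(p,q,0,0)\}=N(S)\setminus\{(p,q,0,0)\},$$ where $\{(p,q,0,0)\}$ denotes the zero section of the cotangent bundle.
   Context: Coordinates on $\mathbb{C}^2$ are $(p,q)$, and $(p,q,\xi_1,\xi_2)$ on $T^*\mathbb{C}^2$, with $\xi_1$ dual to $p$ and $\xi_2$ dual to $q$. The function $z=z(p,q)$ denotes a local holomorphic branch of the solution of $z^3=pz+q$, $\Delta=4p^3-27q^2$, and $S=\Delta^{-1}(0)$ is the cusp. The co-normal of $S$ is the closure of the co-normal of its regular part: $N(S)=\{(3z^2,-2z^3,z\lambda,\lambda):(z,\lambda)\in\mathbb{C}^2\}$. Define $$P_1=\tfrac{p}{3}\xi_2^2-\xi_1^2,\quad P_2=\tfrac{q}{2}\xi_2^3+\xi_1^3,\quad P_3=(4p^3-27q^2)\xi_1^2,$$ with degrees in $(\xi_1,\xi_2)$: $m_1=2$, $m_2=3$, $m_3=2$. The operators $R^k_{ij}$ satisfy, for $k=1,2,3$: (1) for $i\ne j$, $R^k_{ij}$ has order at most $m_k-1$; (2) $R^k_{ii}$ has order $m_k$ and principal symbol $P_k$; (3) $R^k_{11}z+R^k_{12}z^2=0$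 and $R^k_{21}z+R^k_{22}z^2=0$. (On a suitable polydisc $D$ such operators exist.) $\mathcal{D}$ is the sheaf of holomorphic differential operators on $D$. The left $\mathcal{D}$-module morphism $\phi:\mathcal{D}^6\to\mathcal{D}^2$ is $$\phi\big((Q^k_\ell)_{k\in\{1,2,3\},\,\ell\in\{1,2\}}\big)=\sum_{k,\ell}\big(Q^k_\ell R^k_{\ell 1},\,Q^k_\ell R^k_{\ell 2}\big),$$ and $\mathcal{M}=\mathcal{D}^2/\phi(\mathcal{D}^6)$. *)

theory Defs
  imports "HOL-Complex_Analysis.Complex_Analysis" "HOL-Algebra.Module"
    "HOL-Library.Function_Algebras"
begin

type_synonym point = "complex \<times> complex"
type_synonym oper = "(point \<Rightarrow> complex) \<Rightarrow> (point \<Rightarrow> complex)"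

section \<open>Holomorphic functions and differential operators in two variables\<close>

text \<open>Complex differentiability: the real derivative exists and is complex linear.\<close>

definition holo_on :: "(point \<Rightarrow> complex) \<Rightarrow> point set \<Rightarrow> bool" where
  "holo_on f U \<longleftrightarrow>
     (\<forall>x\<in>U. \<exists>a b. (f has_derivative (\<lambda>h. a * fst h + b * snd h)) (at x))"

definition pd :: "nat \<Rightarrow> nat \<Rightarrow> oper" where
  "pd i j f = (\<lambda>(p, q). (deriv ^^ i) (\<lambda>s. (deriv ^^ j) (\<lambda>t. f (s, t)) q) p)"

text \<open>
  A section over an open set \<open>U\<close> of the sheaf of holomorphic differential operators is
  represented by a map on total functions; only its values at points of open subsets
  \<open>W\<close> of \<open>U\<close>, on functions that are holomorphic on \<open>W\<close>, are meaningful.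
  Orders are integers, so that the only operator of negative order is \<open>0\<close>.
\<close>

definition has_coeffs ::
    "point set \<Rightarrow> int \<Rightarrow> oper \<Rightarrow> (nat \<Rightarrow> nat \<Rightarrow> point \<Rightarrow> complex) \<Rightarrow> bool" where
  "has_coeffs U n P a \<longleftrightarrow> (\<forall>i j. holo_on (a i j) U) \<and>
     (\<forall>W f. open W \<and> W \<subseteq> U \<and> holo_on f W \<longrightarrow>
        (\<forall>x\<in>W. P f x = (\<Sum>(i, j) | int (i + j) \<le> n. a i j x * pd i j f x)))"

definition order_le :: "point set \<Rightarrow> int \<Rightarrow> oper \<Rightarrow> bool" where
  "order_le U n P \<longleftrightarrow> (\<exists>a. has_coeffs U n P a)"

text \<open>\<open>P\<close> has order at most \<open>n\<close> and \<open>\<sigma>\<close> is its symbol in degree \<open>n\<close>.\<close>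

definition has_symbol ::
    "point set \<Rightarrow> int \<Rightarrow> oper \<Rightarrow> (point \<times> point \<Rightarrow> complex) \<Rightarrow> bool" where
  "has_symbol U n P \<sigma> \<longleftrightarrow> (\<exists>a. has_coeffs U n P a \<and>
     (\<forall>x\<in>U. \<forall>\<xi>1 \<xi>2. \<sigma> (x, (\<xi>1, \<xi>2)) =
        (\<Sum>(i, j) | int (i + j) = n. a i j x * \<xi>1 ^ i * \<xi>2 ^ j)))"

section \<open>Stalks\<close>

text \<open>
  \<open>Dfilt x n\<close> consists of the representatives of the elements of order at most \<open>n\<close>
  of the stalk at \<open>x\<close>. Representatives define the same element of the stalk iff they
  are related by \<open>same_germ\<close>. The ring operations of the stalk are pointwise addition
  and composition.
\<close>

definition Dfilt :: "point \<Rightarrow> int \<Rightarrow> oper set" where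
  "Dfilt x n = {P. \<exists>U. open U \<and> x \<in> U \<and> order_le U n P}"

definition Dstalk :: "point \<Rightarrow> oper set" where
  "Dstalk x = (\<Union>n. Dfilt x n)"

definition same_germ :: "point \<Rightarrow> oper \<Rightarrow> oper \<Rightarrow> bool" where
  "same_germ x P Q \<longleftrightarrow> (\<exists>U. open U \<and> x \<in> U \<and>
     (\<forall>W f. open W \<and> W \<subseteq> U \<and> holo_on f W \<longrightarrow> (\<forall>y\<in>W. P f y = Q f y)))"

section \<open>Characteristic variety of a left module\<close>

text \<open>
  A left module over the sheaf of differential operators enters through its stalks, each
  given by a \<open>module\<close> record whose scalars are representatives of operator germs (the
  record fields \<open>mult\<close> and \<open>one\<close> are irrelevant). A filtration is good if it is given by
  finitely many generators \<open>u i\<close> placed in degrees \<open>d i\<close>.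
\<close>

definition good_filtration ::
    "point \<Rightarrow> (oper, 'm) module \<Rightarrow> (int \<Rightarrow> 'm set) \<Rightarrow> bool" where
  "good_filtration x M G \<longleftrightarrow>
     (\<exists>(s::nat) u d. (\<forall>i<s. u i \<in> carrier M) \<and>
        (\<forall>n. G n = {(\<Oplus>\<^bsub>M\<^esub>i\<in>{..<s}. Q i \<odot>\<^bsub>M\<^esub> u i) | Q. \<forall>i<s. Q i \<in> Dfilt x (n - d i)})) \<and>
     (\<Union>n. G n) = carrier M"

text \<open>
  The fibre over \<open>x\<close> of the support of the graded module with pieces \<open>G j / G (j - 1)\<close>, that
  is, of the zero set of its annihilator in the graded ring of the stalk. The annihilator
  is a homogeneous ideal, and its elements of degree \<open>n\<close> are the symbols of the operators
  \<open>P\<close> of order at most \<open>n\<close> that map each \<open>G j\<close> to \<open>G (j + n - 1)\<close>. The zero set does not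
  depend on the choice of the good filtration \<open>G\<close>.
\<close>

definition char_fibre :: "point \<Rightarrow> (oper, 'm) module \<Rightarrow> point set" where
  "char_fibre x M = {\<xi>. \<exists>G. good_filtration x M G \<and>
     (\<forall>U n P \<sigma>. open U \<and> x \<in> U \<and> has_symbol U n P \<sigma> \<and>
        (\<forall>j. \<forall>w\<in>G j. P \<odot>\<^bsub>M\<^esub> w \<in> G (j + n - 1)) \<longrightarrow> \<sigma> (x, \<xi>) = 0)}"

definition char_variety ::
    "point set \<Rightarrow> (point \<Rightarrow> (oper, 'm) module) \<Rightarrow> (point \<times> point) set" where
  "char_variety D M = {(x, \<xi>). x \<in> D \<and> \<xi> \<in> char_fibre x (M x)}"

section \<open>The cokernel\<close>

definition phi :: "(nat \<Rightarrow> nat \<Rightarrow> nat \<Rightarrow> oper) \<Rightarrow> (nat \<Rightarrow> nat \<Rightarrow> oper) \<Rightarrow> oper \<times> oper" where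
  "phi R Q = (\<Sum>k\<in>{1,2,3}. \<Sum>l\<in>{1,2}. (Q k l \<circ> R k l 1, Q k l \<circ> R k l 2))"

text \<open>Congruence modulo the image of \<open>phi\<close>, on representatives of pairs of germs.\<close>

definition phi_rel ::
    "(nat \<Rightarrow> nat \<Rightarrow> nat \<Rightarrow> oper) \<Rightarrow> point \<Rightarrow> ((oper \<times> oper) \<times> (oper \<times> oper)) set" where
  "phi_rel R x = {(u, v). u \<in> Dstalk x \<times> Dstalk x \<and> v \<in> Dstalk x \<times> Dstalk x \<and>
     (\<exists>Q. (\<forall>k\<in>{1,2,3}. \<forall>l\<in>{1,2}. Q k l \<in> Dstalk x) \<and>
        same_germ x (fst v) (fst (u + phi R Q)) \<and>
        same_germ x (snd v) (snd (u + phi R Q)))}"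

text \<open>The stalk at \<open>x\<close> of the cokernel of \<open>phi\<close>; stalks commute with cokernels.\<close>

definition coker_phi ::
    "(nat \<Rightarrow> nat \<Rightarrow> nat \<Rightarrow> oper) \<Rightarrow> point \<Rightarrow> (oper, (oper \<times> oper) set) module" where
  "coker_phi R x =
     \<lparr>carrier = (Dstalk x \<times> Dstalk x) // phi_rel R x,
      mult = undefined,
      one = undefined,
      zero = phi_rel R x `` {0},
      add = (\<lambda>X Y. phi_rel R x `` {u + v | u v. u \<in> X \<and> v \<in> Y}),
      smult = (\<lambda>P X. phi_rel R x `` {(P \<circ> u1, P \<circ> u2) | u1 u2. (u1, u2) \<in> X})\<rparr>"

section \<open>The cusp and the symbols\<close>

definition \<Delta> :: "point \<Rightarrow> complex" where
  "\<Delta> = (\<lambda>(p, q). 4 * p ^ 3 - 27 * q ^ 2)"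

text \<open>
  Closure of the set of covectors at regular points of the curve \<open>F = 0\<close> which vanish on
  the tangent space; \<open>F\<close> is supposed to be a reduced equation of the curve, so that its
  regular points are those at which the differential of \<open>F\<close> is nonzero.
\<close>

definition conormal :: "(point \<Rightarrow> complex) \<Rightarrow> (point \<times> point) set" where
  "conormal F = closure {(x, (\<xi>1, \<xi>2)) | x \<xi>1 \<xi>2.
     F x = 0 \<and> (pd 1 0 F x, pd 0 1 F x) \<noteq> (0, 0) \<and>
     (\<forall>v1 v2. pd 1 0 F x * v1 + pd 0 1 F x * v2 = 0 \<longrightarrow> \<xi>1 * v1 + \<xi>2 * v2 = 0)}"

definition zero_section :: "(point \<times> point) set" where
  "zero_section = {((p, q), (0, 0)) | p q. True}"

definition deg_P :: "nat \<Rightarrow> int" where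
  "deg_P k = (if k = 1 then 2 else if k = 2 then 3 else 2)"

definition symb_P :: "nat \<Rightarrow> point \<times> point \<Rightarrow> complex" where
  "symb_P k = (\<lambda>((p, q), (\<xi>1, \<xi>2)).
     if k = 1 then p / 3 * \<xi>2 ^ 2 - \<xi>1 ^ 2
     else if k = 2 then q / 2 * \<xi>2 ^ 3 + \<xi>1 ^ 3
     else (4 * p ^ 3 - 27 * q ^ 2) * \<xi>1 ^ 2)"

lemma pd_Delta: "pd 1 0 \<Delta> (p, q) = 12 * p ^ 2" "pd 0 1 \<Delta> (p, q) = - 54 * q"
proof -
  have "((\<lambda>s. 4 * s ^ 3 - 27 * q ^ 2) has_field_derivative 12 * p ^ 2) (at p)"
    by (auto intro!: derivative_eq_intros)
  then show "pd 1 0 \<Delta> (p, q) = 12 * p ^ 2"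
    by (simp add: pd_def \<Delta>_def DERIV_imp_deriv)
  have "((\<lambda>t. 4 * p ^ 3 - 27 * t ^ 2) has_field_derivative - 54 * q) (at q)"
    by (auto intro!: derivative_eq_intros)
  then show "pd 0 1 \<Delta> (p, q) = - 54 * q"
    by (simp add: pd_def \<Delta>_def DERIV_imp_deriv)
qed

text \<open>The parametrization of the conormal variety of the cusp.\<close>

lemma conormal_Delta:
  "conormal \<Delta> = {((3 * z ^ 2, - 2 * z ^ 3), (z * l, l)) | z l. True}"
proof -
  define A :: "(point \<times> point) set" where "A = {(x, (\<xi>1, \<xi>2)) | x \<xi>1 \<xi>2.
     \<Delta> x = 0 \<and> (pd 1 0 \<Delta> x, pd 0 1 \<Delta> x) \<noteq> (0, 0) \<and>
     (\<forall>v1 v2. pd 1 0 \<Delta> x * v1 + pd 0 1 \<Delta> x * v2 = 0 \<longrightarrow> \<xi>1 * v1 + \<xi>2 * v2 = 0)}"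
  define g :: "complex \<Rightarrow> complex \<Rightarrow> point \<times> point"
    where "g = (\<lambda>l z. ((3 * z ^ 2, - 2 * z ^ 3), (z * l, l)))"
  define C :: "(point \<times> point) set" where
    "C = {y. 4 * fst (fst y) ^ 3 = 27 * snd (fst y) ^ 2 \<and>
       fst (fst y) * snd (snd y) ^ 2 = 3 * fst (snd y) ^ 2 \<and>
       2 * fst (fst y) * fst (snd y) = - 3 * snd (fst y) * snd (snd y)}"
  have "closed C"
    unfolding C_def by (intro closed_Collect_conj closed_Collect_eq continuous_intros)
  have C_g: "\<exists>z l. y = g l z" if "y \<in> C" for y
  proof -
    obtain p q a b where y: "y = ((p, q), (a, b))" by (metis surj_pair)
    from that have e: "4 * p ^ 3 = 27 * q ^ 2" "p * b ^ 2 = 3 * a ^ 2" "2 * p * a = - 3 * q * b"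
      by (auto simp: C_def y)
    show ?thesis
    proof (cases "p = 0")
      case True
      with e have "q = 0" "a = 0" by auto
      with True have "y = g b 0" by (simp add: y g_def)
      then show ?thesis by blast
    next
      case False
      define z where "z = - 3 * q / (2 * p)"
      have zp: "2 * p * z = - 3 * q" using False by (simp add: z_def)
      have "4 * p ^ 2 * (3 * z ^ 2) = 3 * (2 * p * z) ^ 2"
        by (simp add: power2_eq_square)
      also have "\<dots> = 27 * q ^ 2" unfolding zp by (simp add: power2_eq_square)
      also have "\<dots> = 4 * p ^ 2 * p"
        unfolding e(1)[symmetric] by (simp add: power2_eq_square power3_eq_cube)
      finally have p: "3 * z ^ 2 = p" using False by simp
      have "- 2 * z ^ 3 = q"
      proof -
        have "3 * (- 2 * z ^ 3) = - 2 * z * (3 * z ^ 2)"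
          by (simp add: power2_eq_square power3_eq_cube)
        also have "\<dots> = - (2 * p * z)" unfolding p by simp
        also have "\<dots> = 3 * q" unfolding zp by simp
        finally show ?thesis by (metis mult_cancel_left zero_neq_numeral)
      qed
      moreover have "a = z * b"
      proof -
        have "2 * p * a = 2 * p * (z * b)" using e(3) zp by (metis mult.assoc)
        then show ?thesis using False by simp
      qed
      ultimately have "y = g b z" using p by (simp add: y g_def)
      then show ?thesis by blast
    qed
  qed
  have "A \<subseteq> C"
  proof
    fix y assume "y \<in> A"
    then obtain p q a b where y: "y = ((p, q), (a, b))"
      and D: "\<Delta> (p, q) = 0" and ne: "(pd 1 0 \<Delta> (p, q), pd 0 1 \<Delta> (p, q)) \<noteq> (0, 0)"
      and v: "\<And>v1 v2. pd 1 0 \<Delta> (p, q) * v1 + pd 0 1 \<Delta> (p, q) * v2 = 0 \<Longrightarrow> a * v1 + b * v2 = 0"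
      unfolding A_def by auto
    have e: "4 * p ^ 3 = 27 * q ^ 2" using D by (simp add: \<Delta>_def)
    with ne have "p \<noteq> 0" "q \<noteq> 0" unfolding pd_Delta by auto
    have d: "a * (54 * q) + b * (12 * p ^ 2) = 0" by (rule v) (simp add: pd_Delta[simplified])
    have c: "a * (54 * q) + b * (12 * p ^ 2) = 6 * (9 * q * a + 2 * p ^ 2 * b)"
      by (simp add: algebra_simps)
    have "6 * (9 * q * a + 2 * p ^ 2 * b) = 0" using d unfolding c .
    then have "9 * q * a + 2 * p ^ 2 * b = 0" by (subst (asm) mult_eq_0_iff) simp
    then have w: "9 * q * a = - 2 * p ^ 2 * b" by (simp add: eq_neg_iff_add_eq_0)
    have "9 * q * (2 * p * a) = 2 * p * (9 * q * a)" by simp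
    also have "\<dots> = - (4 * p ^ 3) * b"
      unfolding w by (simp add: power2_eq_square power3_eq_cube)
    also have "\<dots> = 9 * q * (- 3 * q * b)" unfolding e by (simp add: power2_eq_square)
    finally have 1: "2 * p * a = - 3 * q * b"
      using \<open>q \<noteq> 0\<close> by (subst (asm) mult_cancel_left) simp
    have "4 * p ^ 2 * (3 * a ^ 2) = 3 * (2 * p * a) ^ 2" by (simp add: power2_eq_square)
    also have "\<dots> = 27 * q ^ 2 * b ^ 2" unfolding 1 by (simp add: power2_eq_square)
    also have "\<dots> = 4 * p ^ 2 * (p * b ^ 2)"
      unfolding e[symmetric] by (simp add: power2_eq_square power3_eq_cube)
    finally have "p * b ^ 2 = 3 * a ^ 2"
      using \<open>p \<noteq> 0\<close> by (subst (asm) mult_cancel_left) simp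
    with e 1 show "y \<in> C" by (simp add: C_def y)
  qed
  then have "closure A \<subseteq> C" using \<open>closed C\<close> by (rule closure_minimal)
  moreover have "g l z \<in> closure A" for l z
  proof -
    have sub: "g l ` (- {0}) \<subseteq> closure A"
    proof
      fix y assume "y \<in> g l ` (- {0})"
      then obtain z where z: "z \<noteq> 0" and y: "y = g l z" by auto
      have "z * l * v1 + l * v2 = 0"
        if "pd 1 0 \<Delta> (3 * z ^ 2, - 2 * z ^ 3) * v1 + pd 0 1 \<Delta> (3 * z ^ 2, - 2 * z ^ 3) * v2 = 0"
        for v1 v2
      proof -
        have "108 * z ^ 3 * (z * v1 + v2)
                = 12 * (3 * z ^ 2) ^ 2 * v1 + - 54 * (- 2 * z ^ 3) * v2"
          by (simp add: algebra_simps power2_eq_square power3_eq_cube)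
        also have "\<dots> = 0" using that unfolding pd_Delta .
        finally have "108 * z ^ 3 * (z * v1 + v2) = 0" .
        then have "z * v1 + v2 = 0" using z by simp
        moreover have "z * l * v1 + l * v2 = l * (z * v1 + v2)" by (simp add: algebra_simps)
        ultimately show ?thesis by simp
      qed
      moreover have "\<Delta> (3 * z ^ 2, - 2 * z ^ 3) = 0"
        by (simp add: \<Delta>_def power_mult_distrib flip: power_mult)
      moreover have "pd 0 1 \<Delta> (3 * z ^ 2, - 2 * z ^ 3) \<noteq> 0"
        using z unfolding pd_Delta by simp
      ultimately have "y \<in> A"
        unfolding A_def y g_def by blast
      then show "y \<in> closure A" using closure_subset by blast
    qed
    have "continuous_on (closure (- {0})) (g l)"
      unfolding g_def by (intro continuous_intros)
    then have "g l ` closure (- {0}) \<subseteq> closure A"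
      by (rule image_closure_subset) (use sub in auto)
    then show ?thesis by (auto simp: closure_complement)
  qed
  ultimately have "closure A = {g l z | z l. True}" using C_g by blast
  then show ?thesis unfolding conormal_def A_def g_def by simp
qed

end

theory Submission
  imports Defs
begin

text \<open>
  Filter the stalk of the cokernel by the order of representatives. Since the diagonal entries
  \<open>R k 1 1\<close> and \<open>R k 2 2\<close> have the same symbol \<open>symb_P k\<close> and the off-diagonal entries have smaller
  order, \<open>R k 1 1\<close> maps each filtration piece one step lower than its order predicts. Hence
  \<open>symb_P k\<close> vanishes on the characteristic variety, and off the zero section the common zeros of
  \<open>symb_P 1\<close> and \<open>symb_P 2\<close> already form the conormal of the cusp.

  Conversely, let \<open>P\<close> have order \<open>n\<close> and lower the filtration too much. Evaluating the resulting
  relation in the cokernel on the solution \<open>(z, z\<^sup>2)\<close> gives \<open>P z = A z + B z\<^sup>2\<close> with \<open>A\<close> and \<open>B\<close> of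
  order less than \<open>n\<close>. Where two branches of \<open>z\<close> meet, \<open>3 z\<^sup>2 - p\<close> tends to \<open>0\<close>, and derivatives of
  order \<open>k\<close> of \<open>z\<close> grow like \<open>(3 z\<^sup>2 - p)\<close> to the power \<open>1 - 2 k\<close>. Comparing the terms of the
  highest growth shows that the symbol of \<open>P\<close> vanishes on the conormal.
\<close>

section \<open>Holomorphic functions of two variables\<close>

text \<open>Membership in \<open>char_fibre\<close> asks for one good filtration, so for points of
  the conormal the order filtration serves as witness. Off the conormal every good filtration must
  be excluded; this forces the comparison of filtrations and the passage to powers of
  \<open>R k 1 1\<close>. At the point (3 \<zeta>^2, -2 \<zeta>^3) the cubic is (z - \<zeta>)^2 (z +
  2 \<zeta>), so for \<zeta> \<noteq> 0 two branches meet there. Put \<delta> = 3 z^2 - p. Implicit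
  differentiation gives dz = (z, 1) / \<delta>, whose direction tends to the conormal direction
  (\<zeta>, 1). The first derivative costs one factor 1 / \<delta>; every further one costs two, one
  through dz and one through the denominator. Since \<open>B\<close> has order below
  \<open>n\<close>, its terms have smaller poles and drop out of the limit. At \<zeta> = 0 all three
  roots meet and the leading coefficients carry powers of \<zeta> that can vanish, which is why that
  point is reached along the curve. Two obstacles shape the groundwork: holomorphy is complex
  differentiability at each point, so that partial derivatives must be shown to be holomorphic and
  to commute, and operators are maps on total functions, so that many ring laws hold only for
  germs.\<close>

definition dp :: oper where
  "dp f = (\<lambda>(p, q). deriv (\<lambda>s. f (s, q)) p)"

definition dq :: oper where
  "dq f = (\<lambda>(p, q). deriv (\<lambda>t. f (p, t)) q)"

lemma dq_power: "(dq ^^ j) f (p, q) = (deriv ^^ j) (\<lambda>t. f (p, t)) q"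
  by (induction j arbitrary: q) (simp_all add: dq_def)

lemma dp_power: "(dp ^^ i) f (p, q) = (deriv ^^ i) (\<lambda>s. f (s, q)) p"
  by (induction i arbitrary: p) (simp_all add: dp_def)

lemma pd_eq: "pd i j f = (dp ^^ i) ((dq ^^ j) f)"
  by (simp add: fun_eq_iff pd_def dp_power dq_power)

lemma holo_on_subset: "holo_on f U \<Longrightarrow> V \<subseteq> U \<Longrightarrow> holo_on f V"
  by (auto simp: holo_on_def)

lemma holo_on_cong_open:
  assumes "open U" "holo_on f U" "\<And>x. x \<in> U \<Longrightarrow> f x = g x"
  shows "holo_on g U"
  unfolding holo_on_def
proof
  fix x assume x: "x \<in> U"
  obtain a b where "(f has_derivative (\<lambda>h. a * fst h + b * snd h)) (at x)"
    using assms(2) x unfolding holo_on_def by blast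
  then have "(g has_derivative (\<lambda>h. a * fst h + b * snd h)) (at x)"
    by (rule has_derivative_transform_within_open[OF _ assms(1) x]) (use assms(3) in auto)
  then show "\<exists>a b. (g has_derivative (\<lambda>h. a * fst h + b * snd h)) (at x)" by blast
qed

lemma has_derivative_partials:
  fixes f :: "point \<Rightarrow> complex"
  assumes "(f has_derivative (\<lambda>h. a * fst h + b * snd h)) (at (p, q))"
  shows "((\<lambda>s. f (s, q)) has_field_derivative a) (at p)"
    and "((\<lambda>t. f (p, t)) has_field_derivative b) (at q)"
proof -
  have "((\<lambda>s. f (s, q)) has_derivative (\<lambda>h. a * fst (h, 0::complex) + b * snd (h, 0::complex)))
    (at p)"
    by (rule has_derivative_compose[of "\<lambda>s. (s, q)" "\<lambda>h. (h, 0)" p UNIV f, simplified])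
       (auto intro!: derivative_eq_intros assms[simplified])
  then show "((\<lambda>s. f (s, q)) has_field_derivative a) (at p)"
    by (simp add: has_field_derivative_def)
  have "((\<lambda>t. f (p, t)) has_derivative (\<lambda>h. a * fst (0::complex, h) + b * snd (0::complex, h)))
    (at q)"
    by (rule has_derivative_compose[of "\<lambda>t. (p, t)" "\<lambda>h. (0, h)" q UNIV f, simplified])
       (auto intro!: derivative_eq_intros assms[simplified])
  then show "((\<lambda>t. f (p, t)) has_field_derivative b) (at q)"
    by (simp add: has_field_derivative_def)
qed

lemma holo_on_iff_dp_dq:
  "holo_on f U \<longleftrightarrow> (\<forall>x\<in>U. (f has_derivative (\<lambda>h. dp f x * fst h + dq f x * snd h)) (at x))"
proof
  assume f: "holo_on f U"
  show "\<forall>x\<in>U. (f has_derivative (\<lambda>h. dp f x * fst h + dq f x * snd h)) (at x)"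
  proof
    fix x assume "x \<in> U"
    then obtain a b where ab: "(f has_derivative (\<lambda>h. a * fst h + b * snd h)) (at x)"
      using f unfolding holo_on_def by blast
    obtain p q where x: "x = (p, q)" by (cases x)
    have "dp f x = a" "dq f x = b"
      using has_derivative_partials[OF ab[unfolded x]] by (auto simp: x dp_def dq_def
        DERIV_imp_deriv)
    then show "(f has_derivative (\<lambda>h. dp f x * fst h + dq f x * snd h)) (at x)" using ab by simp
  qed
qed (auto simp: holo_on_def)

lemma holo_on_has_derivative:
  "holo_on f U \<Longrightarrow> x \<in> U \<Longrightarrow> (f has_derivative (\<lambda>h. dp f x * fst h + dq f x * snd h)) (at x)"
  by (simp add: holo_on_iff_dp_dq)

lemma holo_on_dp_dq:
  assumes "holo_on f U" "(p, q) \<in> U"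
  shows "((\<lambda>s. f (s, q)) has_field_derivative dp f (p, q)) (at p)"
    and "((\<lambda>t. f (p, t)) has_field_derivative dq f (p, q)) (at q)"
  using has_derivative_partials[OF holo_on_has_derivative[OF assms]] by auto

lemma dp_dq_eqI:
  assumes "(f has_derivative (\<lambda>h. a * fst h + b * snd h)) (at x)"
  shows "dp f x = a" "dq f x = b"
  using has_derivative_partials[of f a b "fst x" "snd x"] assms
  by (auto simp: dp_def dq_def split_beta intro!: DERIV_imp_deriv)

lemma holo_on_continuous: "holo_on f U \<Longrightarrow> continuous_on U f"
  by (meson continuous_at_imp_continuous_on has_derivative_continuous holo_on_has_derivative)

lemma dp_dq_cong_open:
  assumes "open U" "x \<in> U" "\<And>y. y \<in> U \<Longrightarrow> f y = g y"
  shows "dp f x = dp g x" "dq f x = dq g x"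
proof -
  obtain p q where x: "x = (p, q)" by (cases x)
  obtain A B where AB: "open A" "open B" "p \<in> A" "q \<in> B" "A \<times> B \<subseteq> U"
    using open_prod_elim[OF assms(1,2)] unfolding x by (metis mem_Sigma_iff)
  have "\<forall>\<^sub>F s in nhds p. f (s, q) = g (s, q)"
    using AB assms(3) by (auto simp: eventually_nhds)
  then show "dp f x = dp g x" by (simp add: x dp_def deriv_cong_ev)
  have "\<forall>\<^sub>F t in nhds q. f (p, t) = g (p, t)"
    using AB assms(3) by (auto simp: eventually_nhds)
  then show "dq f x = dq g x" by (simp add: x dq_def deriv_cong_ev)
qed

lemma pd_cong_open:
  assumes "open U" "x \<in> U" "\<And>y. y \<in> U \<Longrightarrow> f y = g y"
  shows "pd i j f x = pd i j g x"
proof -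
  have "(dq ^^ j) f y = (dq ^^ j) g y" if "y \<in> U" for y
    using that by (induction j arbitrary: y) (auto intro: assms dp_dq_cong_open[OF assms(1)])
  then have "(dp ^^ i) ((dq ^^ j) f) y = (dp ^^ i) ((dq ^^ j) g) y" if "y \<in> U" for y
    using that by (induction i arbitrary: y) (auto intro: dp_dq_cong_open[OF assms(1)])
  then show ?thesis using assms(2) by (simp add: pd_eq)
qed

text \<open>Cauchy's formula for the first derivative, as an integral over a real interval, so that
  the Leibniz rule applies to the parameters.\<close>

definition cauchy_kernel :: "complex \<Rightarrow> real \<Rightarrow> complex \<Rightarrow> real \<Rightarrow> complex" where
  "cauchy_kernel c r p t = of_real r * exp (2 * of_real pi * \<i> * of_real t) / (circlepath c r t
    - p) ^ 2"

text \<open>The velocity of the circle is 2 pi i r exp(2 pi i t); its factor 2 pi i cancels the one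
  in Cauchy's formula, and the rest is \<open>cauchy_kernel\<close>. Only the slice through
  \<open>q\<close> enters, so \<open>B\<close> may be any set.\<close>

lemma dp_Cauchy:
  assumes f: "holo_on f W" and sub: "cball c r \<times> B \<subseteq> W" and p: "p \<in> ball c r" and q: "q \<in> B"
  shows "dp f (p, q) = integral (cbox 0 1) (\<lambda>t. f (circlepath c r t, q) * cauchy_kernel c r p t)"
proof -
  let ?g = "\<lambda>s. f (s, q)"
  have der: "(?g has_field_derivative dp f (s, q)) (at s)" if "s \<in> cball c r" for s
    by (rule holo_on_dp_dq[OF f]) (use that q sub in auto)
  have hol: "?g holomorphic_on ball c r"
    unfolding holomorphic_on_def field_differentiable_def
    by (metis der has_field_derivative_at_within ball_subset_cball subsetD)
  have cont: "continuous_on (cball c r) ?g"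
    using der DERIV_isCont continuous_at_imp_continuous_on by blast
  have "(2 * pi * \<i>) * deriv ?g p = contour_integral (circlepath c r) (\<lambda>u. ?g u / (u - p) ^ 2)"
    using Cauchy_contour_integral_circlepath_2[OF cont hol p] by simp
  also have "\<dots> = integral {0..1} (\<lambda>t. (2 * pi * \<i>) * (?g (circlepath c r t) * cauchy_kernel c r
    p t))"
    by (simp add: contour_integral_integral vector_derivative_circlepath cauchy_kernel_def mult_ac)
  also have "\<dots> = (2 * pi * \<i>) * integral {0..1} (\<lambda>t. ?g (circlepath c r t) * cauchy_kernel c r p t)"
    by (rule integral_mult_right)
  finally show ?thesis by (simp add: dp_def)
qed

lemma circlepath_not_in_ball: "0 < r \<Longrightarrow> circlepath c r t \<notin> ball c r"
  by (simp add: circlepath dist_norm norm_mult)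

lemma circlepath_in_cball: "0 < r \<Longrightarrow> circlepath c r t \<in> cball c r"
  by (simp add: circlepath dist_norm norm_mult)

lemma polydisc_nbhd:
  assumes "open W" "(c, d) \<in> W"
  obtains r where "0 < r" "cball c r \<times> ball d r \<subseteq> W" 
proof -
  obtain A B where AB: "open A" "open B" "c \<in> A" "d \<in> B" "A \<times> B \<subseteq> W"
    using open_prod_elim[OF assms] by (metis mem_Sigma_iff)
  obtain r1 r2 where "0 < r1" "cball c r1 \<subseteq> A" "0 < r2" "cball d r2 \<subseteq> B"
    using AB by (meson open_contains_cball)
  then show ?thesis using AB by (intro that[of "min r1 r2"]) force+
qed

lemma continuous_on_circlepath[continuous_intros]:
  "continuous_on S g \<Longrightarrow> continuous_on S (\<lambda>x. circlepath c r (g x))"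
  by (auto simp: circlepath intro!: continuous_intros)

text \<open>The circle stays away from the open ball, so Cauchy's integrand is jointly continuous in
  the point and the parameter. The mirror image for \<open>dq\<close> supplies the continuity that
  the Leibniz rule demands of the differentiated integrand.\<close>

lemma continuous_on_dp:
  assumes f: "holo_on f W" and W: "open W"
  shows "continuous_on W (dp f)"
proof (rule continuous_at_imp_continuous_on, rule ballI)
  fix x assume "x \<in> W"
  obtain c d where x: "x = (c, d)" by (cases x)
  obtain r where r: "0 < r" "cball c r \<times> ball d r \<subseteq> W"
    using polydisc_nbhd W \<open>x \<in> W\<close> x by metis
  let ?U = "ball c r \<times> ball d r"
  let ?h = "\<lambda>y t. f (circlepath c r t, snd y) * cauchy_kernel c r (fst y) t"
  have "continuous_on (?U \<times> cbox 0 1) (\<lambda>(y, t). f (circlepath c r t, snd y) * cauchy_kernel c r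
    (fst y) t)"
    unfolding cauchy_kernel_def split_beta
    by (intro continuous_intros continuous_on_compose2[OF holo_on_continuous[OF f]])
       (use r circlepath_in_cball[OF r(1), of c] circlepath_not_in_ball[OF r(1), of c] in \<open>auto\<close>)
  then have "continuous_on ?U (\<lambda>y. integral (cbox 0 1) (?h y))"
    by (rule integral_continuous_on_param)
  moreover have "dp f y = integral (cbox 0 1) (?h y)" if "y \<in> ?U" for y
    using that dp_Cauchy[OF f r(2), of "fst y" "snd y"] by auto
  ultimately have "continuous_on ?U (dp f)" by (simp cong: continuous_on_cong)
  moreover have "open ?U" "x \<in> ?U" using r x by (auto simp: open_Times)
  ultimately show "isCont (dp f) x" using continuous_on_eq_continuous_at by blast
qed

text \<open>Exchanging the coordinates turns \<open>dp\<close> into \<open>dq\<close>, so Cauchy's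
  formula has to be worked out in one variable only.\<close>

lemma holo_on_swap:
  assumes "holo_on f W"
  shows "holo_on (f \<circ> prod.swap) (prod.swap ` W)" 
  unfolding holo_on_def
proof
  fix x assume "x \<in> prod.swap ` W"
  then have "prod.swap x \<in> W" by auto
  then obtain a b where "(f has_derivative (\<lambda>h. a * fst h + b * snd h)) (at (prod.swap x))"
    using assms unfolding holo_on_def by blast
  moreover have "(prod.swap has_derivative prod.swap) (at x)" for x :: point
    unfolding prod.swap_def by (auto intro!: derivative_eq_intros)
  ultimately have "((f \<circ> prod.swap) has_derivative (\<lambda>h. a * fst h + b * snd h) \<circ> prod.swap) (at x)"
    by (intro diff_chain_at)
  moreover have "(\<lambda>h. a * fst h + b * snd h) \<circ> prod.swap = (\<lambda>h. b * fst h + a * snd h)"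
    by (auto simp: fun_eq_iff)
  ultimately show "\<exists>a b. ((f \<circ> prod.swap) has_derivative (\<lambda>h. a * fst h + b * snd h)) (at x)"
    by auto
qed

lemma dq_swap: "dq f = dp (f \<circ> prod.swap) \<circ> prod.swap"
  by (simp add: fun_eq_iff dp_def dq_def)


lemma swap_image_eq_vimage: "prod.swap ` W = prod.swap -` W"
  by (force simp: image_iff)

lemma open_swap:
  fixes W :: "point set"
  assumes "open W" shows "open (prod.swap ` W)"
proof -
  have "continuous_on UNIV (prod.swap :: point \<Rightarrow> point)"
    unfolding prod.swap_def by (intro continuous_intros)
  then show ?thesis
    unfolding swap_image_eq_vimage by (rule open_vimage[OF assms])
qed

lemma continuous_on_dq:
  assumes f: "holo_on f W" and W: "open W"
  shows "continuous_on W (dq f)"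
proof -
  have "continuous_on (prod.swap ` W) (dp (f \<circ> prod.swap))"
    by (intro continuous_on_dp holo_on_swap f open_swap W)
  moreover have "continuous_on W (prod.swap :: point \<Rightarrow> point)"
    unfolding prod.swap_def by (intro continuous_intros)
  ultimately show ?thesis unfolding dq_swap by (intro continuous_on_compose)
qed

lemma cauchy_kernel_has_derivative:
  assumes "p \<noteq> circlepath c r t"
  shows "((\<lambda>p. cauchy_kernel c r p t) has_field_derivative
    2 * of_real r * exp (2 * of_real pi * \<i> * of_real t) / (circlepath c r t - p) ^ 3) (at p)"
proof -
  have "circlepath c r t - p \<noteq> 0" using assms by simp
  then show ?thesis
    unfolding cauchy_kernel_def
    by (auto intro!: derivative_eq_intros simp: divide_simps power2_eq_square power3_eq_cube)
       (simp add: algebra_simps)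
qed

text \<open>Differentiation under Cauchy's integral. The coefficient of \<open>snd h\<close> is
  spelled out because it is Cauchy's integral for \<open>dp (dq f)\<close>: the commutation of the
  two partial derivatives is read off from it. The coefficient of \<open>fst h\<close> may stay
  anonymous.\<close>

lemma dp_has_derivative_Cauchy:
  assumes f: "holo_on f W" and W: "open W" and r: "0 < r" and sub: "cball c r \<times> ball d r \<subseteq> W"
    and x: "x \<in> ball c r \<times> ball d r"
  obtains A where
    "(dp f has_derivative (\<lambda>h. A * fst h +
       integral (cbox 0 1) (\<lambda>t. dq f (circlepath c r t, snd x) * cauchy_kernel c r (fst x) t) *
         snd h)) (at x)"
proof -
  let ?U = "ball c r \<times> ball d r"
  define k' where "k' = (\<lambda>p t. 2 * of_real r * exp (2 * of_real pi * \<i> * of_real t) /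
    (circlepath c r t - p) ^ 3)"
  define F where "F = (\<lambda>y t. f (circlepath c r t, snd y) * cauchy_kernel c r (fst y) t)"
  define A where "A = (\<lambda>y t. f (circlepath c r t, snd y) * k' (fst y) t)"
  define B where "B = (\<lambda>y t. dq f (circlepath c r t, snd y) * cauchy_kernel c r (fst y) t)"
  \<comment> \<open>The Leibniz rule takes the derivative of the integrand as a continuous family of
    bounded linear maps.\<close>
  define F' where "F' = (\<lambda>y t. (blinfun_mult_right (A y t) o\<^sub>L fst_blinfun)
     + (blinfun_mult_right (B y t) o\<^sub>L snd_blinfun))"
  have F'_apply: "blinfun_apply (F' y t) h = A y t * fst h + B y t * snd h" for y t h
    by (simp add: F'_def blinfun.add_left)
  have in_W: "(circlepath c r t, q) \<in> W" if "q \<in> ball d r" for q t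
    using circlepath_in_cball[OF r, of c t] sub that by auto
  have nz: "circlepath c r t \<noteq> p" if "p \<in> ball c r" for p t
    using circlepath_not_in_ball[OF r, of c t] that by auto
  have cont: "continuous_on (?U \<times> cbox 0 1) (\<lambda>(y, t). F y t)"
    "continuous_on (?U \<times> cbox 0 1) (\<lambda>(y, t). A y t)"
    "continuous_on (?U \<times> cbox 0 1) (\<lambda>(y, t). B y t)"
    unfolding cauchy_kernel_def split_beta F_def A_def B_def k'_def
      apply (intro continuous_intros continuous_on_compose2[OF holo_on_continuous[OF f]])
      apply (auto intro: in_W dest: nz)[2]
     apply (intro continuous_intros continuous_on_compose2[OF holo_on_continuous[OF f]])
      apply (auto intro: in_W dest: nz)[2]
    apply (intro continuous_intros continuous_on_compose2[OF continuous_on_dq[OF f W]])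
     apply (auto intro: in_W dest: nz)[2]
    done
  have integ: "G y integrable_on cbox 0 1"
    if "y \<in> ?U" "continuous_on (?U \<times> cbox 0 1) (\<lambda>(y, t). G y t)" for G :: "_ \<Rightarrow> _ \<Rightarrow> 'c::banach" and y
  proof (rule integrable_continuous)
    have "continuous_on (cbox 0 1) (\<lambda>t. (\<lambda>(y, t). G y t) (y, t))"
      by (rule continuous_on_compose2[OF that(2)]) (use that(1) in \<open>auto intro!: continuous_intros\<close>)
    then show "continuous_on (cbox 0 1) (G y)" by simp
  qed
  have contF': "continuous_on (?U \<times> cbox 0 1) (\<lambda>(y, t). F' y t)"
    using cont(2,3) unfolding F'_def split_beta
    by (intro continuous_intros bounded_linear.continuous_on[OF bounded_linear_blinfun_mult_right])
  have der: "((\<lambda>y. F y t) has_derivative blinfun_apply (F' y t)) (at y within ?U)"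
    if y: "y \<in> ?U" for y t
  proof -
    have f': "((\<lambda>v. f (circlepath c r t, v)) has_field_derivative dq f (circlepath c r t, snd
      y)) (at (snd y))"
      by (rule holo_on_dp_dq(2)[OF f in_W]) (use y in auto)
    have g1: "((\<lambda>y. f (circlepath c r t, snd y)) has_derivative (\<lambda>h. dq f (circlepath c r t, snd
      y) * snd h)) (at y)"
      using has_derivative_compose[OF has_derivative_snd[OF has_derivative_ident] f'[unfolded
        has_field_derivative_def]]
      by simp
    have k1: "((\<lambda>p. cauchy_kernel c r p t) has_field_derivative k' (fst y) t) (at (fst y))"
      unfolding k'_def by (rule cauchy_kernel_has_derivative) (use nz y in force)
    have g2: "((\<lambda>y. cauchy_kernel c r (fst y) t) has_derivative (\<lambda>h. k' (fst y) t * fst h)) (at y)"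
      using has_derivative_compose[OF has_derivative_fst[OF has_derivative_ident] k1[unfolded
        has_field_derivative_def]]
      by simp
    have "((\<lambda>y. F y t) has_derivative (\<lambda>h. A y t * fst h + B y t * snd h)) (at y)"
      using has_derivative_mult[OF g1 g2] unfolding F_def A_def B_def
      by (rule has_derivative_eq_rhs) (auto simp: fun_eq_iff algebra_simps)
    then show ?thesis
      unfolding F'_apply[abs_def] by (rule has_derivative_at_withinI)
  qed
  have conv: "convex ?U" by (intro convex_Times convex_ball)
  have "((\<lambda>y. integral (cbox 0 1) (F y)) has_derivative integral (cbox 0 1) (F' x)) (at x within
    ?U)"
    by (rule leibniz_rule[OF der integ[OF _ cont(1)] contF' x conv])
  then have "((\<lambda>y. integral (cbox 0 1) (F y)) has_derivative integral (cbox 0 1) (F' x)) (at x)"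
    by (simp only: at_within_open[OF x open_Times[OF open_ball open_ball]])
  moreover have "blinfun_apply (integral (cbox 0 1) (F' x)) h
     = integral (cbox 0 1) (A x) * fst h + integral (cbox 0 1) (B x) * snd h" for h
  proof -
    note i = integ[OF x cont(2)] integ[OF x cont(3)]
    have "blinfun_apply (integral (cbox 0 1) (F' x)) h = integral (cbox 0 1) (\<lambda>t. A x t * fst h
      + B x t * snd h)"
      by (subst blinfun_apply_integral[OF integ[OF x contF']]) (simp add: F'_apply)
    also have "\<dots> = integral (cbox 0 1) (\<lambda>t. A x t * fst h) + integral (cbox 0 1) (\<lambda>t. B x t *
      snd h)"
      by (intro integral_add integrable_on_mult_left i)
    finally show ?thesis by simp
  qed
  ultimately have "((\<lambda>y. integral (cbox 0 1) (F y)) has_derivative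
      (\<lambda>h. integral (cbox 0 1) (A x) * fst h + integral (cbox 0 1) (B x) * snd h)) (at x)"
    by (rule has_derivative_eq_rhs[OF _ ext])
  then have "(dp f has_derivative
      (\<lambda>h. integral (cbox 0 1) (A x) * fst h + integral (cbox 0 1) (B x) * snd h)) (at x)"
    by (rule has_derivative_transform_within_open[of _ _ _ _ ?U])
       (use x dp_Cauchy[OF f sub] in \<open>auto simp: open_Times F_def\<close>)
  then show ?thesis unfolding B_def by (rule that)
qed

lemma holo_on_dp:
  assumes "holo_on f W" "open W"
  shows "holo_on (dp f) W"
  unfolding holo_on_def
proof
  fix x assume "x \<in> W"
  obtain c d where x: "x = (c, d)" by (cases x)
  obtain r where r: "0 < r" "cball c r \<times> ball d r \<subseteq> W"
    using polydisc_nbhd assms(2) \<open>x \<in> W\<close> x by metis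
  show "\<exists>a b. (dp f has_derivative (\<lambda>h. a * fst h + b * snd h)) (at x)"
    by (rule dp_has_derivative_Cauchy[OF assms r, of x]) (use r x in auto)
qed

lemma holo_on_dq:
  assumes f: "holo_on f W" and W: "open W"
  shows "holo_on (dq f) W"
proof -
  have "holo_on (dp (f \<circ> prod.swap) \<circ> prod.swap) (prod.swap ` (prod.swap ` W))"
    by (intro holo_on_swap holo_on_dp f open_swap W)
  then show ?thesis by (simp add: dq_swap image_comp)
qed

lemma dq_dp:
  assumes f: "holo_on f W" and W: "open W" and "x \<in> W"
  shows "dq (dp f) x = dp (dq f) x"
proof -
  obtain c d where x: "x = (c, d)" by (cases x)
  obtain r where r: "0 < r" "cball c r \<times> ball d r \<subseteq> W"
    using polydisc_nbhd W \<open>x \<in> W\<close> x by metis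
  have xU: "x \<in> ball c r \<times> ball d r" using r x by auto
  obtain A where "(dp f has_derivative (\<lambda>h. A * fst h +
       integral (cbox 0 1) (\<lambda>t. dq f (circlepath c r t, snd x) * cauchy_kernel c r (fst x) t) *
         snd h)) (at x)"
    using dp_has_derivative_Cauchy[OF f W r xU] .
  then have "dq (dp f) x = integral (cbox 0 1) (\<lambda>t. dq f (circlepath c r t, snd x) *
    cauchy_kernel c r (fst x) t)"
    by (rule dp_dq_eqI)
  also have "\<dots> = dp (dq f) x"
    using dp_Cauchy[OF holo_on_dq[OF f W] r(2), of "fst x" "snd x"] xU by auto
  finally show ?thesis .
qed

lemma holo_on_pd:
  assumes "holo_on f W" "open W"
  shows "holo_on (pd i j f) W"
proof -
  have "holo_on ((dq ^^ j) f) W" by (induction j) (auto intro: assms holo_on_dq)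
  then have "holo_on ((dp ^^ i) ((dq ^^ j) f)) W" by (induction i) (auto intro: assms holo_on_dp)
  then show ?thesis by (simp add: pd_eq)
qed

lemma dp_pd: "dp (pd i j f) = pd (Suc i) j f"
  by (simp add: pd_eq)

text \<open>\<open>pd i j\<close> applies \<open>dq\<close> first, so one more \<open>dq\<close> has
  to be commuted past \<open>i\<close> copies of \<open>dp\<close>.\<close>

lemma dq_pd:
  assumes f: "holo_on f W" and W: "open W" and x: "x \<in> W"
  shows "dq (pd i j f) x = pd i (Suc j) f x"
  using x
proof (induction i arbitrary: x)
  case 0
  then show ?case by (simp add: pd_eq)
next
  case (Suc i)
  have "dq (pd (Suc i) j f) x = dp (dq (pd i j f)) x"
    unfolding dp_pd[symmetric] by (rule dq_dp[OF holo_on_pd[OF f W] W Suc.prems])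
  also have "\<dots> = dp (pd i (Suc j) f) x"
    by (rule dp_dq_cong_open[OF W Suc.prems Suc.IH])
  finally show ?case by (simp add: dp_pd)
qed

section \<open>Sum and product rules\<close>

lemma holo_on_const[simp]: "holo_on (\<lambda>_. c) U"
  unfolding holo_on_def by (auto intro!: derivative_eq_intros exI[of _ 0])

lemma holo_on_add:
  assumes f: "holo_on f U" and g: "holo_on g U"
  shows "holo_on (\<lambda>x. f x + g x) U"
    and "x \<in> U \<Longrightarrow> dp (\<lambda>x. f x + g x) x = dp f x + dp g x"
    and "x \<in> U \<Longrightarrow> dq (\<lambda>x. f x + g x) x = dq f x + dq g x"
proof -
  have *: "((\<lambda>x. f x + g x) has_derivative
     (\<lambda>h. (dp f x + dp g x) * fst h + (dq f x + dq g x) * snd h)) (at x)" if "x \<in> U" for x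
    using has_derivative_add[OF holo_on_has_derivative[OF f that] holo_on_has_derivative[OF g that]]
    by (rule has_derivative_eq_rhs) (auto simp: fun_eq_iff algebra_simps)
  then show "holo_on (\<lambda>x. f x + g x) U" unfolding holo_on_def by blast
  show "x \<in> U \<Longrightarrow> dp (\<lambda>x. f x + g x) x = dp f x + dp g x"
    by (rule dp_dq_eqI(1)[OF *])
  show "x \<in> U \<Longrightarrow> dq (\<lambda>x. f x + g x) x = dq f x + dq g x"
    by (rule dp_dq_eqI(2)[OF *])
qed

lemma holo_on_mult:
  assumes f: "holo_on f U" and g: "holo_on g U"
  shows "holo_on (\<lambda>x. f x * g x) U"
    and "x \<in> U \<Longrightarrow> dp (\<lambda>x. f x * g x) x = dp f x * g x + f x * dp g x"
    and "x \<in> U \<Longrightarrow> dq (\<lambda>x. f x * g x) x = dq f x * g x + f x * dq g x"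
proof -
  have *: "((\<lambda>x. f x * g x) has_derivative
     (\<lambda>h. (dp f x * g x + f x * dp g x) * fst h + (dq f x * g x + f x * dq g x) * snd h)) (at
       x)" if "x \<in> U" for x
    using has_derivative_mult[OF holo_on_has_derivative[OF f that] holo_on_has_derivative[OF g
      that]]
    by (rule has_derivative_eq_rhs) (auto simp: fun_eq_iff algebra_simps)
  then show "holo_on (\<lambda>x. f x * g x) U" unfolding holo_on_def by blast
  show "x \<in> U \<Longrightarrow> dp (\<lambda>x. f x * g x) x = dp f x * g x + f x * dp g x"
    by (rule dp_dq_eqI(1)[OF *])
  show "x \<in> U \<Longrightarrow> dq (\<lambda>x. f x * g x) x = dq f x * g x + f x * dq g x"
    by (rule dp_dq_eqI(2)[OF *])
qed

lemma holo_on_sum: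
  assumes "finite I" "\<And>i. i \<in> I \<Longrightarrow> holo_on (f i) U"
  shows "holo_on (\<lambda>x. \<Sum>i\<in>I. f i x) U"
    and "x \<in> U \<Longrightarrow> dp (\<lambda>x. \<Sum>i\<in>I. f i x) x = (\<Sum>i\<in>I. dp (f i) x)"
    and "x \<in> U \<Longrightarrow> dq (\<lambda>x. \<Sum>i\<in>I. f i x) x = (\<Sum>i\<in>I. dq (f i) x)"
proof -
  have "holo_on (\<lambda>x. \<Sum>i\<in>I. f i x) U \<and>
    (\<forall>x\<in>U. dp (\<lambda>x. \<Sum>i\<in>I. f i x) x = (\<Sum>i\<in>I. dp (f i) x) \<and>
       dq (\<lambda>x. \<Sum>i\<in>I. f i x) x = (\<Sum>i\<in>I. dq (f i) x))"
    using assms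
  proof (induction I rule: finite_induct)
    case empty
    show ?case by (auto simp: dp_def dq_def)
  next
    case (insert i I)
    then show ?case using holo_on_add[of "f i" U "\<lambda>x. \<Sum>i\<in>I. f i x"] by auto
  qed
  then show "holo_on (\<lambda>x. \<Sum>i\<in>I. f i x) U"
    "x \<in> U \<Longrightarrow> dp (\<lambda>x. \<Sum>i\<in>I. f i x) x = (\<Sum>i\<in>I. dp (f i) x)"
    "x \<in> U \<Longrightarrow> dq (\<lambda>x. \<Sum>i\<in>I. f i x) x = (\<Sum>i\<in>I. dq (f i) x)" by auto
qed

section \<open>Symbol calculus\<close>

lemma pd_add:
  assumes f: "holo_on f W" and g: "holo_on g W" and W: "open W" and x: "x \<in> W"
  shows "pd i j (\<lambda>y. f y + g y) x = pd i j f x + pd i j g x"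
  using x
proof (induction i arbitrary: x)
  case 0
  then show ?case
  proof (induction j arbitrary: x)
    case 0
    then show ?case by (simp add: pd_eq)
  next
    case (Suc j)
    have "dq (pd 0 j (\<lambda>y. f y + g y)) x = dq (\<lambda>y. pd 0 j f y + pd 0 j g y) x"
      by (rule dp_dq_cong_open[OF W Suc.prems Suc.IH])
    also have "\<dots> = dq (pd 0 j f) x + dq (pd 0 j g) x"
      by (rule holo_on_add(3)[OF holo_on_pd[OF f W] holo_on_pd[OF g W] Suc.prems])
    finally show ?case
      using Suc.prems by (simp add: dq_pd[OF _ W] f g holo_on_add)
  qed
next
  case (Suc i)
  have "dp (pd i j (\<lambda>y. f y + g y)) x = dp (\<lambda>y. pd i j f y + pd i j g y) x"
    by (rule dp_dq_cong_open[OF W Suc.prems Suc.IH])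
  also have "\<dots> = dp (pd i j f) x + dp (pd i j g) x"
    by (rule holo_on_add(2)[OF holo_on_pd[OF f W] holo_on_pd[OF g W] Suc.prems])
  finally show ?case by (simp add: dp_pd)
qed

lemma finite_degree_le: "finite {(i, j). int (i + j) \<le> n}"
  by (rule finite_subset[of _ "{..nat n} \<times> {..nat n}"]) auto

lemma finite_degree_eq: "finite {(i, j). int (i + j) = n}"
  by (rule finite_subset[OF _ finite_degree_le[of n]]) auto

text \<open>Writing the symbol over the index set of the whole operator lets both be compared term
  by term.\<close>

lemma sum_degree_eq:
  "(\<Sum>(i, j) | int (i + j) = n. g i j) =
   (\<Sum>(i, j) | int (i + j) \<le> n. if int (i + j) = n then g i j else (0::complex))"
  by (rule sum.mono_neutral_cong_left[OF finite_degree_le]) (auto split: if_splits)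

lemma has_symbolE:
  assumes "has_symbol U n P \<sigma>"
  obtains a where "\<And>i j. holo_on (a i j) U"
    "\<And>W f x. open W \<Longrightarrow> W \<subseteq> U \<Longrightarrow> holo_on f W \<Longrightarrow> x \<in> W \<Longrightarrow>
       P f x = (\<Sum>(i, j) | int (i + j) \<le> n. a i j x * pd i j f x)"
    "\<And>x \<xi>1 \<xi>2. x \<in> U \<Longrightarrow>
       \<sigma> (x, (\<xi>1, \<xi>2)) = (\<Sum>(i, j) | int (i + j) = n. a i j x * \<xi>1 ^ i * \<xi>2 ^ j)"
proof -
  obtain a where "has_coeffs U n P a"
    "\<forall>x\<in>U. \<forall>\<xi>1 \<xi>2. \<sigma> (x, (\<xi>1, \<xi>2)) = (\<Sum>(i, j) | int (i + j) = n. a i j x * \<xi>1 ^ i * \<xi>2 ^ j)"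
    using assms unfolding has_symbol_def by (elim exE conjE)
  then show ?thesis by (intro that[of a]) (simp_all add: has_coeffs_def)
qed

lemma has_symbolI:
  assumes "\<And>i j. holo_on (a i j) U"
    "\<And>W f x. open W \<Longrightarrow> W \<subseteq> U \<Longrightarrow> holo_on f W \<Longrightarrow> x \<in> W \<Longrightarrow>
       P f x = (\<Sum>(i, j) | int (i + j) \<le> n. a i j x * pd i j f x)"
    "\<And>x \<xi>1 \<xi>2. x \<in> U \<Longrightarrow>
       \<sigma> (x, (\<xi>1, \<xi>2)) = (\<Sum>(i, j) | int (i + j) = n. a i j x * \<xi>1 ^ i * \<xi>2 ^ j)"
  shows "has_symbol U n P \<sigma>"
  unfolding has_symbol_def has_coeffs_def
  by (intro exI[of _ a] conjI allI impI ballI; (elim conjE)?; rule assms; assumption)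

text \<open>Every coefficient family has a part in degree \<open>n\<close>, possibly zero, so order
  bounds can be handled by the symbol calculus.\<close>

lemma order_le_iff_has_symbol: "order_le U n P \<longleftrightarrow> (\<exists>\<sigma>. has_symbol U n P \<sigma>)"
proof
  assume "order_le U n P"
  then obtain a where a: "has_coeffs U n P a" unfolding order_le_def by blast
  define \<sigma> where "\<sigma> = (\<lambda>(x, (\<xi>1, \<xi>2)). \<Sum>(i, j) | int (i + j) = n. a i j x * \<xi>1 ^ i * \<xi>2 ^ j)"
  have "has_symbol U n P \<sigma>"
    unfolding has_symbol_def using a by (intro exI[of _ a]) (simp add: \<sigma>_def)
  then show "\<exists>\<sigma>. has_symbol U n P \<sigma>" by (rule exI[of _ \<sigma>])
qed (auto simp: order_le_def has_symbol_def)

lemma has_symbol_imp_order_le: "has_symbol U n P \<sigma> \<Longrightarrow> order_le U n P"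
  by (auto simp: order_le_iff_has_symbol)

lemma has_symbol_subset:
  assumes "has_symbol U n P \<sigma>" "V \<subseteq> U"
  shows "has_symbol V n P \<sigma>"
  using assms(1)
proof (rule has_symbolE)
  fix a assume a: "\<And>i j. holo_on (a i j) U"
    "\<And>W f x. open W \<Longrightarrow> W \<subseteq> U \<Longrightarrow> holo_on f W \<Longrightarrow> x \<in> W \<Longrightarrow>
       P f x = (\<Sum>(i, j) | int (i + j) \<le> n. a i j x * pd i j f x)"
    "\<And>x \<xi>1 \<xi>2. x \<in> U \<Longrightarrow>
       \<sigma> (x, (\<xi>1, \<xi>2)) = (\<Sum>(i, j) | int (i + j) = n. a i j x * \<xi>1 ^ i * \<xi>2 ^ j)"
  show ?thesis
  proof (rule has_symbolI[of a])
    show "holo_on (a i j) V" for i j using holo_on_subset[OF a(1) assms(2)] .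
    show "P f x = (\<Sum>(i, j) | int (i + j) \<le> n. a i j x * pd i j f x)"
      if "open W" "W \<subseteq> V" "holo_on f W" "x \<in> W" for W f x
      using a(2)[OF that(1) order_trans[OF that(2) assms(2)] that(3,4)] .
    show "\<sigma> (x, (\<xi>1, \<xi>2)) = (\<Sum>(i, j) | int (i + j) = n. a i j x * \<xi>1 ^ i * \<xi>2 ^ j)"
      if "x \<in> V" for x \<xi>1 \<xi>2
      using a(3)[OF subsetD[OF assms(2) that]] .
  qed
qed

lemma order_le_subset: "order_le U n P \<Longrightarrow> V \<subseteq> U \<Longrightarrow> order_le V n P"
  by (meson has_symbol_subset order_le_iff_has_symbol)

lemma has_symbol_cong:
  assumes "has_symbol U n P \<sigma>"
    and "\<And>W f x. open W \<Longrightarrow> W \<subseteq> U \<Longrightarrow> holo_on f W \<Longrightarrow> x \<in> W \<Longrightarrow> Q f x = P f x"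
    and "\<And>x \<xi>. x \<in> U \<Longrightarrow> \<tau> (x, \<xi>) = \<sigma> (x, \<xi>)"
  shows "has_symbol U n Q \<tau>"
  using assms(1)
proof (rule has_symbolE)
  fix a assume "\<And>i j. holo_on (a i j) U"
    "\<And>W f x. open W \<Longrightarrow> W \<subseteq> U \<Longrightarrow> holo_on f W \<Longrightarrow> x \<in> W \<Longrightarrow>
       P f x = (\<Sum>(i, j) | int (i + j) \<le> n. a i j x * pd i j f x)"
    "\<And>x \<xi>1 \<xi>2. x \<in> U \<Longrightarrow>
       \<sigma> (x, (\<xi>1, \<xi>2)) = (\<Sum>(i, j) | int (i + j) = n. a i j x * \<xi>1 ^ i * \<xi>2 ^ j)"
  then show ?thesis by (intro has_symbolI[of a]) (use assms(2,3) in auto)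
qed

section \<open>Symbols of sums, multiples, derivatives and compositions\<close>

lemma has_symbol_zero: "has_symbol U n (\<lambda>f x. 0) (\<lambda>_. 0)"
  by (rule has_symbolI[of "\<lambda>i j x. 0"]) auto

lemma has_symbol_add:
  assumes "has_symbol U n P \<sigma>" "has_symbol U n Q \<tau>"
  shows "has_symbol U n (\<lambda>f x. P f x + Q f x) (\<lambda>z. \<sigma> z + \<tau> z)"
proof -
  obtain a where a: "\<And>i j. holo_on (a i j) U"
    "\<And>W f x. open W \<Longrightarrow> W \<subseteq> U \<Longrightarrow> holo_on f W \<Longrightarrow> x \<in> W \<Longrightarrow>
       P f x = (\<Sum>(i, j) | int (i + j) \<le> n. a i j x * pd i j f x)"
    "\<And>x \<xi>1 \<xi>2. x \<in> U \<Longrightarrow>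
       \<sigma> (x, (\<xi>1, \<xi>2)) = (\<Sum>(i, j) | int (i + j) = n. a i j x * \<xi>1 ^ i * \<xi>2 ^ j)"
    using has_symbolE[OF assms(1)] by blast
  obtain b where b: "\<And>i j. holo_on (b i j) U"
    "\<And>W f x. open W \<Longrightarrow> W \<subseteq> U \<Longrightarrow> holo_on f W \<Longrightarrow> x \<in> W \<Longrightarrow>
       Q f x = (\<Sum>(i, j) | int (i + j) \<le> n. b i j x * pd i j f x)"
    "\<And>x \<xi>1 \<xi>2. x \<in> U \<Longrightarrow>
       \<tau> (x, (\<xi>1, \<xi>2)) = (\<Sum>(i, j) | int (i + j) = n. b i j x * \<xi>1 ^ i * \<xi>2 ^ j)"
    using has_symbolE[OF assms(2)] by blast
  show ?thesis
    by (rule has_symbolI[of "\<lambda>i j x. a i j x + b i j x"])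
       (auto simp: a b holo_on_add distrib_right split_beta simp flip: sum.distrib)
qed

lemma has_symbol_sum:
  assumes "finite I" "\<And>i. i \<in> I \<Longrightarrow> has_symbol U n (P i) (\<sigma> i)"
  shows "has_symbol U n (\<lambda>f x. \<Sum>i\<in>I. P i f x) (\<lambda>z. \<Sum>i\<in>I. \<sigma> i z)"
  using assms
proof (induction I rule: finite_induct)
  case empty
  show ?case using has_symbol_zero by simp
next
  case (insert i I)
  then show ?case using has_symbol_add[of U n "P i" "\<sigma> i"] by simp
qed

lemma has_symbol_monomial:
  assumes "holo_on c U" "int (i + j) \<le> n"
  shows "has_symbol U n (\<lambda>f x. c x * pd i j f x)
    (\<lambda>z. if int (i + j) = n then c (fst z) * fst (snd z) ^ i * snd (snd z) ^ j else 0)"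
proof (rule has_symbolI[of "\<lambda>i' j'. if (i', j') = (i, j) then c else (\<lambda>_. 0)"], goal_cases)
  case (1 i' j')
  then show ?case using assms by auto
next
  case (2 W f x)
  have "(\<Sum>(i', j') | int (i' + j') \<le> n. (if (i', j') = (i, j) then c else (\<lambda>_. 0)) x * pd i' j' f x)
     = (\<Sum>z\<in>{(i', j'). int (i' + j') \<le> n}. if z = (i, j) then c x * pd i j f x else 0)"
    by (rule sum.cong) (auto split: if_splits)
  also have "\<dots> = c x * pd i j f x" using assms(2) by (subst sum.delta[OF finite_degree_le]) simp
  finally show ?case ..
next
  case (3 x \<xi>1 \<xi>2)
  have "(\<Sum>(i', j') | int (i' + j') = n. (if (i', j') = (i, j) then c else (\<lambda>_. 0)) x * \<xi>1 ^ i' *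
    \<xi>2 ^ j')
     = (\<Sum>z\<in>{(i', j'). int (i' + j') = n}. if z = (i, j) then c x * \<xi>1 ^ i * \<xi>2 ^ j else 0)"
    by (rule sum.cong) (auto split: if_splits)
  also have "\<dots> = (if int (i + j) = n then c x * \<xi>1 ^ i * \<xi>2 ^ j else 0)" by (subst sum.delta[OF
    finite_degree_eq]) simp
  finally show ?case by simp
qed

text \<open>Locality: \<open>f\<close> and \<open>g\<close> are different total functions in
  general, so the equality has to pass through the coefficient formula, which sees only derivatives
  at points of \<open>W\<close>.\<close>

lemma order_le_cong_on:
  assumes "order_le U n P" "open W" "W \<subseteq> U" "holo_on f W" "\<And>y. y \<in> W \<Longrightarrow> f y = g y" "x \<in> W"
  shows "P f x = P g x"
proof -
  obtain a where "has_coeffs U n P a" using assms(1) unfolding order_le_def by blast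
  moreover have "holo_on g W" using holo_on_cong_open assms by blast
  ultimately show ?thesis
    using assms pd_cong_open[OF assms(2,6,5)] unfolding has_coeffs_def by simp
qed

lemma order_le_add_on:
  assumes "order_le U n P" "open W" "W \<subseteq> U" "holo_on f W" "holo_on g W" "x \<in> W"
  shows "P (\<lambda>y. f y + g y) x = P f x + P g x"
proof -
  obtain a where a: "has_coeffs U n P a" using assms(1) unfolding order_le_def by blast
  have "P h x = (\<Sum>(i, j) | int (i + j) \<le> n. a i j x * pd i j h x)" if "holo_on h W" for h
    using a assms that unfolding has_coeffs_def by blast
  then show ?thesis
    using assms by (simp add: holo_on_add pd_add split_beta algebra_simps sum.distrib)
qed

lemma order_le_zero_on:
  assumes "order_le U n P" "open W" "W \<subseteq> U" "x \<in> W"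
  shows "P (\<lambda>_. 0) x = 0"
  using order_le_add_on[OF assms(1-3), of "\<lambda>_. 0" "\<lambda>_. 0" x] assms(4) by simp

lemma order_le_holo_on:
  assumes "order_le U n P" "open W" "W \<subseteq> U" "holo_on f W"
  shows "holo_on (P f) W"
proof -
  obtain a where a: "has_coeffs U n P a" using assms(1) unfolding order_le_def by blast
  have "holo_on (a i j) W" for i j
    using a assms(3) holo_on_subset unfolding has_coeffs_def by blast
  then have "holo_on (\<lambda>x. \<Sum>t\<in>{(i, j). int (i + j) \<le> n}. a (fst t) (snd t) x * pd (fst t) (snd t)
    f x) W"
    by (rule holo_on_sum(1)[OF finite_degree_le holo_on_mult(1)[OF _ holo_on_pd[OF assms(4,2)]]])
  then show ?thesis
    by (rule holo_on_cong_open[OF assms(2)])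
       (use a assms in \<open>simp add: has_coeffs_def split_beta\<close>)
qed

text \<open>Coefficients of degree above \<open>n\<close> are unconstrained by
  \<open>has_coeffs\<close>, so the given family cannot simply be reused in degree \<open>m\<close>;
  the operator is rebuilt from its monomials of degree at most \<open>n\<close>.\<close>

lemma has_symbol_lift:
  assumes "has_symbol U n P \<sigma>" "n < m"
  shows "has_symbol U m P (\<lambda>_. 0)"
  using assms(1)
proof (rule has_symbolE)
  fix a assume a: "\<And>i j. holo_on (a i j) U"
    "\<And>W f x. open W \<Longrightarrow> W \<subseteq> U \<Longrightarrow> holo_on f W \<Longrightarrow> x \<in> W \<Longrightarrow>
       P f x = (\<Sum>(i, j) | int (i + j) \<le> n. a i j x * pd i j f x)"
  let ?T = "{(i, j). int (i + j) \<le> n}"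
  have "has_symbol U m (\<lambda>f x. \<Sum>t\<in>?T. a (fst t) (snd t) x * pd (fst t) (snd t) f x) (\<lambda>z. \<Sum>t\<in>?T.
    if int (fst t + snd t) = m
     then a (fst t) (snd t) (fst z) * fst (snd z) ^ fst t * snd (snd z) ^ snd t else 0)"
    by (intro has_symbol_sum has_symbol_monomial a finite_degree_le) (use assms(2) in auto)
  then show ?thesis
    by (rule has_symbol_cong) (use assms(2) in \<open>auto simp: a(2) split_beta intro!: sum.neutral\<close>)
qed

lemma order_le_mono: "order_le U n P \<Longrightarrow> n \<le> m \<Longrightarrow> order_le U m P"
  by (metis has_symbol_lift order_le_iff_has_symbol order_le_less)

lemma has_symbol_mult:
  assumes "has_symbol U n P \<sigma>" "holo_on c U"
  shows "has_symbol U n (\<lambda>f x. c x * P f x) (\<lambda>z. c (fst z) * \<sigma> z)"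
  using assms(1)
proof (rule has_symbolE)
  fix a assume a: "\<And>i j. holo_on (a i j) U"
    "\<And>W f x. open W \<Longrightarrow> W \<subseteq> U \<Longrightarrow> holo_on f W \<Longrightarrow> x \<in> W \<Longrightarrow>
       P f x = (\<Sum>(i, j) | int (i + j) \<le> n. a i j x * pd i j f x)"
    "\<And>x \<xi>1 \<xi>2. x \<in> U \<Longrightarrow>
       \<sigma> (x, (\<xi>1, \<xi>2)) = (\<Sum>(i, j) | int (i + j) = n. a i j x * \<xi>1 ^ i * \<xi>2 ^ j)"
  show ?thesis
    by (rule has_symbolI[of "\<lambda>i j x. c x * a i j x"])
       (use assms(2) a in \<open>auto simp: holo_on_mult sum_distrib_left split_beta mult_ac\<close>)
qed

text \<open>Both partial derivatives at once: \<open>d\<close> is one of them and \<open>e\<close>, \<open>e'\<close> are the increments of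
  the exponents.\<close>

lemma has_symbol_derivation:
  fixes d :: oper and e e' :: nat
  assumes P: "has_symbol U n P \<sigma>" and U: "open U" and e: "e + e' = 1"
    and d_holo: "\<And>f W. holo_on f W \<Longrightarrow> open W \<Longrightarrow> holo_on (d f) W"
    and d_mult: "\<And>f g W x. holo_on f W \<Longrightarrow> holo_on g W \<Longrightarrow> x \<in> W \<Longrightarrow> d (\<lambda>x. f x * g x) x = d f x * g x
      + f x * d g x"
    and d_sum: "\<And>(f :: nat \<times> nat \<Rightarrow> _) W x I. finite I \<Longrightarrow> (\<And>i. i \<in> I \<Longrightarrow> holo_on (f i) W) \<Longrightarrow> x \<in> W \<Longrightarrow>
      d (\<lambda>x. \<Sum>i\<in>I. f i x) x = (\<Sum>i\<in>I. d (f i) x)"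
    and d_cong: "\<And>f g W x. open W \<Longrightarrow> x \<in> W \<Longrightarrow> (\<And>y. y \<in> W \<Longrightarrow> f y = g y) \<Longrightarrow> d f x = d g x"
    and d_pd: "\<And>f W x i j. holo_on f W \<Longrightarrow> open W \<Longrightarrow> x \<in> W \<Longrightarrow> d (pd i j f) x = pd (i + e) (j + e') f x"
  shows "has_symbol U (n + 1) (\<lambda>f. d (P f)) (\<lambda>z. fst (snd z) ^ e * snd (snd z) ^ e' * \<sigma> z)"
  using P
proof (rule has_symbolE)
  fix a assume a: "\<And>i j. holo_on (a i j) U"
    "\<And>W f x. open W \<Longrightarrow> W \<subseteq> U \<Longrightarrow> holo_on f W \<Longrightarrow> x \<in> W \<Longrightarrow>
       P f x = (\<Sum>(i, j) | int (i + j) \<le> n. a i j x * pd i j f x)"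
    "\<And>x \<xi>1 \<xi>2. x \<in> U \<Longrightarrow>
       \<sigma> (x, (\<xi>1, \<xi>2)) = (\<Sum>(i, j) | int (i + j) = n. a i j x * \<xi>1 ^ i * \<xi>2 ^ j)"
  let ?T = "{(i, j). int (i + j) \<le> n}"
  \<comment> \<open>Product rule: the terms in which \<open>d\<close> hits a coefficient keep degree
    at most \<open>n\<close> and leave the symbol alone; those in which it hits \<open>pd\<close>
    raise the degree by one.\<close>
  have "has_symbol U (n + 1)
     (\<lambda>f x. \<Sum>t\<in>?T. d (a (fst t) (snd t)) x * pd (fst t) (snd t) f x + a (fst t) (snd t) x * pd
       (fst t + e) (snd t + e') f x)
     (\<lambda>z. \<Sum>t\<in>?T.
       (if int (fst t + snd t) = n + 1 then d (a (fst t) (snd t)) (fst z) * fst (snd z) ^ fst t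
         * snd (snd z) ^ snd t else 0) +
       (if int (fst t + e + (snd t + e')) = n + 1 then a (fst t) (snd t) (fst z) * fst (snd z) ^
         (fst t + e) * snd (snd z) ^ (snd t + e') else 0))"
    by (intro has_symbol_sum has_symbol_add has_symbol_monomial a d_holo U finite_degree_le)
      (use e in auto)
  then show ?thesis
  proof (rule has_symbol_cong, goal_cases)
    case (1 W f x)
    note W = 1
    note aW = holo_on_subset[OF a(1) W(2)]
    note h = holo_on_mult(1)[OF aW holo_on_pd[OF W(3) W(1)]]
    have "d (P f) x = d (\<lambda>x. \<Sum>t\<in>?T. a (fst t) (snd t) x * pd (fst t) (snd t) f x) x"
      by (rule d_cong[OF W(1,4)]) (use a(2) W in \<open>auto simp: split_beta\<close>)
    also have "\<dots> = (\<Sum>t\<in>?T. d (\<lambda>x. a (fst t) (snd t) x * pd (fst t) (snd t) f x) x)"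
      by (rule d_sum[OF finite_degree_le h W(4)])
    also have "\<dots> = (\<Sum>t\<in>?T. d (a (fst t) (snd t)) x * pd (fst t) (snd t) f x + a (fst t) (snd t)
      x * pd (fst t + e) (snd t + e') f x)"
      by (simp add: d_mult[OF aW holo_on_pd[OF W(3) W(1)] W(4)] d_pd[OF W(3) W(1) W(4)])
    finally show ?case .
  next
    case (2 x \<xi>)
    obtain \<xi>1 \<xi>2 where \<xi>: "\<xi> = (\<xi>1, \<xi>2)" by (cases \<xi>)
    have *: "int (i + e + (j + e')) = n + 1 \<longleftrightarrow> int (i + j) = n" for i j using e by linarith
    have "int (fst t + snd t) \<noteq> n + 1" if "t \<in> ?T" for t using that by auto
    then show ?case
      unfolding \<xi> a(3)[OF 2] sum_degree_eq split_beta sum_distrib_left fst_conv snd_conv *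
      by (intro sum.cong refl) (simp add: power_add mult_ac)
  qed
qed

lemma has_symbol_dp:
  assumes "has_symbol U n P \<sigma>" "open U"
  shows "has_symbol U (n + 1) (\<lambda>f. dp (P f)) (\<lambda>z. fst (snd z) * \<sigma> z)"
proof -
  have "has_symbol U (n + 1) (\<lambda>f. dp (P f)) (\<lambda>z. fst (snd z) ^ 1 * snd (snd z) ^ 0 * \<sigma> z)"
  proof (rule has_symbol_derivation[where d = dp, OF assms])
    show "dp (pd i j f) x = pd (i + 1) (j + 0) f x" for f x i j by (simp add: dp_pd)
  qed (fact holo_on_dp holo_on_mult(2) holo_on_sum(2) dp_dq_cong_open(1) | simp)+
  then show ?thesis by simp
qed

lemma has_symbol_dq:
  assumes "has_symbol U n P \<sigma>" "open U"
  shows "has_symbol U (n + 1) (\<lambda>f. dq (P f)) (\<lambda>z. snd (snd z) * \<sigma> z)"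
proof -
  have "has_symbol U (n + 1) (\<lambda>f. dq (P f)) (\<lambda>z. fst (snd z) ^ 0 * snd (snd z) ^ 1 * \<sigma> z)"
  proof (rule has_symbol_derivation[where d = dq, OF assms])
    show "dq (pd i j f) x = pd (i + 0) (j + 1) f x" if "holo_on f W" "open W" "x \<in> W" for f W x i j
      using dq_pd[OF that] by simp
  qed (fact holo_on_dq holo_on_mult(3) holo_on_sum(3) dp_dq_cong_open(2) | simp)+
  then show ?thesis by simp
qed

lemma has_symbol_pd:
  assumes "has_symbol U n P \<sigma>" "open U"
  shows "has_symbol U (n + int (i + j)) (\<lambda>f. pd i j (P f)) (\<lambda>z. fst (snd z) ^ i * snd (snd z) ^
    j * \<sigma> z)"
proof -
  have "has_symbol U (n + int j) (\<lambda>f. (dq ^^ j) (P f)) (\<lambda>z. snd (snd z) ^ j * \<sigma> z)"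
  proof (induction j)
    case (Suc j)
    then show ?case using has_symbol_dq[OF Suc.IH assms(2)] by (simp add: add_ac mult_ac)
  qed (use assms in simp)
  note q = this
  have "has_symbol U (n + int j + int i) (\<lambda>f. (dp ^^ i) ((dq ^^ j) (P f))) (\<lambda>z. fst (snd z) ^ i
    * (snd (snd z) ^ j * \<sigma> z))"
  proof (induction i)
    case (Suc i)
    then show ?case using has_symbol_dp[OF Suc.IH assms(2)] by (simp add: add_ac mult_ac)
  qed (use q in simp)
  then show ?thesis by (simp add: pd_eq add_ac mult_ac)
qed

text \<open>Expanding \<open>P\<close> leaves terms \<open>pd i j (Q f)\<close> with coefficients in
  front. Only those with \<open>i + j = m\<close> reach degree \<open>m + n\<close>; the others have
  smaller order and are lifted with symbol zero.\<close>

lemma has_symbol_comp: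
  assumes P: "has_symbol U m P \<sigma>" and Q: "has_symbol U n Q \<tau>" and U: "open U"
  shows "has_symbol U (m + n) (P \<circ> Q) (\<lambda>z. \<sigma> z * \<tau> z)"
  using P
proof (rule has_symbolE)
  fix a assume a: "\<And>i j. holo_on (a i j) U"
    "\<And>W f x. open W \<Longrightarrow> W \<subseteq> U \<Longrightarrow> holo_on f W \<Longrightarrow> x \<in> W \<Longrightarrow>
       P f x = (\<Sum>(i, j) | int (i + j) \<le> m. a i j x * pd i j f x)"
    "\<And>x \<xi>1 \<xi>2. x \<in> U \<Longrightarrow>
       \<sigma> (x, (\<xi>1, \<xi>2)) = (\<Sum>(i, j) | int (i + j) = m. a i j x * \<xi>1 ^ i * \<xi>2 ^ j)"
  let ?T = "{(i, j). int (i + j) \<le> m}"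
  have "has_symbol U (m + n) (\<lambda>f. pd i j (Q f))
     (\<lambda>z. if int (i + j) = m then fst (snd z) ^ i * snd (snd z) ^ j * \<tau> z else 0)"
    if "int (i + j) \<le> m" for i j
  proof (cases "int (i + j) = m")
    case True
    then show ?thesis using has_symbol_pd[OF Q U, of i j] by (simp add: add_ac)
  next
    case False
    then show ?thesis
      using that has_symbol_lift[OF has_symbol_pd[OF Q U, of i j], of "m + n"] by simp
  qed
  then have "has_symbol U (m + n) (\<lambda>f. pd (fst t) (snd t) (Q f))
     (\<lambda>z. if int (fst t + snd t) = m then fst (snd z) ^ fst t * snd (snd z) ^ snd t * \<tau> z else 0)"
    if "t \<in> ?T" for t using that by (simp add: split_beta)
  then have "has_symbol U (m + n) (\<lambda>f x. \<Sum>t\<in>?T. a (fst t) (snd t) x * pd (fst t) (snd t) (Q f) x)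
     (\<lambda>z. \<Sum>t\<in>?T. a (fst t) (snd t) (fst z) * (if int (fst t + snd t) = m then fst (snd z) ^ fst
       t * snd (snd z) ^ snd t * \<tau> z else 0))"
    by (intro has_symbol_sum has_symbol_mult a finite_degree_le)
  then show ?thesis
  proof (rule has_symbol_cong, goal_cases)
    case (1 W f x)
    have "holo_on (Q f) W"
      using order_le_holo_on[OF has_symbol_imp_order_le[OF Q]] 1 by blast
    then show ?case using 1 a(2) by (simp add: split_beta)
  next
    case (2 x \<xi>)
    obtain \<xi>1 \<xi>2 where \<xi>: "\<xi> = (\<xi>1, \<xi>2)" by (cases \<xi>)
    show ?case
      unfolding \<xi> a(3)[OF 2] sum_degree_eq split_beta sum_distrib_right fst_conv snd_conv
      by (intro sum.cong refl) (simp add: mult_ac)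
  qed
qed

lemma sum_degree_eq_int:
  fixes g :: "nat \<Rightarrow> nat \<Rightarrow> complex"
  shows "(\<Sum>(i, j) | int (i + j) = int N. g i j) = (\<Sum>i\<le>N. g i (N - i))"
  by (rule sum.reindex_bij_witness[of _ "\<lambda>i. (i, N - i)" fst]) (auto simp flip: of_nat_add)

lemma has_symbol_0_imp_order_le:
  assumes "has_symbol U n P \<sigma>" "\<And>x \<xi>. x \<in> U \<Longrightarrow> \<sigma> (x, \<xi>) = 0"
  shows "order_le U (n - 1) P"
  using assms(1)
proof (rule has_symbolE)
  fix a assume a: "\<And>i j. holo_on (a i j) U"
    "\<And>W f x. open W \<Longrightarrow> W \<subseteq> U \<Longrightarrow> holo_on f W \<Longrightarrow> x \<in> W \<Longrightarrow>
       P f x = (\<Sum>(i, j) | int (i + j) \<le> n. a i j x * pd i j f x)"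
    "\<And>x \<xi>1 \<xi>2. x \<in> U \<Longrightarrow>
       \<sigma> (x, (\<xi>1, \<xi>2)) = (\<Sum>(i, j) | int (i + j) = n. a i j x * \<xi>1 ^ i * \<xi>2 ^ j)"
  have 0: "a i j x = 0" if x: "x \<in> U" and ij: "int (i + j) = n" for i j x
  proof -
    define N where "N = i + j"
    \<comment> \<open>Setting the second covariable to 1 turns the binary form into a polynomial in
      one variable with the same coefficients.\<close>
    have "(\<Sum>i\<le>N. a i (N - i) x * t ^ i) = 0" for t
      using a(3)[OF x, of t 1] assms(2)[OF x]
      unfolding ij[symmetric] N_def[symmetric] sum_degree_eq_int by simp
    then have "\<forall>i\<le>N. a i (N - i) x = 0"
      using polyfun_eq_0[of "\<lambda>i. a i (N - i) x" N] by blast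
    moreover have "i \<le> N" "N - i = j" by (simp_all add: N_def)
    ultimately show ?thesis by metis
  qed
  have "has_coeffs U (n - 1) P a"
    unfolding has_coeffs_def
  proof (intro conjI allI impI ballI a(1))
    fix W f x assume W: "open W \<and> W \<subseteq> U \<and> holo_on f W" and x: "x \<in> W"
    have "(\<Sum>(i, j) | int (i + j) \<le> n - 1. a i j x * pd i j f x) =
       (\<Sum>(i, j) | int (i + j) \<le> n. a i j x * pd i j f x)"
    proof (rule sum.mono_neutral_left[OF finite_degree_le]; (intro ballI)?)
      fix t assume "t \<in> {(i, j). int (i + j) \<le> n} - {(i, j). int (i + j) \<le> n - 1}"
      then have "int (fst t + snd t) = n" by (simp add: split_beta)
      moreover have "x \<in> U" using W x by blast
      ultimately show "(case t of (i, j) \<Rightarrow> a i j x * pd i j f x) = 0"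
        using 0 by (simp add: split_beta)
    qed auto
    then show "P f x = (\<Sum>(i, j) | int (i + j) \<le> n - 1. a i j x * pd i j f x)"
      using a(2)[of W f x] W x by simp
  qed
  then show ?thesis unfolding order_le_def by blast
qed

lemma has_symbol_uminus: "has_symbol U n P \<sigma> \<Longrightarrow> has_symbol U n (\<lambda>f x. - P f x) (\<lambda>z. - \<sigma> z)"
  using has_symbol_mult[of U n P \<sigma> "\<lambda>_. - 1"] by simp

lemma has_symbol_id: "has_symbol U 0 id (\<lambda>_. 1)"
  by (rule has_symbol_cong[OF has_symbol_monomial[of "\<lambda>_. 1" U 0 0 0]]) (auto simp: pd_eq)

lemma has_symbol_funpow:
  assumes "has_symbol U n P \<sigma>" "open U"
  shows "has_symbol U (int N * n) (P ^^ N) (\<lambda>z. \<sigma> z ^ N)"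
proof (induction N)
  case 0
  show ?case using has_symbol_id by (simp add: id_def)
next
  case (Suc N)
  show ?case using has_symbol_comp[OF assms(1) Suc.IH assms(2)] by (simp add: algebra_simps
    comp_def)
qed

section \<open>Stalks and good filtrations\<close>

lemma DstalkE:
  assumes "P \<in> Dstalk x"
  obtains U n where "open U" "x \<in> U" "order_le U n P"
  using assms by (auto simp: Dstalk_def Dfilt_def)

lemma DfiltE:
  assumes "P \<in> Dfilt x n"
  obtains U \<sigma> where "open U" "x \<in> U" "has_symbol U n P \<sigma>"
  using assms by (auto simp: Dfilt_def order_le_iff_has_symbol)

lemma DfiltI: "open U \<Longrightarrow> x \<in> U \<Longrightarrow> has_symbol U n P \<sigma> \<Longrightarrow> P \<in> Dfilt x n"
  by (auto simp: Dfilt_def order_le_iff_has_symbol)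

lemma Dfilt_subset_Dstalk: "Dfilt x n \<subseteq> Dstalk x"
  by (auto simp: Dstalk_def)

lemma Dfilt_in_Dstalk: "P \<in> Dfilt x n \<Longrightarrow> P \<in> Dstalk x"
  using Dfilt_subset_Dstalk by blast

lemma Dfilt_mono: "m \<le> n \<Longrightarrow> Dfilt x m \<subseteq> Dfilt x n"
  by (auto simp: Dfilt_def intro: order_le_mono)

lemma Dfilt_zero: "0 \<in> Dfilt x n"
  using DfiltI[OF open_UNIV UNIV_I has_symbol_zero] by (simp add: zero_fun_def)

lemma Dfilt_id: "id \<in> Dfilt x 0"
  by (rule DfiltI[OF open_UNIV UNIV_I has_symbol_id])

lemma Dfilt_add:
  assumes "P \<in> Dfilt x n" "Q \<in> Dfilt x n"
  shows "P + Q \<in> Dfilt x n"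
proof -
  obtain U \<sigma> where U: "open U" "x \<in> U" "has_symbol U n P \<sigma>" using assms(1) by (rule DfiltE)
  obtain V \<tau> where V: "open V" "x \<in> V" "has_symbol V n Q \<tau>" using assms(2) by (rule DfiltE)
  have "has_symbol (U \<inter> V) n (\<lambda>f x. P f x + Q f x) (\<lambda>z. \<sigma> z + \<tau> z)"
    by (intro has_symbol_add has_symbol_subset[OF U(3)] has_symbol_subset[OF V(3)]) auto
  then have "(\<lambda>f x. P f x + Q f x) \<in> Dfilt x n"
    by (rule DfiltI[rotated 2]) (use U V in auto)
  then show ?thesis by (simp add: plus_fun_def)
qed

lemma Dfilt_uminus:
  assumes "P \<in> Dfilt x n"
  shows "- P \<in> Dfilt x n"
proof -
  obtain U \<sigma> where U: "open U" "x \<in> U" "has_symbol U n P \<sigma>" using assms(1) by (rule DfiltE)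
  have "(\<lambda>f x. - P f x) \<in> Dfilt x n" by (rule DfiltI[OF U(1,2) has_symbol_uminus[OF U(3)]])
  then show ?thesis by (simp add: fun_Compl_def)
qed

lemma Dfilt_diff: "P \<in> Dfilt x n \<Longrightarrow> Q \<in> Dfilt x n \<Longrightarrow> P - Q \<in> Dfilt x n"
  using Dfilt_add[of P x n "- Q"] Dfilt_uminus[of Q x n] by simp

lemma Dfilt_comp:
  assumes "P \<in> Dfilt x m" "Q \<in> Dfilt x n"
  shows "P \<circ> Q \<in> Dfilt x (m + n)"
proof -
  obtain U \<sigma> where U: "open U" "x \<in> U" "has_symbol U m P \<sigma>" using assms(1) by (rule DfiltE)
  obtain V \<tau> where V: "open V" "x \<in> V" "has_symbol V n Q \<tau>" using assms(2) by (rule DfiltE)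
  have "has_symbol (U \<inter> V) (m + n) (P \<circ> Q) (\<lambda>z. \<sigma> z * \<tau> z)"
    by (intro has_symbol_comp has_symbol_subset[OF U(3)] has_symbol_subset[OF V(3)] open_Int U
      V) auto
  then show ?thesis
    by (rule DfiltI[rotated 2]) (use U V in auto)
qed

text \<open>The commutator estimate: symbols commute, so the leading terms cancel. It is stated for
  two operators with a common symbol because it will be applied with \<open>R k 1 1\<close> on one
  side and \<open>R k 2 2\<close> on the other.\<close>

lemma Dfilt_comp_diff:
  assumes "P \<in> Dfilt x n" "open U" "x \<in> U" "has_symbol U m Q \<sigma>" "has_symbol U m Q' \<sigma>"
  shows "(Q \<circ> P) - (P \<circ> Q') \<in> Dfilt x (m + n - 1)"
proof -
  obtain V \<tau> where V: "open V" "x \<in> V" "has_symbol V n P \<tau>" using assms(1) by (rule DfiltE)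
  let ?W = "U \<inter> V"
  have W: "open ?W" "x \<in> ?W" using assms V by auto
  note s = has_symbol_subset[OF assms(4), of ?W] has_symbol_subset[OF assms(5), of ?W]
     has_symbol_subset[OF V(3), of ?W]
  have "has_symbol ?W (m + n) (Q \<circ> P) (\<lambda>z. \<sigma> z * \<tau> z)" "has_symbol ?W (n + m) (P \<circ> Q') (\<lambda>z. \<tau> z
    * \<sigma> z)"
    by (intro has_symbol_comp s W; simp)+
  then have "has_symbol ?W (m + n) (\<lambda>f x. (Q \<circ> P) f x + - (P \<circ> Q') f x) (\<lambda>z. \<sigma> z * \<tau> z + - (\<tau> z
    * \<sigma> z))"
    unfolding add.commute[of n m] by (rule has_symbol_add[OF _ has_symbol_uminus])
  then have "order_le ?W (m + n - 1) (\<lambda>f x. (Q \<circ> P) f x + - (P \<circ> Q') f x)"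
    by (rule has_symbol_0_imp_order_le) simp
  then have "(\<lambda>f x. (Q \<circ> P) f x + - (P \<circ> Q') f x) \<in> Dfilt x (m + n - 1)"
    using W unfolding Dfilt_def by blast
  then show ?thesis by (simp add: fun_diff_def)
qed

lemma Dstalk_to_Dfilt: "P \<in> Dstalk x \<Longrightarrow> \<exists>n. P \<in> Dfilt x n"
  by (auto simp: Dstalk_def)

lemma Dstalk_common:
  assumes "P \<in> Dstalk x" "Q \<in> Dstalk x"
  obtains n where "P \<in> Dfilt x n" "Q \<in> Dfilt x n"
proof -
  obtain m n where "P \<in> Dfilt x m" "Q \<in> Dfilt x n" using assms by (auto simp: Dstalk_def)
  then have "P \<in> Dfilt x (max m n)" "Q \<in> Dfilt x (max m n)"
    using Dfilt_mono by (meson max.cobounded1 max.cobounded2 subsetD)+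
  then show ?thesis by (rule that)
qed

lemma Dstalk_add: "P \<in> Dstalk x \<Longrightarrow> Q \<in> Dstalk x \<Longrightarrow> P + Q \<in> Dstalk x"
  by (meson Dstalk_common Dfilt_add Dfilt_subset_Dstalk subsetD)

lemma Dstalk_uminus: "P \<in> Dstalk x \<Longrightarrow> - P \<in> Dstalk x"
  by (meson Dstalk_to_Dfilt Dfilt_uminus Dfilt_subset_Dstalk subsetD)

lemma Dstalk_comp: "P \<in> Dstalk x \<Longrightarrow> Q \<in> Dstalk x \<Longrightarrow> P \<circ> Q \<in> Dstalk x"
  by (meson Dstalk_to_Dfilt Dfilt_comp Dfilt_subset_Dstalk subsetD)

lemma Dstalk_zero: "0 \<in> Dstalk x"
  using Dfilt_zero Dfilt_subset_Dstalk by blast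

lemma Dstalk_id: "id \<in> Dstalk x"
  using Dfilt_id Dfilt_subset_Dstalk by blast

lemma Dstalk_sum: "(\<And>i. i \<in> I \<Longrightarrow> P i \<in> Dstalk x) \<Longrightarrow> (\<Sum>i\<in>I. P i) \<in> Dstalk x"
  by (induction I rule: infinite_finite_induct) (auto simp: Dstalk_zero Dstalk_add)

section \<open>Equality of germs and its compatibility with composition\<close>

lemma same_germI:
  assumes "open U" "x \<in> U"
    "\<And>W f y. open W \<Longrightarrow> W \<subseteq> U \<Longrightarrow> holo_on f W \<Longrightarrow> y \<in> W \<Longrightarrow> P f y = Q f y"
  shows "same_germ x P Q"
  unfolding same_germ_def
  by (intro exI[of _ U] conjI allI impI ballI assms(1,2); elim conjE; rule assms(3); assumption)

lemma same_germE:
  assumes "same_germ x P Q"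
  obtains U where "open U" "x \<in> U"
    "\<forall>W f. open W \<and> W \<subseteq> U \<and> holo_on f W \<longrightarrow> (\<forall>y\<in>W. P f y = Q f y)"
  using assms unfolding same_germ_def by blast

lemma same_germ_refl: "same_germ x P P"
  by (rule same_germI[OF open_UNIV]) auto

lemma same_germ_sym: "same_germ x P Q \<Longrightarrow> same_germ x Q P"
  unfolding same_germ_def by metis

lemma same_germ_trans:
  assumes "same_germ x P Q" "same_germ x Q R"
  shows "same_germ x P R"
proof -
  obtain U where U: "open U" "x \<in> U"
    "\<forall>W f. open W \<and> W \<subseteq> U \<and> holo_on f W \<longrightarrow> (\<forall>y\<in>W. P f y = Q f y)"
    using assms(1) by (rule same_germE) 
  obtain V where V: "open V" "x \<in> V"
    "\<forall>W f. open W \<and> W \<subseteq> V \<and> holo_on f W \<longrightarrow> (\<forall>y\<in>W. Q f y = R f y)"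
    using assms(2) by (rule same_germE)
  show ?thesis by (rule same_germI[of "U \<inter> V"]) (use U V in auto)
qed

lemma same_germ_add:
  assumes "same_germ x P P'" "same_germ x Q Q'"
  shows "same_germ x (P + Q) (P' + Q')"
proof -
  obtain U where U: "open U" "x \<in> U"
    "\<forall>W f. open W \<and> W \<subseteq> U \<and> holo_on f W \<longrightarrow> (\<forall>y\<in>W. P f y = P' f y)"
    using assms(1) by (rule same_germE) 
  obtain V where V: "open V" "x \<in> V"
    "\<forall>W f. open W \<and> W \<subseteq> V \<and> holo_on f W \<longrightarrow> (\<forall>y\<in>W. Q f y = Q' f y)"
    using assms(2) by (rule same_germE)
  show ?thesis by (rule same_germI[of "U \<inter> V"]) (use U V in auto)
qed

lemma same_germ_comp:
  assumes P: "P \<in> Dstalk x" and Q: "Q \<in> Dstalk x" "same_germ x Q Q'"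
  shows "same_germ x (P \<circ> Q) (P \<circ> Q')"
proof -
  obtain U m where U: "open U" "x \<in> U" "order_le U m P" using P by (rule DstalkE)
  obtain V n where V: "open V" "x \<in> V" "order_le V n Q" using Q(1) by (rule DstalkE)
  obtain T where T: "open T" "x \<in> T"
    "\<forall>W f. open W \<and> W \<subseteq> T \<and> holo_on f W \<longrightarrow> (\<forall>y\<in>W. Q f y = Q' f y)"
    using Q(2) by (rule same_germE)
  show ?thesis
  proof (rule same_germI[of "U \<inter> V \<inter> T"])
    fix W f y assume W: "open W" "W \<subseteq> U \<inter> V \<inter> T" "holo_on f W" "y \<in> W"
    have "holo_on (Q f) W" by (rule order_le_holo_on[OF V(3) W(1) _ W(3)]) (use W in auto)
    moreover have "Q f t = Q' f t" if "t \<in> W" for t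
      using T(3) W that by blast
    ultimately have "P (Q f) y = P (Q' f) y"
      using W by (intro order_le_cong_on[OF U(3) W(1)]) auto
    then show "(P \<circ> Q) f y = (P \<circ> Q') f y" by simp
  qed (use U V T in auto)
qed

text \<open>As a map on total functions \<open>P\<close> need not be additive, so this law holds for
  germs only; distributivity in the left factor of a composition holds on the nose.\<close>

lemma same_germ_comp_add:
  assumes P: "P \<in> Dstalk x" and Q: "Q \<in> Dstalk x" "Q' \<in> Dstalk x"
  shows "same_germ x (P \<circ> (Q + Q')) ((P \<circ> Q) + (P \<circ> Q'))"
proof -
  obtain U m where U: "open U" "x \<in> U" "order_le U m P" using P by (rule DstalkE)
  obtain V n where V: "open V" "x \<in> V" "order_le V n Q" using Q(1) by (rule DstalkE)
  obtain V' n' where V': "open V'" "x \<in> V'" "order_le V' n' Q'" using Q(2) by (rule DstalkE)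
  show ?thesis
  proof (rule same_germI[of "U \<inter> V \<inter> V'"])
    fix W f y assume W: "open W" "W \<subseteq> U \<inter> V \<inter> V'" "holo_on f W" "y \<in> W"
    have "holo_on (Q f) W" "holo_on (Q' f) W"
      by (rule order_le_holo_on[OF V(3) W(1) _ W(3)] order_le_holo_on[OF V'(3) W(1) _ W(3)], use
        W in auto)+
    then have "P (\<lambda>x. Q f x + Q' f x) y = P (Q f) y + P (Q' f) y"
      by (intro order_le_add_on[OF U(3) W(1)]) (use W in auto)
    moreover have "(Q + Q') f = (\<lambda>x. Q f x + Q' f x)" by (simp add: fun_eq_iff)
    ultimately show "(P \<circ> (Q + Q')) f y = ((P \<circ> Q) + (P \<circ> Q')) f y" by simp
  qed (use U V V' in auto)
qed

lemma same_germ_comp_zero: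
  assumes P: "P \<in> Dstalk x"
  shows "same_germ x (P \<circ> 0) 0"
proof -
  obtain U m where U: "open U" "x \<in> U" "order_le U m P" using P by (rule DstalkE)
  show ?thesis
    by (rule same_germI[OF U(1,2)]) (use order_le_zero_on[OF U(3)] in \<open>auto simp: zero_fun_def\<close>)
qed

lemma same_germ_comp_sum:
  assumes P: "P \<in> Dstalk x" and Q: "\<And>i. i \<in> I \<Longrightarrow> Q i \<in> Dstalk x"
  shows "same_germ x (P \<circ> (\<Sum>i\<in>I. Q i)) (\<Sum>i\<in>I. P \<circ> Q i)"
  using Q
proof (induction I rule: infinite_finite_induct)
  case (insert i I)
  have "same_germ x (P \<circ> (Q i + (\<Sum>i\<in>I. Q i))) ((P \<circ> Q i) + (P \<circ> (\<Sum>i\<in>I. Q i)))"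
    using insert by (intro same_germ_comp_add P Dstalk_sum) auto
  moreover have "same_germ x ((P \<circ> Q i) + (P \<circ> (\<Sum>i\<in>I. Q i))) ((P \<circ> Q i) + (\<Sum>i\<in>I. P \<circ> Q i))"
    by (intro same_germ_add same_germ_refl insert.IH insert.prems insertI2)
  ultimately show ?case
    unfolding sum.insert[OF insert.hyps] by (rule same_germ_trans)
qed (auto intro: same_germ_comp_zero P)

text \<open>The scalars are representatives of germs and satisfy the ring laws only up to
  \<open>same_germ\<close>. The module laws are therefore postulated for the action itself, where
  equality is meaningful.\<close>

locale D_module = abelian_monoid M
  for x :: point and M :: "(oper, 'm) module" (structure) +
  assumes smult_closed: "\<lbrakk>P \<in> Dstalk x; w \<in> carrier M\<rbrakk> \<Longrightarrow> P \<odot> w \<in> carrier M"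
    and smult_r_distr: "\<lbrakk>P \<in> Dstalk x; v \<in> carrier M; w \<in> carrier M\<rbrakk> \<Longrightarrow> P \<odot> (v \<oplus> w) = P \<odot> v \<oplus> P \<odot> w"
    and smult_l_distr: "\<lbrakk>P \<in> Dstalk x; Q \<in> Dstalk x; w \<in> carrier M\<rbrakk> \<Longrightarrow> (P + Q) \<odot> w = P \<odot> w \<oplus> Q \<odot> w"
    and smult_assoc: "\<lbrakk>P \<in> Dstalk x; Q \<in> Dstalk x; w \<in> carrier M\<rbrakk> \<Longrightarrow> (P \<circ> Q) \<odot> w = P \<odot> (Q \<odot> w)"
    and smult_id: "w \<in> carrier M \<Longrightarrow> id \<odot> w = w"
    and smult_l_null: "w \<in> carrier M \<Longrightarrow> 0 \<odot> w = \<zero>"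
    and smult_r_null: "P \<in> Dstalk x \<Longrightarrow> P \<odot> \<zero> = \<zero>"
begin

lemma smult_finsum:
  assumes "P \<in> Dstalk x" "f \<in> {..<s::nat} \<rightarrow> carrier M"
  shows "P \<odot> (\<Oplus>i\<in>{..<s}. f i) = (\<Oplus>i\<in>{..<s}. P \<odot> f i)"
  using assms(2)
  by (induction s) (auto simp: smult_r_null assms(1) lessThan_Suc smult_r_distr smult_closed Pi_def)

section \<open>Filtrations by finitely many generators and their comparison\<close>

definition gen_filt :: "nat \<Rightarrow> (nat \<Rightarrow> 'm) \<Rightarrow> (nat \<Rightarrow> int) \<Rightarrow> int \<Rightarrow> 'm set" where
  "gen_filt s u d n = {(\<Oplus>i\<in>{..<s}. Q i \<odot> u i) | Q. \<forall>i<s. Q i \<in> Dfilt x (n - d i)}"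

lemma good_filtrationE:
  assumes "good_filtration x M G"
  obtains s u d where "\<forall>i<s. u i \<in> carrier M" "G = gen_filt s u d" "(\<Union>n. G n) = carrier M"
  using assms unfolding good_filtration_def gen_filt_def[abs_def] by (metis (no_types, lifting) ext)

context
  fixes s :: nat and u :: "nat \<Rightarrow> 'm" and d :: "nat \<Rightarrow> int"
  assumes u: "\<forall>i<s. u i \<in> carrier M"
begin

lemma gen_filt_term_closed: "\<forall>i<s. Q i \<in> Dfilt x (n - d i) \<Longrightarrow> (\<lambda>i. Q i \<odot> u i) \<in> {..<s} \<rightarrow> carrier M"
  using u by (auto intro!: smult_closed dest: Dfilt_in_Dstalk)

lemma gen_filt_add:
  assumes "v \<in> gen_filt s u d n" "w \<in> gen_filt s u d n"
  shows "v \<oplus> w \<in> gen_filt s u d n"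
proof -
  obtain Q Q' where Q: "\<forall>i<s. Q i \<in> Dfilt x (n - d i)" "v = (\<Oplus>i\<in>{..<s}. Q i \<odot> u i)"
    and Q': "\<forall>i<s. Q' i \<in> Dfilt x (n - d i)" "w = (\<Oplus>i\<in>{..<s}. Q' i \<odot> u i)"
    using assms unfolding gen_filt_def by blast
  have "v \<oplus> w = (\<Oplus>i\<in>{..<s}. Q i \<odot> u i \<oplus> Q' i \<odot> u i)"
    unfolding Q Q' by (rule finsum_addf[symmetric, OF gen_filt_term_closed[OF Q(1)]
      gen_filt_term_closed[OF Q'(1)]])
  also have "\<dots> = (\<Oplus>i\<in>{..<s}. (Q i + Q' i) \<odot> u i)"
    using u Q(1) Q'(1)
    by (intro finsum_cong') (auto intro!: smult_l_distr[symmetric] smult_closed Dstalk_add dest: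
      Dfilt_in_Dstalk)
  finally show ?thesis
    unfolding gen_filt_def using Q(1) Q'(1)
    by (intro CollectI exI[of _ "\<lambda>i. Q i + Q' i"]) (simp add: Dfilt_add)
qed

lemma gen_filt_zero: "\<zero> \<in> gen_filt s u d n"
proof -
  have "(\<Oplus>i\<in>{..<s}. 0 \<odot> u i) = (\<Oplus>i\<in>{..<s}. \<zero>)"
    using u by (intro finsum_cong') (auto simp: smult_l_null)
  then have "\<zero> = (\<Oplus>i\<in>{..<s}. (\<lambda>_. 0) i \<odot> u i)" by simp
  then show ?thesis
    unfolding gen_filt_def by (intro CollectI exI[of _ "\<lambda>_. 0"]) (simp add: Dfilt_zero)
qed

lemma gen_filt_finsum:
  assumes "\<forall>i<t. f i \<in> gen_filt s u d n" "f \<in> {..<t::nat} \<rightarrow> carrier M"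
  shows "(\<Oplus>i\<in>{..<t}. f i) \<in> gen_filt s u d n"
  using assms by (induction t) (auto simp: gen_filt_zero lessThan_Suc Pi_def intro: gen_filt_add)

lemma gen_filt_smult:
  assumes "P \<in> Dfilt x k" "w \<in> gen_filt s u d n"
  shows "P \<odot> w \<in> gen_filt s u d (k + n)"
proof -
  obtain Q where Q: "\<forall>i<s. Q i \<in> Dfilt x (n - d i)" "w = (\<Oplus>i\<in>{..<s}. Q i \<odot> u i)"
    using assms(2) unfolding gen_filt_def by blast
  have P: "P \<in> Dstalk x" using assms(1) Dfilt_subset_Dstalk by blast
  have "P \<odot> w = (\<Oplus>i\<in>{..<s}. P \<odot> (Q i \<odot> u i))"
    unfolding Q by (rule smult_finsum[OF P gen_filt_term_closed[OF Q(1)]])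
  also have "\<dots> = (\<Oplus>i\<in>{..<s}. (P \<circ> Q i) \<odot> u i)"
    using u Q(1) P
    by (intro finsum_cong') (auto intro!: smult_assoc[symmetric] smult_closed Dstalk_comp dest:
      Dfilt_in_Dstalk)
  finally have "P \<odot> w = (\<Oplus>i\<in>{..<s}. (P \<circ> Q i) \<odot> u i)" .
  moreover have "\<forall>i<s. P \<circ> Q i \<in> Dfilt x (k + n - d i)"
    using Dfilt_comp[OF assms(1)] Q(1) by (metis add_diff_eq)
  ultimately show ?thesis unfolding gen_filt_def by (intro CollectI exI[of _ "\<lambda>i. P \<circ> Q i"]) simp
qed

lemma gen_filt_mono: "m \<le> n \<Longrightarrow> gen_filt s u d m \<subseteq> gen_filt s u d n"
  unfolding gen_filt_def using Dfilt_mono[of "m - d i" "n - d i" x for i] by fastforce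

end

lemma good_filtration_subset_carrier: "good_filtration x M G \<Longrightarrow> G n \<subseteq> carrier M"
  by (auto simp: good_filtration_def)

lemma good_filtration_mono: "good_filtration x M G \<Longrightarrow> m \<le> n \<Longrightarrow> G m \<subseteq> G n"
  by (elim good_filtrationE) (simp add: gen_filt_mono)

text \<open>Each of the finitely many generators of \<open>G\<close> lies in some piece of
  \<open>H\<close>; the largest excess of its degree there over its degree in \<open>G\<close>
  bounds the shift.\<close>

lemma good_filtrations_comparable:
  assumes G: "good_filtration x M G" and H: "good_filtration x M H"
  shows "\<exists>c. \<forall>n. G n \<subseteq> H (n + c)"
proof -
  obtain s u d where u: "\<forall>i<s. u i \<in> carrier M" and G_eq: "G = gen_filt s u d"
    using G by (rule good_filtrationE)
  obtain t v e where v: "\<forall>i<t. v i \<in> carrier M" and H_eq: "H = gen_filt t v e" and H_un: "(\<Union>n. H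
    n) = carrier M"
    using H by (rule good_filtrationE)
  have "\<forall>i<s. \<exists>k. u i \<in> H k" using u H_un by blast
  then obtain k where k: "\<And>i. i < s \<Longrightarrow> u i \<in> H (k i)" by metis
  \<comment> \<open>Inserting 0 keeps the maximum meaningful when there are no generators.\<close>
  define c where "c = Max (insert 0 ((\<lambda>i. k i - d i) ` {..<s}))"
  have c: "k i - d i \<le> c" if "i < s" for i
    unfolding c_def using that by (intro Max_ge) auto
  have "G n \<subseteq> H (n + c)" for n
  proof
    fix w assume "w \<in> G n"
    then obtain Q where Q: "\<forall>i<s. Q i \<in> Dfilt x (n - d i)" and w: "w = (\<Oplus>i\<in>{..<s}. Q i \<odot> u i)"
      unfolding G_eq gen_filt_def by blast
    have "Q i \<odot> u i \<in> H (n + c)" if i: "i < s" for i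
    proof -
      have "Q i \<odot> u i \<in> H (n - d i + k i)"
        unfolding H_eq using gen_filt_smult[OF v] Q i k[OF i, unfolded H_eq] by blast
      then show ?thesis using good_filtration_mono[OF H, of "n - d i + k i" "n + c"] c[OF i] by auto
    qed
    then show "w \<in> H (n + c)"
      unfolding w H_eq by (intro gen_filt_finsum[OF v] gen_filt_term_closed[OF u Q]) blast
  qed
  then show ?thesis by blast
qed

text \<open>For an operator of degree \<open>m\<close> that lowers the filtration this is used with
  shift \<open>m - 1\<close>, so that \<open>N\<close> applications fall short of the expected
  degree by \<open>N\<close>.\<close>

lemma smult_funpow:
  assumes P: "P \<in> Dstalk x" and H: "\<And>n. H n \<subseteq> carrier M"
    and PH: "\<And>n w. w \<in> H n \<Longrightarrow> P \<odot> w \<in> H (n + m)" and w: "w \<in> H n"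
  shows "(P ^^ N) \<odot> w \<in> H (n + int N * m)" "(P ^^ N) \<in> Dstalk x"
proof -
  have "(P ^^ N) \<odot> w \<in> H (n + int N * m) \<and> (P ^^ N) \<in> Dstalk x"
  proof (induction N)
    case 0
    have "P ^^ 0 = id" by (simp add: fun_eq_iff)
    then show ?case using w smult_id[of w] H[of n] Dstalk_id[of x] by (auto simp: id_def)
  next
    case (Suc N)
    have eq: "P ^^ Suc N = P \<circ> P ^^ N" by simp
    have "(P \<circ> P ^^ N) \<odot> w = P \<odot> ((P ^^ N) \<odot> w)"
      using Suc w H P by (intro smult_assoc) auto
    moreover have "P \<odot> ((P ^^ N) \<odot> w) \<in> H (n + int N * m + m)"
      using Suc by (intro PH) auto
    moreover have "n + int N * m + m = n + int (Suc N) * m" by (simp add: algebra_simps)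
    ultimately show ?case
      unfolding eq using Suc Dstalk_comp[OF P, of "P ^^ N"] by metis
  qed
  then show "(P ^^ N) \<odot> w \<in> H (n + int N * m)" "(P ^^ N) \<in> Dstalk x" by auto
qed

text \<open>A high power of an operator which lowers degrees in one good filtration lowers degrees in
  all the others, and taking powers does not change the zero set of the symbol.\<close>

lemma char_fibre_symbol_zero:
  assumes H: "good_filtration x M H" and U: "open U" "x \<in> U" and P: "has_symbol U m P \<sigma>"
    and PH: "\<And>n w. w \<in> H n \<Longrightarrow> P \<odot> w \<in> H (n + m - 1)"
    and \<xi>: "\<xi> \<in> char_fibre x M"
  shows "\<sigma> (x, \<xi>) = 0"
proof -
  obtain G where G: "good_filtration x M G"
    and \<xi>G: "\<forall>U n P \<sigma>. open U \<and> x \<in> U \<and> has_symbol U n P \<sigma> \<and>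
        (\<forall>j. \<forall>w\<in>G j. P \<odot> w \<in> G (j + n - 1)) \<longrightarrow> \<sigma> (x, \<xi>) = 0"
    using \<xi> unfolding char_fibre_def by (elim CollectE exE conjE)
  obtain c where c: "\<And>n. G n \<subseteq> H (n + c)" using good_filtrations_comparable[OF G H] by blast
  obtain c' where c': "\<And>n. H n \<subseteq> G (n + c')" using good_filtrations_comparable[OF H G] by blast
  \<comment> \<open>Passing from \<open>G\<close> to \<open>H\<close> and back costs
    \<open>c + c'\<close>, and each factor \<open>P\<close> gains 1; with this \<open>N\<close> a
    net gain of at least 1 remains.\<close>
  define N where "N = nat (c + c' + 1)"
  have Pst: "P \<in> Dstalk x" using DfiltI[OF U P] Dfilt_subset_Dstalk by blast
  have "(P ^^ N) \<odot> w \<in> G (j + int N * m - 1)" if w: "w \<in> G j" for j w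
  proof -
    have "w \<in> H (j + c)" using w c by blast
    then have "(P ^^ N) \<odot> w \<in> H (j + c + int N * (m - 1))"
      using PH by (intro smult_funpow[OF Pst good_filtration_subset_carrier[OF H]]) (simp_all
        add: algebra_simps)
    then have "(P ^^ N) \<odot> w \<in> G (j + c + int N * (m - 1) + c')" using c' by blast
    moreover have "j + c + int N * (m - 1) + c' \<le> j + int N * m - 1"
      by (simp add: N_def algebra_simps)
    ultimately show ?thesis using good_filtration_mono[OF G] by blast
  qed
  then have "\<sigma> (x, \<xi>) ^ N = 0"
    using U has_symbol_funpow[OF P U(1), of N]
    by (intro \<xi>G[THEN spec[of _ U], THEN spec[of _ "int N * m"], THEN spec[of _ "P ^^ N"],
          THEN spec[of _ "\<lambda>z. \<sigma> z ^ N"], THEN mp]) simp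
  then show ?thesis by simp
qed

end

section \<open>Branches of the cubic\<close>

text \<open>The last clause says that the root is simple: \<open>3 * z y ^ 2 - fst y\<close> is the
  derivative of the cubic at the root, and it becomes the denominator of all derivatives of
  \<open>z\<close>.\<close>

definition cubic_branch :: "(point \<Rightarrow> complex) \<Rightarrow> point set \<Rightarrow> bool" where
  "cubic_branch z W \<longleftrightarrow> open W \<and> holo_on z W \<and>
     (\<forall>(p, q)\<in>W. z (p, q) ^ 3 = p * z (p, q) + q) \<and> (\<forall>y\<in>W. 3 * z y ^ 2 - fst y \<noteq> 0)"

text \<open>The map sending (p, z) to (p, z^3 - p z) recovers the coefficients from \<open>p\<close>
  and a root. At a simple root its derivative is invertible, and the second component of a local
  inverse is a branch. Prescribing the root \<zeta> selects which of the branches over the point is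
  meant.\<close>

lemma cubic_branch_exists:
  fixes p \<zeta> :: complex
  assumes nz: "3 * \<zeta> ^ 2 - p \<noteq> 0" and U: "open U" "(p, \<zeta> ^ 3 - p * \<zeta>) \<in> U"
  obtains z W where "cubic_branch z W" "W \<subseteq> U" "(p, \<zeta> ^ 3 - p * \<zeta>) \<in> W" "z (p, \<zeta> ^ 3 - p * \<zeta>) = \<zeta>"
proof -
  define f :: "point \<Rightarrow> point" where "f = (\<lambda>y. (fst y, snd y ^ 3 - fst y * snd y))"
  define e1 :: "complex \<Rightarrow>\<^sub>L point" where "e1 = Blinfun (\<lambda>c. (c, 0))"
  define e2 :: "complex \<Rightarrow>\<^sub>L point" where "e2 = Blinfun (\<lambda>c. (0, c))"
  define L :: "complex \<Rightarrow> complex \<Rightarrow> point \<Rightarrow>\<^sub>L point" where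
    "L = (\<lambda>a b. (e1 o\<^sub>L fst_blinfun) +
       (e2 o\<^sub>L ((blinfun_mult_right a o\<^sub>L snd_blinfun) + (blinfun_mult_right b o\<^sub>L fst_blinfun))))"
  have e1: "blinfun_apply e1 c = (c, 0)" and e2: "blinfun_apply e2 c = (0, c)" for c
    unfolding e1_def e2_def
    by (subst bounded_linear_Blinfun_apply; simp add: bounded_linear_Pair bounded_linear_ident
      bounded_linear_zero)+
  have L: "blinfun_apply (L a b) h = (fst h, a * snd h + b * fst h)" for a b h
    by (simp add: L_def e1 e2 blinfun.add_left)
  define \<delta> :: "point \<Rightarrow> complex" where "\<delta> = (\<lambda>y. 3 * snd y ^ 2 - fst y)"
  define S where "S = {y. \<delta> y \<noteq> 0}"
  have "open S" unfolding S_def \<delta>_def by (intro open_Collect_neq continuous_intros)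
  have der: "(f has_derivative blinfun_apply (L (\<delta> y) (- snd y))) (at y)" for y
  proof -
    have "(f has_derivative (\<lambda>h. (fst h, \<delta> y * snd h + - snd y * fst h))) (at y)"
      unfolding f_def \<delta>_def
      by (auto intro!: derivative_eq_intros simp: fun_eq_iff algebra_simps)
    then show ?thesis by (rule has_derivative_eq_rhs) (simp add: L fun_eq_iff)
  qed
  have cont: "continuous_on S (\<lambda>y. L (\<delta> y) (- snd y))"
    unfolding L_def \<delta>_def
    by (intro continuous_intros bounded_linear.continuous_on[OF bounded_linear_blinfun_mult_right])
  \<comment> \<open>The derivative is the triangular map (h1, h2) to (h1, \<delta> h2 - z h1);
    solving for h2 gives the inverse.\<close>
  have inv: "L (1 / \<delta> y) (snd y / \<delta> y) o\<^sub>L L (\<delta> y) (- snd y) = id_blinfun"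
    and inv': "L (\<delta> y) (- snd y) o\<^sub>L L (1 / \<delta> y) (snd y / \<delta> y) = id_blinfun"
    if "y \<in> S" for y
    using that by (auto intro!: blinfun_eqI simp: L S_def field_simps prod_eq_iff)
  have pS: "(p, \<zeta>) \<in> S" using nz by (simp add: S_def \<delta>_def)
  obtain U' V g g' where g: "open U'" "U' \<subseteq> S" "(p, \<zeta>) \<in> U'" "open V" "f (p, \<zeta>) \<in> V"
    "homeomorphism U' V f g"
    "\<And>y. y \<in> V \<Longrightarrow> (g has_derivative (g' y)) (at y)"
    "\<And>y. y \<in> V \<Longrightarrow> g' y = Hilbert_Choice.inv (blinfun_apply (L (\<delta> (g y)) (- snd (g y))))"
    by (rule inverse_function_theorem[OF \<open>open S\<close> der cont pS inv[OF pS]]) blast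
  define z where "z = snd \<circ> g"
  define W where "W = V \<inter> U"
  have gV: "g y \<in> S" "f (g y) = y" if "y \<in> V" for y
    using g(2,6) that by (auto simp: homeomorphism_def)
  have g_eq: "g y = (fst y, z y)" if "y \<in> V" for y
    using gV(2)[OF that] by (auto simp: f_def z_def prod_eq_iff)
  have "holo_on z W"
    unfolding holo_on_def
  proof
    fix y assume "y \<in> W"
    then have y: "y \<in> V" by (simp add: W_def)
    have "g' y = blinfun_apply (L (1 / \<delta> (g y)) (snd (g y) / \<delta> (g y)))"
      unfolding g(8)[OF y]
      by (rule inv_unique_comp)
         (use arg_cong[OF inv[OF gV(1)[OF y]], of blinfun_apply] arg_cong[OF inv'[OF gV(1)[OF
           y]], of blinfun_apply]
            in \<open>simp_all add: fun_eq_iff\<close>)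
    then have "(z has_derivative (\<lambda>h. snd (L (1 / \<delta> (g y)) (snd (g y) / \<delta> (g y)) h))) (at y)"
      using has_derivative_snd[OF g(7)[OF y]] by (simp add: z_def comp_def)
    then have "(z has_derivative (\<lambda>h. snd (g y) / \<delta> (g y) * fst h + 1 / \<delta> (g y) * snd h)) (at y)"
      by (rule has_derivative_eq_rhs) (simp add: L fun_eq_iff)
    then show "\<exists>a b. (z has_derivative (\<lambda>h. a * fst h + b * snd h)) (at y)" by blast
  qed
  moreover have "z (p, q) ^ 3 = p * z (p, q) + q" if "(p, q) \<in> W" for p q
    using gV(2)[of "(p, q)"] that g_eq[of "(p, q)"] by (auto simp: W_def f_def algebra_simps)
  moreover have "3 * z y ^ 2 - fst y \<noteq> 0" if "y \<in> W" for y
    using gV(1)[of y] that g_eq[of y] by (auto simp: W_def S_def \<delta>_def)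
  ultimately have "cubic_branch z W"
    unfolding cubic_branch_def using g(4) U(1) by (auto simp: W_def)
  moreover have "f (p, \<zeta>) \<in> W" using g(5) U by (simp add: W_def f_def)
  moreover have "z (f (p, \<zeta>)) = \<zeta>"
    using g(3,6) by (auto simp: z_def homeomorphism_def)
  ultimately show ?thesis by (intro that[of z W]) (auto simp: f_def W_def)
qed

text \<open>Implicit differentiation: z^3 - p z - q vanishes on \<open>W\<close>, and its derivative
  is computed in two ways. The ratio z : 1 of the two partial derivatives is the origin of the
  covectors (\<zeta> l, l).\<close>

lemma cubic_branch_derivs:
  assumes "cubic_branch z W" "x \<in> W"
  shows "(z has_derivative (\<lambda>h. z x / (3 * z x ^ 2 - fst x) * fst h + 1 / (3 * z x ^ 2 - fst x)
    * snd h)) (at x)"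
proof -
  have W: "open W" and z: "holo_on z W" and eq: "\<And>p q. (p, q) \<in> W \<Longrightarrow> z (p, q) ^ 3 = p * z (p, q) + q"
    and nz: "3 * z x ^ 2 - fst x \<noteq> 0"
    using assms by (auto simp: cubic_branch_def)
  define a where "a = dp z x"
  define b where "b = dq z x"
  have der: "(z has_derivative (\<lambda>h. a * fst h + b * snd h)) (at x)"
    unfolding a_def b_def by (rule holo_on_has_derivative[OF z assms(2)])
  have "((\<lambda>y. z y ^ 3 - fst y * z y - snd y) has_derivative
     (\<lambda>h. (3 * z x ^ 2 * a - z x - fst x * a) * fst h + (3 * z x ^ 2 * b - fst x * b - 1) * snd
       h)) (at x)"
    by (rule derivative_eq_intros der refl | simp)+
       (simp add: fun_eq_iff algebra_simps)
  note D1 = dp_dq_eqI[OF this]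
  have "((\<lambda>y. z y ^ 3 - fst y * z y - snd y) has_derivative (\<lambda>h. 0 * fst h + 0 * snd h)) (at x)"
    by (rule has_derivative_transform_within_open[of "\<lambda>_. 0", OF _ W assms(2)]) (use eq in auto)
  note D2 = dp_dq_eqI[OF this]
  have "3 * z x ^ 2 * a - z x - fst x * a = 0" "3 * z x ^ 2 * b - fst x * b - 1 = 0"
    using D1 D2 by simp_all
  then have "a = z x / (3 * z x ^ 2 - fst x)" "b = 1 / (3 * z x ^ 2 - fst x)"
    using nz by (simp_all add: field_simps)
  then show ?thesis using der by simp
qed

section \<open>Derivatives of branches as polynomials in p and z over powers of 3 z^2 - p\<close>

inductive poly2 :: "(complex \<Rightarrow> complex \<Rightarrow> complex) \<Rightarrow> bool" where
  poly2_const: "poly2 (\<lambda>p z. c)"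
| poly2_fst: "poly2 (\<lambda>p z. p)"
| poly2_snd: "poly2 (\<lambda>p z. z)"
| poly2_add: "poly2 F \<Longrightarrow> poly2 G \<Longrightarrow> poly2 (\<lambda>p z. F p z + G p z)"
| poly2_mult: "poly2 F \<Longrightarrow> poly2 G \<Longrightarrow> poly2 (\<lambda>p z. F p z * G p z)"

lemma poly2_diff: "poly2 F \<Longrightarrow> poly2 G \<Longrightarrow> poly2 (\<lambda>p z. F p z - G p z)"
  using poly2_add[OF _ poly2_mult[OF poly2_const[of "- 1"]], of F G] by simp

lemma poly2_power: "poly2 F \<Longrightarrow> poly2 (\<lambda>p z. F p z ^ n)"
  by (induction n) (auto intro: poly2_const[of 1] poly2_mult)

lemmas poly2_intros = poly2_const poly2_fst poly2_snd poly2_add poly2_mult poly2_diff poly2_power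

lemma poly2_continuous:
  assumes "poly2 F" "continuous_on S f" "continuous_on S g"
  shows "continuous_on S (\<lambda>x. F (f x) (g x))"
  using assms(1) by induction (auto intro!: continuous_intros assms(2,3))

definition has_partials ::
    "(complex \<Rightarrow> complex \<Rightarrow> complex) \<Rightarrow> (complex \<Rightarrow> complex \<Rightarrow> complex) \<Rightarrow> (complex \<Rightarrow> complex \<Rightarrow>
      complex) \<Rightarrow> bool" where
  "has_partials F Fp Fz \<longleftrightarrow> (\<forall>x. ((\<lambda>x. F (fst x) (snd x)) has_derivative
     (\<lambda>h. Fp (fst x) (snd x) * fst h + Fz (fst x) (snd x) * snd h)) (at x))"

lemma poly2_has_partials:
  assumes "poly2 F"
  shows "\<exists>Fp Fz. poly2 Fp \<and> poly2 Fz \<and> has_partials F Fp Fz"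
  using assms
proof induction
  case (poly2_const c)
  have "has_partials (\<lambda>p z. c) (\<lambda>p z. 0) (\<lambda>p z. 0)" by (simp add: has_partials_def)
  then show ?case using poly2.poly2_const by blast
next
  case poly2_fst
  have "has_partials (\<lambda>p z. p) (\<lambda>p z. 1) (\<lambda>p z. 0)"
    by (auto simp: has_partials_def intro!: derivative_eq_intros)
  then show ?case using poly2.poly2_const by blast
next
  case poly2_snd
  have "has_partials (\<lambda>p z. z) (\<lambda>p z. 0) (\<lambda>p z. 1)"
    by (auto simp: has_partials_def intro!: derivative_eq_intros)
  then show ?case using poly2.poly2_const by blast
next
  case (poly2_add F G)
  then obtain Fp Fz Gp Gz where *: "poly2 Fp" "poly2 Fz" "has_partials F Fp Fz" "poly2 Gp"
    "poly2 Gz" "has_partials G Gp Gz"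
    by blast
  have "has_partials (\<lambda>p z. F p z + G p z) (\<lambda>p z. Fp p z + Gp p z) (\<lambda>p z. Fz p z + Gz p z)"
    unfolding has_partials_def
  proof
    fix x
    show "((\<lambda>x. F (fst x) (snd x) + G (fst x) (snd x)) has_derivative
       (\<lambda>h. (Fp (fst x) (snd x) + Gp (fst x) (snd x)) * fst h + (Fz (fst x) (snd x) + Gz (fst x)
         (snd x)) * snd h)) (at x)"
      by (rule has_derivative_eq_rhs[OF has_derivative_add[OF
          *(3)[unfolded has_partials_def, rule_format] *(6)[unfolded has_partials_def,
            rule_format]]])
         (simp add: fun_eq_iff algebra_simps)
  qed
  moreover have "poly2 (\<lambda>p z. Fp p z + Gp p z)" "poly2 (\<lambda>p z. Fz p z + Gz p z)"
    using * by (simp_all add: poly2.poly2_add)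
  ultimately show ?case by blast
next
  case (poly2_mult F G)
  then obtain Fp Fz Gp Gz where *: "poly2 Fp" "poly2 Fz" "has_partials F Fp Fz" "poly2 Gp"
    "poly2 Gz" "has_partials G Gp Gz"
    by blast
  have "has_partials (\<lambda>p z. F p z * G p z) (\<lambda>p z. Fp p z * G p z + F p z * Gp p z) (\<lambda>p z. Fz p z
    * G p z + F p z * Gz p z)"
    unfolding has_partials_def
  proof
    fix x
    show "((\<lambda>x. F (fst x) (snd x) * G (fst x) (snd x)) has_derivative
       (\<lambda>h. (Fp (fst x) (snd x) * G (fst x) (snd x) + F (fst x) (snd x) * Gp (fst x) (snd x)) *
         fst h +
         (Fz (fst x) (snd x) * G (fst x) (snd x) + F (fst x) (snd x) * Gz (fst x) (snd x)) * snd
           h)) (at x)"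
      by (rule has_derivative_eq_rhs[OF has_derivative_mult[OF
          *(3)[unfolded has_partials_def, rule_format] *(6)[unfolded has_partials_def,
            rule_format]]])
         (simp add: fun_eq_iff algebra_simps)
  qed
  moreover have "poly2 (\<lambda>p z. Fp p z * G p z + F p z * Gp p z)" "poly2 (\<lambda>p z. Fz p z * G p z + F
    p z * Gz p z)"
    using * poly2_mult.hyps by (simp_all add: poly2.poly2_add poly2.poly2_mult)
  ultimately show ?case by blast
qed

text \<open>The quotient rule, using that \<delta> has the partial derivatives (6 z^2 - \<delta>) /
  \<delta> and 6 z / \<delta>. Quotients of a polynomial in p and z by a power of \<delta> thus form
  a class closed under both derivations, with the exponent raised by two. On \<delta> = 0 only the
  terms with the factor \<open>m\<close> survive in the new numerators.\<close>

lemma poly2_branch_derivs: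
  fixes m :: nat
  assumes F: "has_partials F Fp Fz" and z: "cubic_branch z W" "x \<in> W"
  defines "\<delta> \<equiv> 3 * z x ^ 2 - fst x"
  defines "g \<equiv> \<lambda>y. F (fst y) (z y) / (3 * z y ^ 2 - fst y) ^ m"
  shows "dp g x = (\<delta> ^ 2 * Fp (fst x) (z x) + \<delta> * z x * Fz (fst x) (z x)
       - of_nat m * F (fst x) (z x) * (6 * z x ^ 2 - \<delta>)) / \<delta> ^ (m + 2)"
    and "dq g x = (\<delta> * Fz (fst x) (z x) - 6 * of_nat m * z x * F (fst x) (z x)) / \<delta> ^ (m + 2)"
proof -
  obtain p q where x: "x = (p, q)" by (cases x)
  have nz: "\<delta> \<noteq> 0" using z by (auto simp: cubic_branch_def \<delta>_def)
  note dz = cubic_branch_derivs[OF z, folded \<delta>_def]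
  have "((\<lambda>y. (fst y, z y)) has_derivative (\<lambda>h. (fst h, z x / \<delta> * fst h + 1 / \<delta> * snd h))) (at x)"
    by (intro has_derivative_Pair dz derivative_intros)
  then have "((\<lambda>y. F (fst (fst y, z y)) (snd (fst y, z y))) has_derivative
     (\<lambda>h. Fp (fst (fst x, z x)) (snd (fst x, z x)) * fst (fst h, z x / \<delta> * fst h + 1 / \<delta> * snd h)
       + Fz (fst (fst x, z x)) (snd (fst x, z x)) * snd (fst h, z x / \<delta> * fst h + 1 / \<delta> * snd
         h))) (at x)"
    by (rule has_derivative_compose[OF _ F[unfolded has_partials_def, rule_format]])
  then have "((\<lambda>y. F (fst y) (z y)) has_derivative
     (\<lambda>h. (Fp (fst x) (z x) + Fz (fst x) (z x) * (z x / \<delta>)) * fst h + Fz (fst x) (z x) / \<delta> * snd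
       h)) (at x)"
    unfolding fst_conv snd_conv by (rule has_derivative_eq_rhs) (simp add: fun_eq_iff algebra_simps)
  note dF = has_derivative_partials[OF this[unfolded x], folded x]
  have dFp: "((\<lambda>s. F s (z (s, q))) has_field_derivative Fp p (z x) + Fz p (z x) * (z x / \<delta>)) (at p)"
    and dFq: "((\<lambda>t. F p (z (p, t))) has_field_derivative Fz p (z x) / \<delta>) (at q)"
    using dF by (simp_all add: x)
  note dz' = has_derivative_partials[OF dz[unfolded x], folded x]
  have \<delta>x: "3 * z (p, q) ^ 2 - p = \<delta>" by (simp add: \<delta>_def x)
  have d\<delta>p: "((\<lambda>s. 3 * z (s, q) ^ 2 - s) has_field_derivative 6 * z x * (z x / \<delta>) - 1) (at p)"
    by (rule derivative_eq_intros dz' refl | simp add: x)+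
  have d\<delta>q: "((\<lambda>t. 3 * z (p, t) ^ 2 - p) has_field_derivative 6 * z x * (1 / \<delta>)) (at q)"
    by (rule derivative_eq_intros dz' refl | simp add: x)+
  have nz': "(3 * z (p, q) ^ 2 - p) ^ m \<noteq> 0" unfolding \<delta>x using nz by simp
  \<comment> \<open>For \<open>m = 0\<close> the exponent \<open>m - 1\<close> is truncated, but
    then both sides vanish.\<close>
  have pow: "of_nat m * D * \<delta> ^ (m - 1) = of_nat m * D * \<delta> ^ m / \<delta>" for D
    using nz by (cases m) simp_all
  have "((\<lambda>s. F s (z (s, q)) / (3 * z (s, q) ^ 2 - s) ^ m) has_field_derivative
    ((Fp p (z x) + Fz p (z x) * (z x / \<delta>)) * \<delta> ^ m - F p (z x) * (of_nat m * (6 * z x * (z x /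
      \<delta>) - 1) * \<delta> ^ (m - 1)))
      / (\<delta> ^ m * \<delta> ^ m)) (at p)"
    by (rule DERIV_cong[OF DERIV_divide[OF dFp DERIV_power[OF d\<delta>p, of m] nz']]) (simp add: \<delta>x x
      mult_ac)
  then have "dp g x = ((Fp p (z x) + Fz p (z x) * (z x / \<delta>)) * \<delta> ^ m - F p (z x) * (of_nat m *
    (6 * z x * (z x / \<delta>) - 1) * \<delta> ^ (m - 1)))
      / (\<delta> ^ m * \<delta> ^ m)"
    by (simp add: g_def dp_def x DERIV_imp_deriv)
  also have "\<dots> = (\<delta> ^ 2 * Fp (fst x) (z x) + \<delta> * z x * Fz (fst x) (z x)
       - of_nat m * F (fst x) (z x) * (6 * z x ^ 2 - \<delta>)) / \<delta> ^ (m + 2)"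
    unfolding pow using nz by (simp add: x field_simps power_add power2_eq_square)
  finally show "dp g x = (\<delta> ^ 2 * Fp (fst x) (z x) + \<delta> * z x * Fz (fst x) (z x)
       - of_nat m * F (fst x) (z x) * (6 * z x ^ 2 - \<delta>)) / \<delta> ^ (m + 2)" .
  have "((\<lambda>t. F p (z (p, t)) / (3 * z (p, t) ^ 2 - p) ^ m) has_field_derivative
    (Fz p (z x) / \<delta> * \<delta> ^ m - F p (z x) * (of_nat m * (6 * z x * (1 / \<delta>)) * \<delta> ^ (m - 1)))
      / (\<delta> ^ m * \<delta> ^ m)) (at q)"
    by (rule DERIV_cong[OF DERIV_divide[OF dFq DERIV_power[OF d\<delta>q, of m] nz']]) (simp add: \<delta>x x
      mult_ac)
  then have "dq g x = (Fz p (z x) / \<delta> * \<delta> ^ m - F p (z x) * (of_nat m * (6 * z x * (1 / \<delta>)) * \<delta>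
    ^ (m - 1)))
      / (\<delta> ^ m * \<delta> ^ m)"
    by (simp add: g_def dq_def x DERIV_imp_deriv)
  also have "\<dots> = (\<delta> * Fz (fst x) (z x) - 6 * of_nat m * z x * F (fst x) (z x)) / \<delta> ^ (m + 2)"
    unfolding pow using nz by (simp add: x field_simps power_add power2_eq_square)
  finally show "dq g x = (\<delta> * Fz (fst x) (z x) - 6 * of_nat m * z x * F (fst x) (z x)) / \<delta> ^ (m
    + 2)" .
qed


lemma poly2_branch_holo:
  assumes "poly2 F" "cubic_branch z W"
  shows "holo_on (\<lambda>y. F (fst y) (z y)) W"
  using assms(1)
proof induction
  case poly2_fst
  show ?case unfolding holo_on_def
    by (intro ballI exI[of _ 1] exI[of _ 0]) (auto intro!: derivative_eq_intros)
qed (use assms(2) in \<open>auto simp: cubic_branch_def intro: holo_on_add holo_on_mult\<close>)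

text \<open>The exponent counts the order of the pole along the discriminant of the branch.\<close>

definition branch_formula ::
    "(complex \<Rightarrow> complex \<Rightarrow> complex) \<Rightarrow> nat \<Rightarrow> nat \<Rightarrow> nat \<Rightarrow> (complex \<Rightarrow> complex \<Rightarrow> complex) \<Rightarrow> bool" where
  "branch_formula F0 i j m F \<longleftrightarrow> (\<forall>z W. cubic_branch z W \<longrightarrow> (\<forall>x\<in>W.
     pd i j (\<lambda>y. F0 (fst y) (z y)) x = F (fst x) (z x) / (3 * z x ^ 2 - fst x) ^ m))"

lemma branch_formulaD:
  "branch_formula F0 i j m F \<Longrightarrow> cubic_branch z W \<Longrightarrow> x \<in> W \<Longrightarrow>
     pd i j (\<lambda>y. F0 (fst y) (z y)) x = F (fst x) (z x) / (3 * z x ^ 2 - fst x) ^ m"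
  unfolding branch_formula_def by blast

lemma branch_formula_dp:
  assumes "branch_formula F0 i j m F" "has_partials F Fp Fz"
  shows "branch_formula F0 (Suc i) j (m + 2) (\<lambda>p z. (3 * z ^ 2 - p) ^ 2 * Fp p z
    + (3 * z ^ 2 - p) * z * Fz p z - of_nat m * F p z * (6 * z ^ 2 - (3 * z ^ 2 - p)))"
  unfolding branch_formula_def
proof (intro allI impI ballI)
  fix z W x assume z: "cubic_branch z W" and x: "x \<in> W"
  have W: "open W" using z by (simp add: cubic_branch_def)
  have "pd (Suc i) j (\<lambda>y. F0 (fst y) (z y)) x = dp (\<lambda>y. F (fst y) (z y) / (3 * z y ^ 2 - fst y)
    ^ m) x"
    unfolding dp_pd[symmetric] by (rule dp_dq_cong_open[OF W x branch_formulaD[OF assms(1) z]])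
  then show "pd (Suc i) j (\<lambda>y. F0 (fst y) (z y)) x =
     ((3 * z x ^ 2 - fst x) ^ 2 * Fp (fst x) (z x)
    + (3 * z x ^ 2 - fst x) * z x * Fz (fst x) (z x) - of_nat m * F (fst x) (z x) * (6 * z x ^ 2
      - (3 * z x ^ 2 - fst x)))
    / (3 * z x ^ 2 - fst x) ^ (m + 2)"
    using poly2_branch_derivs(1)[OF assms(2) z x, of m] by (simp only:)
qed

lemma branch_formula_dq:
  assumes "branch_formula F0 i j m F" "has_partials F Fp Fz" "poly2 F0"
  shows "branch_formula F0 i (Suc j) (m + 2) (\<lambda>p z. (3 * z ^ 2 - p) * Fz p z - 6 * of_nat m * z
    * F p z)"
  unfolding branch_formula_def
proof (intro allI impI ballI)
  fix z W x assume z: "cubic_branch z W" and x: "x \<in> W"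
  have W: "open W" using z by (simp add: cubic_branch_def)
  have "pd i (Suc j) (\<lambda>y. F0 (fst y) (z y)) x = dq (pd i j (\<lambda>y. F0 (fst y) (z y))) x"
    by (rule dq_pd[symmetric, OF poly2_branch_holo[OF assms(3) z] W x])
  also have "\<dots> = dq (\<lambda>y. F (fst y) (z y) / (3 * z y ^ 2 - fst y) ^ m) x"
    by (rule dp_dq_cong_open[OF W x branch_formulaD[OF assms(1) z]])
  finally show "pd i (Suc j) (\<lambda>y. F0 (fst y) (z y)) x =
     ((3 * z x ^ 2 - fst x) * Fz (fst x) (z x) - 6 * of_nat m * z x * F (fst x) (z x)) / (3 * z
       x ^ 2 - fst x) ^ (m + 2)"
    using poly2_branch_derivs(2)[OF assms(2) z x, of m] by (simp only:)
qed

text \<open>Needed for first derivatives: starting from a polynomial, that is from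
  \<open>m = 0\<close>, the quotient rule produces a numerator divisible by \<delta>. Cancelling it
  leaves a simple pole, whence the exponent \<open>2 k - 1\<close> for order \<open>k\<close>
  instead of \<open>2 k\<close>.\<close>

lemma branch_formula_cancel:
  assumes "branch_formula F0 i j (Suc m) (\<lambda>p z. (3 * z ^ 2 - p) * F p z)"
  shows "branch_formula F0 i j m F"
  unfolding branch_formula_def
proof (intro allI impI ballI)
  fix z W x assume z: "cubic_branch z W" and x: "x \<in> W"
  have "3 * z x ^ 2 - fst x \<noteq> 0" using z x by (auto simp: cubic_branch_def)
  then show "pd i j (\<lambda>y. F0 (fst y) (z y)) x = F (fst x) (z x) / (3 * z x ^ 2 - fst x) ^ m"
    using branch_formulaD[OF assms z x] by simp
qed

text \<open>The index is the total order minus one. Differentiating a pole of order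
  \<open>2 k + 1\<close> brings down its order with a minus sign, and the 6 comes from
  differentiating 3 z^2.\<close>

fun leading_const :: "nat \<Rightarrow> complex" where
  "leading_const 0 = 1"
| "leading_const (Suc k) = - 6 * of_nat (2 * k + 1) * leading_const k"

lemma leading_const_nonzero: "leading_const k \<noteq> 0"
proof (induction k)
  case (Suc k)
  have "of_nat (2 * k + 1) \<noteq> (0 :: complex)" by (simp only: of_nat_eq_0_iff)
  then show ?case unfolding leading_const.simps using Suc by (intro no_zero_divisors) simp_all
qed simp

text \<open>Evaluating the numerator at \<open>p = 3 * \<zeta> ^ 2\<close> extracts the leading
  coefficient of the pole. Among derivatives of the same total order it depends on \<open>i\<close>
  only through the factor \<zeta>^i, as a monomial symbol does at the covector (\<zeta>, 1). In
  order 0 the truncated exponent is 0, as it should be.\<close>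

definition good_branch_formula where
  "good_branch_formula F0 Fz0 i j F \<longleftrightarrow> poly2 F \<and> branch_formula F0 i j (2 * (i + j) - 1) F \<and>
     (i + j = 0 \<longrightarrow> F = F0) \<and>
     (\<forall>k \<zeta>. i + j = Suc k \<longrightarrow> F (3 * \<zeta> ^ 2) \<zeta> = leading_const k * \<zeta> ^ (k + i) * Fz0 (3 * \<zeta> ^ 2) \<zeta>)"

text \<open>Order one is a base case of its own, because the pole order first grows by one and
  afterwards by two. Since \<open>pd\<close> applies \<open>dq\<close> before \<open>dp\<close>, the
  induction runs through \<open>j\<close> with \<open>i = 0\<close> and then through
  \<open>i\<close>. On \<delta> = 0 a step by \<open>dq\<close> multiplies by \<zeta> and one by
  \<open>dp\<close> by \<zeta>^2, apart from the constant.\<close>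

lemma good_branch_formula_ex:
  assumes F0: "poly2 F0" "poly2 Fp0" "poly2 Fz0" "has_partials F0 Fp0 Fz0"
  shows "\<exists>F. good_branch_formula F0 Fz0 i j F"
proof -
  have base: "branch_formula F0 0 0 0 F0"
    by (simp add: branch_formula_def pd_eq)
  have base_q: "good_branch_formula F0 Fz0 0 (Suc 0) Fz0"
    using branch_formula_cancel[of F0 0 "Suc 0" "Suc 0" Fz0] branch_formula_dq[OF base F0(4,1)] F0
    by (simp add: good_branch_formula_def)
  have base_p: "good_branch_formula F0 Fz0 (Suc 0) 0 (\<lambda>p z. (3 * z ^ 2 - p) * Fp0 p z + z * Fz0
    p z)"
    using branch_formula_cancel[of F0 "Suc 0" 0 "Suc 0" "\<lambda>p z. (3 * z ^ 2 - p) * Fp0 p z + z *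
      Fz0 p z"]
      branch_formula_dp[OF base F0(4)] F0
    by (auto simp: good_branch_formula_def algebra_simps power2_eq_square intro!: poly2_intros)
  have step_q: "\<exists>F'. good_branch_formula F0 Fz0 i (Suc j) F'"
    if F: "good_branch_formula F0 Fz0 i j F" and k: "i + j = Suc k" for i j k F
  proof -
    obtain Fp Fz where F': "poly2 Fp" "poly2 Fz" "has_partials F Fp Fz"
      using F poly2_has_partials unfolding good_branch_formula_def by blast
    let ?m = "2 * k + 1"
    have "branch_formula F0 i j ?m F"
      using F k by (simp add: good_branch_formula_def)
    from branch_formula_dq[OF this F'(3) F0(1)]
    have "branch_formula F0 i (Suc j) (2 * (i + Suc j) - 1) (\<lambda>p z. (3 * z ^ 2 - p) * Fz p z - 6
      * of_nat ?m * z * F p z)"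
      using k by simp
    moreover have "poly2 (\<lambda>p z. (3 * z ^ 2 - p) * Fz p z - 6 * of_nat ?m * z * F p z)"
      using F F' unfolding good_branch_formula_def by (intro poly2_intros) auto
    moreover have "F (3 * \<zeta> ^ 2) \<zeta> = leading_const k * \<zeta> ^ (k + i) * Fz0 (3 * \<zeta> ^ 2) \<zeta>" for \<zeta>
      using F k unfolding good_branch_formula_def by blast
    ultimately have "good_branch_formula F0 Fz0 i (Suc j) (\<lambda>p z. (3 * z ^ 2 - p) * Fz p z - 6 *
      of_nat ?m * z * F p z)"
      using k unfolding good_branch_formula_def by (auto simp: algebra_simps)
    then show ?thesis by blast
  qed
  have step_p: "\<exists>F'. good_branch_formula F0 Fz0 (Suc i) j F'"
    if F: "good_branch_formula F0 Fz0 i j F" and k: "i + j = Suc k" for i j k F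
  proof -
    obtain Fp Fz where F': "poly2 Fp" "poly2 Fz" "has_partials F Fp Fz"
      using F poly2_has_partials unfolding good_branch_formula_def by blast
    let ?m = "2 * k + 1"
    let ?F' = "\<lambda>p z. (3 * z ^ 2 - p) ^ 2 * Fp p z
      + (3 * z ^ 2 - p) * z * Fz p z - of_nat ?m * F p z * (6 * z ^ 2 - (3 * z ^ 2 - p))"
    have "branch_formula F0 i j ?m F"
      using F k by (simp add: good_branch_formula_def)
    from branch_formula_dp[OF this F'(3)]
    have "branch_formula F0 (Suc i) j (2 * (Suc i + j) - 1) ?F'"
      using k by simp
    moreover have "poly2 ?F'"
      using F F' unfolding good_branch_formula_def by (intro poly2_intros) auto
    moreover have "F (3 * \<zeta> ^ 2) \<zeta> = leading_const k * \<zeta> ^ (k + i) * Fz0 (3 * \<zeta> ^ 2) \<zeta>" for \<zeta>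
      using F k unfolding good_branch_formula_def by blast
    ultimately have "good_branch_formula F0 Fz0 (Suc i) j ?F'"
      using k unfolding good_branch_formula_def by (auto simp: algebra_simps power2_eq_square)
    then show ?thesis by blast
  qed
  have q: "\<exists>F. good_branch_formula F0 Fz0 0 j F" for j
  proof (induction j)
    case 0
    have "good_branch_formula F0 Fz0 0 0 F0" using base F0 by (simp add: good_branch_formula_def)
    then show ?case by (rule exI[of _ F0])
  next
    case (Suc j)
    then show ?case using base_q step_q[of 0 j] by (cases j) auto
  qed
  show ?thesis
  proof (induction i)
    case (Suc i)
    show ?case
    proof (cases "i + j")
      case 0
      then show ?thesis using base_p by auto
    next
      case (Suc k)
      then show ?thesis using Suc.IH step_p by blast
    qed
  qed (rule q)
qed

text \<open>At a point of the cusp with a double root \<open>\<zeta>\<close> of the cubic, the terms of top order in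
  the derivatives of a branch have the largest poles, and the leading coefficients of these poles
  assemble to the symbol in the conormal direction.\<close>

lemma branch_equation_symbol_zero:
  assumes U: "open U" "(3 * \<zeta> ^ 2, - 2 * \<zeta> ^ 3) \<in> U" and \<zeta>: "\<zeta> \<noteq> 0"
    and P: "has_symbol U n P \<sigma>" and B: "order_le U (n - 1) B"
    and eq: "\<And>z W x. cubic_branch z W \<Longrightarrow> W \<subseteq> U \<Longrightarrow> x \<in> W \<Longrightarrow> P z x = B (\<lambda>y. z y ^ 2) x"
  shows "\<sigma> ((3 * \<zeta> ^ 2, - 2 * \<zeta> ^ 3), (\<zeta> * l, l)) = 0"
proof -
  define p where "p = 3 * \<zeta> ^ 2"
  define y where "y = (p, - 2 * \<zeta> ^ 3)"
  have y: "y \<in> U" using U by (simp add: y_def p_def)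
  obtain a where a: "\<And>i j. holo_on (a i j) U"
    "\<And>W f x. open W \<Longrightarrow> W \<subseteq> U \<Longrightarrow> holo_on f W \<Longrightarrow> x \<in> W \<Longrightarrow>
       P f x = (\<Sum>(i, j) | int (i + j) \<le> n. a i j x * pd i j f x)"
    "\<And>x \<xi>1 \<xi>2. x \<in> U \<Longrightarrow>
       \<sigma> (x, (\<xi>1, \<xi>2)) = (\<Sum>(i, j) | int (i + j) = n. a i j x * \<xi>1 ^ i * \<xi>2 ^ j)"
    using has_symbolE[OF P] by blast
  obtain c where c: "has_coeffs U (n - 1) B c" using B by (auto simp: order_le_def)
  show ?thesis
  proof (cases "n < 0")
    case True
    then have "{(i, j). int (i + j) = n} = {}" by auto
    then show ?thesis using a(3)[OF y] by (simp add: y_def p_def)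
  next
    case False
    then obtain N where N: "n = int N" by (metis nonneg_int_cases not_less)
    have z_partials: "has_partials (\<lambda>p z. z) (\<lambda>p z. 0) (\<lambda>p z. 1)"
      by (auto simp: has_partials_def intro!: derivative_eq_intros)
    have z2_partials: "has_partials (\<lambda>p z. z ^ 2) (\<lambda>p z. 0) (\<lambda>p z. 2 * z)"
      by (auto simp: has_partials_def intro!: derivative_eq_intros)
    have "\<forall>i j. \<exists>F. good_branch_formula (\<lambda>p z. z) (\<lambda>p z. 1) i j F"
      by (intro allI good_branch_formula_ex[OF _ _ _ z_partials] poly2_intros)
    then obtain F where F: "\<And>i j. good_branch_formula (\<lambda>p z. z) (\<lambda>p z. 1) i j (F i j)"
      unfolding choice_iff by blast
    have "\<forall>i j. \<exists>F. good_branch_formula (\<lambda>p z. z ^ 2) (\<lambda>p z. 2 * z) i j F"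
      by (intro allI good_branch_formula_ex[OF _ _ _ z2_partials] poly2_intros)
    then obtain F' where F': "\<And>i j. good_branch_formula (\<lambda>p z. z ^ 2) (\<lambda>p z. 2 * z) i j (F' i j)"
      unfolding choice_iff by blast
    \<comment> \<open>A curve through the cusp point with \<open>p\<close> fixed: \<open>X t\<close>
      is the point over which \<open>\<zeta> + t\<close> is a root, and the double root is at
      \<open>t = 0\<close>.\<close>
    define X where "X = (\<lambda>t. (p, (\<zeta> + t) ^ 3 - p * (\<zeta> + t)))"
    define \<delta> where "\<delta> = (\<lambda>t. 3 * (\<zeta> + t) ^ 2 - p)"
    \<comment> \<open>For \<zeta> \<noteq> 0 this is nonzero for all small
      \<open>t \<noteq> 0\<close>, so a branch exists at each such \<open>X t\<close>.\<close>
    have \<delta>: "\<delta> t = 3 * t * (2 * \<zeta> + t)" for t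
      by (simp add: \<delta>_def p_def power2_eq_square algebra_simps)
    have X0: "X 0 = y" by (simp add: X_def y_def p_def power2_eq_square power3_eq_cube)
    \<comment> \<open>The exponent left after multiplying by \<delta>^(2 N - 1), the largest pole.
      For total order at most \<open>N\<close> it vanishes exactly in order \<open>N\<close>, also
      for \<open>N = 0\<close> with truncated subtraction.\<close>
    define e where "e = (\<lambda>i j. 2 * N - 1 - (2 * (i + j) - 1))"
    let ?T = "{(i, j). int (i + j) \<le> n}"
    let ?T' = "{(i, j). int (i + j) \<le> n - 1}"
    define H where "H = (\<lambda>t. (\<Sum>r\<in>?T. a (fst r) (snd r) (X t) * F (fst r) (snd r) p (\<zeta> + t) * \<delta> t
      ^ e (fst r) (snd r))
       - (\<Sum>r\<in>?T'. c (fst r) (snd r) (X t) * F' (fst r) (snd r) p (\<zeta> + t) * \<delta> t ^ e (fst r) (snd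
         r)))"
    have X_cont: "isCont X t" for t
      unfolding X_def by (intro continuous_intros)
    have coeff_cont: "isCont (\<lambda>t. b (X t)) 0" if "holo_on b U" for b
    proof (rule isCont_o2[OF X_cont])
      show "isCont b (X 0)"
        using holo_on_has_derivative[OF that y] has_derivative_continuous by (simp add: X0)
    qed
    have poly_cont: "isCont (\<lambda>t. E p (\<zeta> + t)) t0" if "poly2 E" for E t0
    proof -
      have "continuous_on UNIV (\<lambda>t. E p (\<zeta> + t))"
        by (rule poly2_continuous[OF that]) (intro continuous_intros)+
      then show ?thesis by (simp add: continuous_on_eq_continuous_at)
    qed
    have polys: "poly2 (F i j)" "poly2 (F' i j)" for i j
      using F F' by (auto simp: good_branch_formula_def)
    have \<delta>_cont: "isCont \<delta> 0" unfolding \<delta>_def by (intro continuous_intros)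
    have "isCont H 0"
      unfolding H_def
      by (intro isCont_diff isCont_sum ballI isCont_mult isCont_power coeff_cont a poly_cont
        polys \<delta>_cont)
         (use c in \<open>auto simp: has_coeffs_def\<close>)
    then have "(H \<longlongrightarrow> H 0) (at 0)" by (simp add: isCont_def)
    moreover have "\<forall>\<^sub>F t in at 0. H t = 0"
    proof -
      have "\<forall>\<^sub>F t in at 0. X t \<in> U"
        using topological_tendstoD[OF X_cont[of 0, unfolded isCont_def X0] U(1) y] .
      moreover have "\<forall>\<^sub>F t in at 0. t \<noteq> - 2 * \<zeta>"
        by (rule tendsto_imp_eventually_ne[OF tendsto_ident_at]) (use \<zeta> in simp)
      moreover have "\<forall>\<^sub>F t in at 0. t \<noteq> (0::complex)" by (rule eventually_neq_at_within)
      ultimately show ?thesis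
      proof eventually_elim
        case (elim t)
        have "2 * \<zeta> + t \<noteq> 0" using elim(2) by (simp add: add_eq_0_iff)
        then have nz: "\<delta> t \<noteq> 0" using elim(3) by (simp add: \<delta>)
        obtain z W where z: "cubic_branch z W" "W \<subseteq> U" "X t \<in> W" "z (X t) = \<zeta> + t"
          using cubic_branch_exists[of "\<zeta> + t" p U] U(1) elim(1) nz unfolding X_def \<delta>_def by metis
        have W: "open W" "holo_on z W" using z by (auto simp: cubic_branch_def)
        have z2: "holo_on (\<lambda>y. z y ^ 2) W"
          using poly2_branch_holo[OF poly2_power[OF poly2_snd] z(1)] .
        have fp: "fst (X t) = p" by (simp add: X_def)
        have pz: "pd i j z (X t) = F i j p (\<zeta> + t) / \<delta> t ^ (2 * (i + j) - 1)" for i j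
          using branch_formulaD[of "\<lambda>p z. z" i j _ "F i j", OF _ z(1,3)] F[of i j]
          by (simp add: good_branch_formula_def z(4) fp \<delta>_def)
        have pz2: "pd i j (\<lambda>y. z y ^ 2) (X t) = F' i j p (\<zeta> + t) / \<delta> t ^ (2 * (i + j) - 1)" for i j
          using branch_formulaD[of "\<lambda>p z. z ^ 2" i j _ "F' i j", OF _ z(1,3)] F'[of i j]
          by (simp add: good_branch_formula_def z(4) fp \<delta>_def)
        have pow: "\<delta> t ^ (2 * N - 1) / \<delta> t ^ (2 * (i + j) - 1) = \<delta> t ^ e i j" if "i + j \<le> N" for i j
          unfolding e_def using nz that by (intro power_diff[symmetric]) auto
        have "P z (X t) * \<delta> t ^ (2 * N - 1)
          = (\<Sum>r\<in>?T. a (fst r) (snd r) (X t) * F (fst r) (snd r) p (\<zeta> + t) * \<delta> t ^ e (fst r) (snd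
            r))"
          unfolding a(2)[OF W(1) z(2) W(2) z(3)] split_beta sum_distrib_right pz
          by (intro sum.cong refl) (use N in \<open>auto simp flip: pow\<close>)
        moreover have "B (\<lambda>y. z y ^ 2) (X t) = (\<Sum>(i, j) | int (i + j) \<le> n - 1. c i j (X t) * pd
          i j (\<lambda>y. z y ^ 2) (X t))"
          using c W(1) z(2,3) z2 unfolding has_coeffs_def by blast
        then have "B (\<lambda>y. z y ^ 2) (X t) * \<delta> t ^ (2 * N - 1)
          = (\<Sum>r\<in>?T'. c (fst r) (snd r) (X t) * F' (fst r) (snd r) p (\<zeta> + t) * \<delta> t ^ e (fst r)
            (snd r))"
          unfolding split_beta sum_distrib_right pz2
          by (simp only: sum_distrib_right) (intro sum.cong refl, use N in \<open>auto simp flip: pow\<close>)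
        ultimately show "H t = 0" using eq[OF z(1-3)] by (simp add: H_def)
      qed
    qed
    ultimately have H0: "H 0 = 0"
      using tendsto_unique[OF trivial_limit_at] tendsto_eventually by blast
    \<comment> \<open>The nonzero factor common to all leading coefficients of order
      \<open>N\<close>. In order 0 there is no pole, and the value of the branch itself takes its
      place.\<close>
    define K where "K = (if N = 0 then \<zeta> else leading_const (N - 1) * \<zeta> ^ (N - 1))"
    have K: "F i j p \<zeta> = K * \<zeta> ^ i" if "i + j = N" for i j
    proof (cases N)
      case 0
      then show ?thesis using that F[of i j] by (simp add: good_branch_formula_def K_def)
    next
      case (Suc k)
      then have "F i j p \<zeta> = leading_const k * \<zeta> ^ (k + i)"
        using that F[of i j] unfolding good_branch_formula_def p_def by (metis mult.right_neutral)
      then show ?thesis using Suc by (simp add: K_def power_add)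
    qed
    have \<delta>0: "\<delta> 0 = 0" by (simp add: \<delta>)
    \<comment> \<open>Here the order is at most \<open>N - 1\<close>, so every term keeps a positive
      power of \<open>\<delta> 0 = 0\<close>.\<close>
    have "(\<Sum>r\<in>?T'. c (fst r) (snd r) (X 0) * F' (fst r) (snd r) p (\<zeta> + 0) * \<delta> 0 ^ e (fst r) (snd
      r)) = 0"
      by (rule sum.neutral) (use N in \<open>auto simp: \<delta>0 e_def\<close>)
    moreover have "(\<Sum>r\<in>?T. a (fst r) (snd r) (X 0) * F (fst r) (snd r) p (\<zeta> + 0) * \<delta> 0 ^ e (fst
      r) (snd r))
      = (\<Sum>r\<in>?T. if int (fst r + snd r) = n then a (fst r) (snd r) y * (K * \<zeta> ^ fst r) else 0)"
      by (intro sum.cong refl) (use N K in \<open>auto simp: \<delta>0 e_def X0\<close>)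
    ultimately have "(\<Sum>r\<in>?T. if int (fst r + snd r) = n then a (fst r) (snd r) y * (K * \<zeta> ^ fst
      r) else 0) = 0"
      using H0 by (simp add: H_def)
    also have "(\<Sum>r\<in>?T. if int (fst r + snd r) = n then a (fst r) (snd r) y * (K * \<zeta> ^ fst r) else 0)
      = K * (\<Sum>(i, j) | int (i + j) = n. a i j y * \<zeta> ^ i)"
      unfolding sum_degree_eq split_beta sum_distrib_left by (intro sum.cong refl) simp
    finally have "(\<Sum>(i, j) | int (i + j) = n. a i j y * \<zeta> ^ i) = 0"
      using \<zeta> leading_const_nonzero by (auto simp: K_def split: if_splits)
    moreover have "\<sigma> (y, (\<zeta> * l, l)) = l ^ N * (\<Sum>(i, j) | int (i + j) = n. a i j y * \<zeta> ^ i)"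
      unfolding a(3)[OF y] split_beta sum_distrib_left
      by (intro sum.cong refl) (auto simp: N power_mult_distrib power_add simp flip: of_nat_add)
    ultimately show ?thesis by (simp add: y_def p_def)
  qed
qed

section \<open>The cokernel\<close>

text \<open>The operations of \<open>coker_phi\<close> saturate sets that may fill only part of a
  class; one representative inside the right class determines the result.\<close>

lemma equiv_Image_eq_class:
  assumes "equiv A r" "B \<subseteq> r `` {a}" "a \<in> B"
  shows "r `` B = r `` {a}"
proof
  have "trans r" using assms(1) by (rule equivE)
  then show "r `` B \<subseteq> r `` {a}" using assms(2) by (auto dest: transD)
qed (use assms(3) in auto)

section \<open>Pairs of operator germs modulo the relations\<close>

definition act :: "oper \<Rightarrow> oper \<times> oper \<Rightarrow> oper \<times> oper" where
  "act P u = (P \<circ> fst u, P \<circ> snd u)"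

definition same_germ2 :: "point \<Rightarrow> oper \<times> oper \<Rightarrow> oper \<times> oper \<Rightarrow> bool" where
  "same_germ2 x u v \<longleftrightarrow> same_germ x (fst u) (fst v) \<and> same_germ x (snd u) (snd v)"

lemma same_germ2_refl: "same_germ2 x u u"
  by (simp add: same_germ2_def same_germ_refl)

lemma same_germ2_sym: "same_germ2 x u v \<Longrightarrow> same_germ2 x v u"
  by (simp add: same_germ2_def same_germ_sym)

lemma same_germ2_trans: "same_germ2 x u v \<Longrightarrow> same_germ2 x v w \<Longrightarrow> same_germ2 x u w"
  unfolding same_germ2_def by (elim conjE, intro conjI; erule same_germ_trans; assumption)

lemma same_germ2_add: "same_germ2 x u u' \<Longrightarrow> same_germ2 x v v' \<Longrightarrow> same_germ2 x (u + v) (u' + v')"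
  by (simp add: same_germ2_def same_germ_add)

lemma oper_sum_apply: "(\<Sum>i\<in>I. P i) f y = (\<Sum>i\<in>I. P i f y)" for P :: "'i \<Rightarrow> oper"
  by (induction I rule: infinite_finite_induct) simp_all

lemma phi_zero: "phi R (\<lambda>k l. 0) = 0"
  by (simp add: phi_def prod_eq_iff fun_eq_iff)

text \<open>An equality of maps and not only of germs, because the coefficients are the left factors
  of the compositions.\<close>

lemma phi_add: "phi R (\<lambda>k l. Q k l + Q' k l) = phi R Q + phi R Q'"
  by (simp add: phi_def prod_eq_iff fun_eq_iff)

lemma phi_uminus: "phi R (\<lambda>k l. - Q k l) = - phi R Q"
  by (simp add: phi_def prod_eq_iff fun_eq_iff)

lemma phi_eq:
  "phi R Q = ((\<Sum>kl\<in>{1,2,3} \<times> {1,2}. Q (fst kl) (snd kl) \<circ> R (fst kl) (snd kl) 1),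
     (\<Sum>kl\<in>{1,2,3} \<times> {1,2}. Q (fst kl) (snd kl) \<circ> R (fst kl) (snd kl) 2))"
  unfolding phi_def by (simp only: sum.cartesian_product sum_prod case_prod_unfold)

text \<open>The good filtration generated by the classes of \<open>(id, 0)\<close> and
  \<open>(0, id)\<close>, both placed in degree 0.\<close>

definition std_filt :: "(nat \<Rightarrow> nat \<Rightarrow> nat \<Rightarrow> oper) \<Rightarrow> point \<Rightarrow> int \<Rightarrow> (oper \<times> oper) set set" where
  "std_filt R x n = {phi_rel R x `` {(A, B)} | A B. A \<in> Dfilt x n \<and> B \<in> Dfilt x n}"

locale coker =
  fixes R :: "nat \<Rightarrow> nat \<Rightarrow> nat \<Rightarrow> oper" and x :: point
  assumes R: "\<lbrakk>k \<in> {1,2,3}; l \<in> {1,2}; j \<in> {1,2}\<rbrakk> \<Longrightarrow> R k l j \<in> Dstalk x"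
begin

abbreviation S where "S \<equiv> Dstalk x \<times> Dstalk x"
abbreviation cls where "cls u \<equiv> phi_rel R x `` {u}"
abbreviation M where "M \<equiv> coker_phi R x"

lemma S_add: "u \<in> S \<Longrightarrow> v \<in> S \<Longrightarrow> u + v \<in> S"
  by (auto simp: Dstalk_add)

lemma S_zero: "0 \<in> S"
  by (simp add: zero_prod_def Dstalk_zero)

lemma S_act: "P \<in> Dstalk x \<Longrightarrow> u \<in> S \<Longrightarrow> act P u \<in> S"
  by (auto simp: act_def Dstalk_comp)

lemma phi_relI:
  assumes "u \<in> S" "v \<in> S" "\<And>k l. k \<in> {1,2,3} \<Longrightarrow> l \<in> {1,2} \<Longrightarrow> Q k l \<in> Dstalk x" "same_germ2 x v (u
    + phi R Q)"
  shows "(u, v) \<in> phi_rel R x"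
  using assms unfolding phi_rel_def same_germ2_def by blast

lemma phi_relE:
  assumes "(u, v) \<in> phi_rel R x"
  obtains Q where "u \<in> S" "v \<in> S" "\<forall>k\<in>{1,2,3}. \<forall>l\<in>{1,2}. Q k l \<in> Dstalk x" "same_germ2 x v (u +
    phi R Q)"
  using assms unfolding phi_rel_def same_germ2_def by blast

lemma same_germ2_phi_rel: "u \<in> S \<Longrightarrow> v \<in> S \<Longrightarrow> same_germ2 x v u \<Longrightarrow> (u, v) \<in> phi_rel R x"
  by (rule phi_relI[of _ _ "\<lambda>_ _. 0"]) (simp_all only: phi_zero Dstalk_zero add_0_right)

lemma phi_rel_equiv: "equiv S (phi_rel R x)"
proof (rule equivI)
  show "phi_rel R x \<subseteq> S \<times> S" by (auto simp: phi_rel_def)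
  show "refl_on S (phi_rel R x)"
    by (rule refl_onI) (intro same_germ2_phi_rel same_germ2_refl)
  show "sym (phi_rel R x)"
  proof (rule symI)
    fix u v assume "(u, v) \<in> phi_rel R x"
    then obtain Q where Q: "u \<in> S" "v \<in> S" "\<forall>k\<in>{1,2,3}. \<forall>l\<in>{1,2}. Q k l \<in> Dstalk x" "same_germ2
      x v (u + phi R Q)"
      by (rule phi_relE)
    have "same_germ2 x (v + - phi R Q) ((u + phi R Q) + - phi R Q)"
      by (rule same_germ2_add[OF Q(4) same_germ2_refl])
    then have "same_germ2 x u (v + phi R (\<lambda>k l. - Q k l))"
      unfolding phi_uminus by (simp only: add.assoc right_minus add_0_right same_germ2_sym)
    then show "(v, u) \<in> phi_rel R x"
      using Q by (intro phi_relI[of _ _ "\<lambda>k l. - Q k l"]) (auto simp: Dstalk_uminus)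
  qed
  show "trans (phi_rel R x)"
  proof (rule transI)
    fix u v w assume "(u, v) \<in> phi_rel R x" "(v, w) \<in> phi_rel R x"
    then obtain Q Q' where Q: "u \<in> S" "v \<in> S" "\<forall>k\<in>{1,2,3}. \<forall>l\<in>{1,2}. Q k l \<in> Dstalk x"
      "same_germ2 x v (u + phi R Q)"
      and Q': "w \<in> S" "\<forall>k\<in>{1,2,3}. \<forall>l\<in>{1,2}. Q' k l \<in> Dstalk x" "same_germ2 x w (v + phi R Q')"
      by (elim phi_relE)
    have "same_germ2 x (v + phi R Q') ((u + phi R Q) + phi R Q')"
      by (rule same_germ2_add[OF Q(4) same_germ2_refl])
    then have "same_germ2 x w (u + phi R (\<lambda>k l. Q k l + Q' k l))"
      unfolding phi_add add.assoc[symmetric] by (rule same_germ2_trans[OF Q'(3)])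
    then show "(u, w) \<in> phi_rel R x"
      using Q Q' by (intro phi_relI[of _ _ "\<lambda>k l. Q k l + Q' k l"]) (auto simp: Dstalk_add)
  qed
qed

lemma cls_eq_iff: "u \<in> S \<Longrightarrow> v \<in> S \<Longrightarrow> cls u = cls v \<longleftrightarrow> (u, v) \<in> phi_rel R x"
  by (rule eq_equiv_class_iff[OF phi_rel_equiv])

lemma cls_self: "u \<in> S \<Longrightarrow> u \<in> cls u"
  by (rule equiv_class_self[OF phi_rel_equiv])

lemma cls_eqI: "u \<in> S \<Longrightarrow> v \<in> S \<Longrightarrow> same_germ2 x v u \<Longrightarrow> cls u = cls v"
  using cls_eq_iff same_germ2_phi_rel by blast

lemma phi_rel_add:
  assumes "(u, u') \<in> phi_rel R x" "(v, v') \<in> phi_rel R x"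
  shows "(u + v, u' + v') \<in> phi_rel R x"
proof -
  obtain Q Q' where Q: "u \<in> S" "u' \<in> S" "\<forall>k\<in>{1,2,3}. \<forall>l\<in>{1,2}. Q k l \<in> Dstalk x" "same_germ2 x
    u' (u + phi R Q)"
    and Q': "v \<in> S" "v' \<in> S" "\<forall>k\<in>{1,2,3}. \<forall>l\<in>{1,2}. Q' k l \<in> Dstalk x" "same_germ2 x v' (v + phi
      R Q')"
    using assms by (elim phi_relE)
  have eq: "(u + phi R Q) + (v + phi R Q') = (u + v) + phi R (\<lambda>k l. Q k l + Q' k l)"
    unfolding phi_add by (simp only: add_ac)
  have "same_germ2 x (u' + v') ((u + v) + phi R (\<lambda>k l. Q k l + Q' k l))"
    unfolding eq[symmetric] by (rule same_germ2_add[OF Q(4) Q'(4)])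
  then show ?thesis
    using Q Q' by (intro phi_relI[of _ _ "\<lambda>k l. Q k l + Q' k l"] S_add) (auto simp: Dstalk_add)
qed

lemma phi_in_S:
  assumes "\<forall>k\<in>{1,2,3}. \<forall>l\<in>{1,2}. Q k l \<in> Dstalk x"
  shows "phi R Q \<in> S"
  unfolding phi_eq using assms R by (intro SigmaI Dstalk_sum Dstalk_comp) auto

text \<open>The image of \<open>phi\<close> is a left submodule by associativity; moving
  \<open>P\<close> into the sum uses its additivity, hence the statement about germs.\<close>

lemma act_phi:
  assumes P: "P \<in> Dstalk x" and Q: "\<forall>k\<in>{1,2,3}. \<forall>l\<in>{1,2}. Q k l \<in> Dstalk x"
  shows "same_germ2 x (act P (phi R Q)) (phi R (\<lambda>k l. P \<circ> Q k l))"
  unfolding phi_eq act_def same_germ2_def fst_conv snd_conv comp_assoc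
  using Q R by (intro conjI same_germ_comp_sum P Dstalk_comp) auto

lemma act_add:
  assumes "P \<in> Dstalk x" "u \<in> S" "v \<in> S"
  shows "same_germ2 x (act P (u + v)) (act P u + act P v)"
  using assms by (auto simp: act_def same_germ2_def intro: same_germ_comp_add)

lemma phi_rel_act:
  assumes P: "P \<in> Dstalk x" and uv: "(u, v) \<in> phi_rel R x"
  shows "(act P u, act P v) \<in> phi_rel R x"
proof -
  obtain Q where Q: "u \<in> S" "v \<in> S" "\<forall>k\<in>{1,2,3}. \<forall>l\<in>{1,2}. Q k l \<in> Dstalk x" "same_germ2 x v (u
    + phi R Q)"
    using uv by (rule phi_relE)
  have "same_germ2 x (act P v) (act P (u + phi R Q))"
    using Q(2,4) P unfolding same_germ2_def act_def fst_conv snd_conv by (auto intro: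
      same_germ_comp)
  moreover have "same_germ2 x (act P (u + phi R Q)) (act P u + act P (phi R Q))"
    by (intro act_add P Q phi_in_S)
  moreover have "same_germ2 x (act P u + act P (phi R Q)) (act P u + phi R (\<lambda>k l. P \<circ> Q k l))"
    by (intro same_germ2_add same_germ2_refl act_phi P Q)
  ultimately have "same_germ2 x (act P v) (act P u + phi R (\<lambda>k l. P \<circ> Q k l))"
    using same_germ2_trans by blast
  then show ?thesis
    using Q P by (intro phi_relI[of _ _ "\<lambda>k l. P \<circ> Q k l"] S_act Dstalk_comp) auto
qed

lemma carrier_coker: "carrier M = cls ` S"
  by (auto simp: coker_phi_def quotient_def)

lemma zero_coker: "\<zero>\<^bsub>M\<^esub> = cls 0"
  by (simp add: coker_phi_def)

lemma add_coker:
  assumes "u \<in> S" "v \<in> S"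
  shows "cls u \<oplus>\<^bsub>M\<^esub> cls v = cls (u + v)"
proof -
  have "phi_rel R x `` {u' + v' | u' v'. u' \<in> cls u \<and> v' \<in> cls v} = cls (u + v)"
  proof (rule equiv_Image_eq_class[OF phi_rel_equiv])
    show "{u' + v' | u' v'. u' \<in> cls u \<and> v' \<in> cls v} \<subseteq> cls (u + v)"
      using phi_rel_add by blast
    show "u + v \<in> {u' + v' | u' v'. u' \<in> cls u \<and> v' \<in> cls v}"
      using cls_self[OF assms(1)] cls_self[OF assms(2)] by blast
  qed
  then show ?thesis by (simp add: coker_phi_def)
qed

lemma smult_coker:
  assumes "P \<in> Dstalk x" "u \<in> S"
  shows "P \<odot>\<^bsub>M\<^esub> cls u = cls (act P u)"
proof -
  have "phi_rel R x `` {(P \<circ> u1, P \<circ> u2) | u1 u2. (u1, u2) \<in> cls u} = cls (act P u)"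
  proof (rule equiv_Image_eq_class[OF phi_rel_equiv])
    show "{(P \<circ> u1, P \<circ> u2) | u1 u2. (u1, u2) \<in> cls u} \<subseteq> cls (act P u)"
      using phi_rel_act[OF assms(1), of u] by (fastforce simp: act_def)
    have "(fst u, snd u) \<in> cls u" using cls_self[OF assms(2)] by simp
    then show "act P u \<in> {(P \<circ> u1, P \<circ> u2) | u1 u2. (u1, u2) \<in> cls u}"
      unfolding act_def by blast
  qed
  then show ?thesis by (simp add: coker_phi_def)
qed

lemma carrier_cokerE:
  assumes "w \<in> carrier M"
  obtains u where "u \<in> S" "w = cls u"
  using assms unfolding carrier_coker by blast

lemma cls_in_carrier: "u \<in> S \<Longrightarrow> cls u \<in> carrier M"
  unfolding carrier_coker by blast

sublocale D_module x M
proof (intro D_module.intro abelian_monoidI D_module_axioms.intro)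
  show "\<zero>\<^bsub>M\<^esub> \<in> carrier M" unfolding zero_coker by (rule cls_in_carrier[OF S_zero])
next
  fix v w assume "v \<in> carrier M" "w \<in> carrier M"
  then obtain a b where "a \<in> S" "b \<in> S" and eq: "v = cls a" "w = cls b" by (metis carrier_cokerE)
  then show "v \<oplus>\<^bsub>M\<^esub> w \<in> carrier M" "v \<oplus>\<^bsub>M\<^esub> w = w \<oplus>\<^bsub>M\<^esub> v"
    unfolding eq by (simp_all only: add_coker cls_in_carrier S_add add.commute)
next
  fix u v w assume "u \<in> carrier M" "v \<in> carrier M" "w \<in> carrier M"
  then obtain a b c where "a \<in> S" "b \<in> S" "c \<in> S" and eq: "u = cls a" "v = cls b" "w = cls c"
    by (metis carrier_cokerE)
  then show "u \<oplus>\<^bsub>M\<^esub> v \<oplus>\<^bsub>M\<^esub> w = u \<oplus>\<^bsub>M\<^esub> (v \<oplus>\<^bsub>M\<^esub> w)"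
    unfolding eq by (simp only: add_coker S_add add.assoc)
next
  fix w assume "w \<in> carrier M"
  then obtain a where a: "a \<in> S" and eq: "w = cls a" by (metis carrier_cokerE)
  show "\<zero>\<^bsub>M\<^esub> \<oplus>\<^bsub>M\<^esub> w = w"
    unfolding eq zero_coker by (simp only: add_coker[OF S_zero a] add_0_left)
  have "act id a = a" "act 0 a = 0" by (simp_all add: act_def prod_eq_iff fun_eq_iff)
  then show "id \<odot>\<^bsub>M\<^esub> w = w" "0 \<odot>\<^bsub>M\<^esub> w = \<zero>\<^bsub>M\<^esub>"
    unfolding eq zero_coker smult_coker[OF Dstalk_id a] smult_coker[OF Dstalk_zero a] by simp_all
next
  fix P w assume P: "P \<in> Dstalk x" and "w \<in> carrier M"
  then obtain a where a: "a \<in> S" and eq: "w = cls a" by (metis carrier_cokerE)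
  show "P \<odot>\<^bsub>M\<^esub> w \<in> carrier M"
    unfolding eq smult_coker[OF P a] by (rule cls_in_carrier[OF S_act[OF P a]])
next
  fix P v w assume P: "P \<in> Dstalk x" and "v \<in> carrier M" "w \<in> carrier M"
  then obtain a b where ab: "a \<in> S" "b \<in> S" and eq: "v = cls a" "w = cls b" by (metis
    carrier_cokerE)
  have "cls (act P (a + b)) = cls (act P a + act P b)"
    by (intro cls_eqI S_act S_add P ab same_germ2_sym[OF act_add])
  then show "P \<odot>\<^bsub>M\<^esub> (v \<oplus>\<^bsub>M\<^esub> w) = P \<odot>\<^bsub>M\<^esub> v \<oplus>\<^bsub>M\<^esub> P \<odot>\<^bsub>M\<^esub> w"
    unfolding eq using P ab by (simp only: add_coker smult_coker S_add S_act)
next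
  fix P Q w assume PQ: "P \<in> Dstalk x" "Q \<in> Dstalk x" and "w \<in> carrier M"
  then obtain a where a: "a \<in> S" and eq: "w = cls a" by (metis carrier_cokerE)
  have "act (P + Q) a = act P a + act Q a" "act (P \<circ> Q) a = act P (act Q a)"
    by (simp_all add: act_def prod_eq_iff fun_eq_iff)
  then show "(P + Q) \<odot>\<^bsub>M\<^esub> w = P \<odot>\<^bsub>M\<^esub> w \<oplus>\<^bsub>M\<^esub> Q \<odot>\<^bsub>M\<^esub> w" "(P \<circ> Q) \<odot>\<^bsub>M\<^esub> w = P \<odot>\<^bsub>M\<^esub> (Q \<odot>\<^bsub>M\<^esub> w)"
    unfolding eq using PQ a by (simp_all only: add_coker smult_coker S_act Dstalk_add Dstalk_comp)
next
  fix P assume P: "P \<in> Dstalk x"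
  have "same_germ2 x (act P 0) 0"
    using same_germ_comp_zero[OF P] by (simp add: act_def same_germ2_def)
  then have "cls 0 = cls (act P 0)" by (intro cls_eqI S_zero S_act P)
  then show "P \<odot>\<^bsub>M\<^esub> \<zero>\<^bsub>M\<^esub> = \<zero>\<^bsub>M\<^esub>"
    unfolding zero_coker smult_coker[OF P S_zero] by simp
qed

lemma std_filt_good: "good_filtration x M (std_filt R x)"
proof -
  define u where "u = (\<lambda>i::nat. if i = 0 then cls (id, 0) else cls (0, id))"
  have e: "(id, 0) \<in> S" "(0, id) \<in> S" by (simp_all add: Dstalk_id Dstalk_zero)
  have u: "\<forall>i<2. u i \<in> carrier M" by (simp add: u_def cls_in_carrier[OF e(1)] cls_in_carrier[OF
    e(2)])
  have sum_eq: "(\<Oplus>\<^bsub>M\<^esub>i\<in>{..<2}. Q i \<odot>\<^bsub>M\<^esub> u i) = cls (Q 0, Q 1)"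
    if Q: "Q 0 \<in> Dstalk x" "Q 1 \<in> Dstalk x" for Q :: "nat \<Rightarrow> oper"
  proof -
    have "{..<2::nat} = {0, 1}" by auto
    then have "(\<Oplus>\<^bsub>M\<^esub>i\<in>{..<2}. Q i \<odot>\<^bsub>M\<^esub> u i) = Q 0 \<odot>\<^bsub>M\<^esub> u 0 \<oplus>\<^bsub>M\<^esub> Q 1 \<odot>\<^bsub>M\<^esub> u 1"
      using Q u by (simp add: smult_closed Pi_def)
    also have "\<dots> = cls (act (Q 0) (id, 0) + act (Q 1) (0, id))"
      using Q e by (simp add: u_def smult_coker add_coker S_act)
    also have "\<dots> = cls (Q 0, Q 1)"
    proof (rule sym, rule cls_eqI)
      show "same_germ2 x (act (Q 0) (id, 0) + act (Q 1) (0, id)) (Q 0, Q 1)"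
        using same_germ_add[OF same_germ_refl same_germ_comp_zero[OF Q(2)], of "Q 0"]
          same_germ_add[OF same_germ_comp_zero[OF Q(1)] same_germ_refl, of "Q 1"]
        by (simp add: act_def same_germ2_def)
    qed (use Q e in \<open>auto intro: S_add S_act\<close>)
    finally show ?thesis .
  qed
  have eq: "std_filt R x n = {(\<Oplus>\<^bsub>M\<^esub>i\<in>{..<2}. Q i \<odot>\<^bsub>M\<^esub> u i) | Q. \<forall>i<2. Q i \<in> Dfilt x (n - 0)}" for n
  proof (intro equalityI subsetI)
    fix w assume "w \<in> std_filt R x n"
    then obtain A B where AB: "A \<in> Dfilt x n" "B \<in> Dfilt x n" and w: "w = cls (A, B)"
      unfolding std_filt_def by blast
    let ?Q = "\<lambda>i::nat. if i = 0 then A else B"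
    have "w = (\<Oplus>\<^bsub>M\<^esub>i\<in>{..<2}. ?Q i \<odot>\<^bsub>M\<^esub> u i)"
      using sum_eq[of ?Q] AB Dfilt_in_Dstalk w by simp
    moreover have "\<forall>i<2. ?Q i \<in> Dfilt x (n - 0)" using AB by simp
    ultimately show "w \<in> {(\<Oplus>\<^bsub>M\<^esub>i\<in>{..<2}. Q i \<odot>\<^bsub>M\<^esub> u i) | Q. \<forall>i<2. Q i \<in> Dfilt x (n - 0)}"
      by (intro CollectI exI[of _ ?Q] conjI)
  next
    fix w assume "w \<in> {(\<Oplus>\<^bsub>M\<^esub>i\<in>{..<2}. Q i \<odot>\<^bsub>M\<^esub> u i) | Q. \<forall>i<2. Q i \<in> Dfilt x (n - 0)}"
    then obtain Q where Q: "\<forall>i<2. Q i \<in> Dfilt x (n - 0)" and w: "w = (\<Oplus>\<^bsub>M\<^esub>i\<in>{..<2}. Q i \<odot>\<^bsub>M\<^esub> u i)"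
      by blast
    have Q': "Q 0 \<in> Dfilt x n" "Q 1 \<in> Dfilt x n" using Q by auto
    then have "w = cls (Q 0, Q 1)" unfolding w by (intro sum_eq Dfilt_in_Dstalk)
    then show "w \<in> std_filt R x n" unfolding std_filt_def using Q' by blast
  qed
  have "(\<Union>n. std_filt R x n) = carrier M"
  proof (intro equalityI subsetI)
    fix w assume "w \<in> carrier M"
    then obtain v where "v \<in> S" and w: "w = cls v" by (rule carrier_cokerE)
    then have v: "fst v \<in> Dstalk x" "snd v \<in> Dstalk x" by auto
    obtain n where "fst v \<in> Dfilt x n" "snd v \<in> Dfilt x n" using v by (rule Dstalk_common)
    then have "cls (fst v, snd v) \<in> std_filt R x n" unfolding std_filt_def by blast
    then show "w \<in> (\<Union>n. std_filt R x n)" unfolding w by auto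
  next
    fix w assume "w \<in> (\<Union>n. std_filt R x n)"
    then obtain n A B where "A \<in> Dfilt x n" "B \<in> Dfilt x n" and w: "w = cls (A, B)"
      unfolding std_filt_def by blast
    then show "w \<in> carrier M" unfolding w by (intro cls_in_carrier SigmaI Dfilt_in_Dstalk)
  qed
  then show ?thesis
    unfolding good_filtration_def using u eq
    by (intro conjI exI[of _ 2] exI[of _ u] exI[of _ "\<lambda>_. 0"]) auto
qed

end

text \<open>Modulo the image of \<open>phi\<close>, the operators \<open>R k 1 1\<close> and \<open>R k 2 2\<close>, which have the same
  symbol, can be moved to the right of the coefficients.\<close>

lemma (in coker) std_filt_lowered:
  assumes k: "k \<in> {1,2,3}" and U: "open U" "x \<in> U"
    and diag: "has_symbol U m (R k 1 1) \<sigma>" "has_symbol U m (R k 2 2) \<sigma>"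
    and off: "order_le U (m - 1) (R k 1 2)" "order_le U (m - 1) (R k 2 1)"
    and w: "w \<in> std_filt R x n"
  shows "R k 1 1 \<odot>\<^bsub>M\<^esub> w \<in> std_filt R x (n + m - 1)"
proof -
  obtain A B where AB: "A \<in> Dfilt x n" "B \<in> Dfilt x n" and w: "w = cls (A, B)"
    using w unfolding std_filt_def by blast
  have AB': "A \<in> Dstalk x" "B \<in> Dstalk x" using AB Dfilt_in_Dstalk by auto
  let ?P = "R k 1 1"
  have P: "?P \<in> Dstalk x" using R k by simp
  have off': "R k 1 2 \<in> Dfilt x (m - 1)" "R k 2 1 \<in> Dfilt x (m - 1)"
    using off U unfolding Dfilt_def by blast+
  \<comment> \<open>Subtracting \<open>A\<close> times the first and \<open>B\<close> times the
    second relation of index \<open>k\<close> turns \<open>R k 1 1 \<circ> A\<close> and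
    \<open>R k 1 1 \<circ> B\<close> into the commutator-like terms \<open>C\<close> and
    \<open>E\<close>, up to off-diagonal entries of smaller order.\<close>
  define Q where "Q = (\<lambda>k' (l::nat). if k' = k then if l = 1 then - A else - B else 0 :: oper)"
  have Q: "Q k' l \<in> Dstalk x" for k' l
    unfolding Q_def using AB' by (simp add: Dstalk_uminus Dstalk_zero)
  define C where "C = ((?P \<circ> A) - (A \<circ> ?P)) - (B \<circ> R k 2 1)"
  define E where "E = ((?P \<circ> B) - (B \<circ> R k 2 2)) - (A \<circ> R k 1 2)"
  have phiQ: "phi R Q = (- (A \<circ> R k 1 1) - (B \<circ> R k 2 1), - (A \<circ> R k 1 2) - (B \<circ> R k 2 2))"
    using k by (auto simp: phi_def Q_def prod_eq_iff fun_eq_iff)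
  have eq: "(C, E) = (?P \<circ> A, ?P \<circ> B) + phi R Q"
    unfolding phiQ C_def E_def by (simp add: algebra_simps)
  have "C \<in> Dfilt x (n + m - 1)"
    using Dfilt_comp_diff[OF AB(1) U diag(1,1)] Dfilt_comp[OF AB(2) off'(2)]
    unfolding C_def add.commute[of m n] add_diff_eq by (rule Dfilt_diff)
  \<comment> \<open>Here two different operators meet, \<open>R k 1 1\<close> on the left of
    \<open>B\<close> and \<open>R k 2 2\<close> on its right; their common symbol makes the leading
    terms cancel.\<close>
  moreover have "E \<in> Dfilt x (n + m - 1)"
    using Dfilt_comp_diff[OF AB(2) U diag] Dfilt_comp[OF AB(1) off'(1)]
    unfolding E_def add.commute[of m n] add_diff_eq by (rule Dfilt_diff)
  moreover have "cls (?P \<circ> A, ?P \<circ> B) = cls (C, E)"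
  proof (subst cls_eq_iff)
    show "((?P \<circ> A, ?P \<circ> B), (C, E)) \<in> phi_rel R x"
    proof (rule phi_relI[of _ _ Q])
      show "same_germ2 x (C, E) ((?P \<circ> A, ?P \<circ> B) + phi R Q)" unfolding eq by (rule same_germ2_refl)
    qed (use calculation P AB' Q in \<open>auto intro: Dstalk_comp Dfilt_in_Dstalk\<close>)
  qed (use calculation P AB' in \<open>auto intro: Dstalk_comp Dfilt_in_Dstalk\<close>)
  ultimately show ?thesis
    unfolding w std_filt_def using smult_coker[OF P, of "(A, B)"] AB'
    by (auto simp: act_def simp del: Image_singleton_iff)
qed

text \<open>The relation satisfied by an operator which lowers degrees, evaluated on the solution
  \<open>(z, z\<^sup>2)\<close>.\<close>

lemma (in coker) lowering_imp_branch_equation: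
  assumes P: "P \<in> Dfilt x n" and low: "P \<odot>\<^bsub>M\<^esub> cls (id, 0) \<in> std_filt R x (n - 1)"
    and D: "open D" "x \<in> D"
    and R_order: "\<And>k l j. k \<in> {1,2,3} \<Longrightarrow> l \<in> {1,2} \<Longrightarrow> j \<in> {1,2} \<Longrightarrow> \<exists>m. order_le D m (R k l j)"
    and sol: "\<And>k l W z y. \<lbrakk>k \<in> {1,2,3}; l \<in> {1,2}; cubic_branch z W; W \<subseteq> D; y \<in> W\<rbrakk> \<Longrightarrow>
       R k l 1 z y + R k l 2 (\<lambda>y. z y ^ 2) y = 0"
  shows "\<exists>U A B. open U \<and> x \<in> U \<and> order_le U (n - 1) A \<and> order_le U (n - 1) B \<and>
    (\<forall>z W. cubic_branch z W \<and> W \<subseteq> U \<longrightarrow> (\<forall>y\<in>W. P z y = A z y + B (\<lambda>y. z y ^ 2) y))"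
proof -
  have Pst: "P \<in> Dstalk x" using P by (rule Dfilt_in_Dstalk)
  obtain A B where AB: "A \<in> Dfilt x (n - 1)" "B \<in> Dfilt x (n - 1)" and eq: "P \<odot>\<^bsub>M\<^esub> cls (id, 0) =
    cls (A, B)"
    using low unfolding std_filt_def by blast
  have e: "(id, 0) \<in> S" "(A, B) \<in> S" using AB by (auto simp: Dstalk_id Dstalk_zero intro:
    Dfilt_in_Dstalk)
  have "((A, B), act P (id, 0)) \<in> phi_rel R x"
    using eq unfolding smult_coker[OF Pst e(1)] using cls_eq_iff[OF e(2) S_act[OF Pst e(1)]] by simp
  then obtain Q where Q: "\<forall>k\<in>{1,2,3}. \<forall>l\<in>{1,2}. Q k l \<in> Dstalk x" and sg: "same_germ2 x (act P
    (id, 0)) ((A, B) + phi R Q)"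
    by (rule phi_relE)
  let ?I = "{1,2,3} \<times> {1,2::nat}"
  have sg1: "same_germ x P (A + (\<Sum>kl\<in>?I. Q (fst kl) (snd kl) \<circ> R (fst kl) (snd kl) 1))"
    and sg2: "same_germ x (P \<circ> 0) (B + (\<Sum>kl\<in>?I. Q (fst kl) (snd kl) \<circ> R (fst kl) (snd kl) 2))"
    using sg by (simp_all add: same_germ2_def act_def phi_eq)
  obtain U1 where U1: "open U1" "x \<in> U1" "\<forall>W f. open W \<and> W \<subseteq> U1 \<and> holo_on f W \<longrightarrow> (\<forall>y\<in>W. P f y
      = (A + (\<Sum>kl\<in>?I. Q (fst kl) (snd kl) \<circ> R (fst kl) (snd kl) 1)) f y)"
    using sg1 by (rule same_germE)
  obtain U2 where U2: "open U2" "x \<in> U2" "\<forall>W f. open W \<and> W \<subseteq> U2 \<and> holo_on f W \<longrightarrow> (\<forall>y\<in>W. (P \<circ> 0) f y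
      = (B + (\<Sum>kl\<in>?I. Q (fst kl) (snd kl) \<circ> R (fst kl) (snd kl) 2)) f y)"
    using sg2 by (rule same_germE)
  obtain U3 where U3: "open U3" "x \<in> U3" "order_le U3 (n - 1) A" using AB(1) by (auto simp:
    Dfilt_def)
  obtain U4 where U4: "open U4" "x \<in> U4" "order_le U4 (n - 1) B" using AB(2) by (auto simp:
    Dfilt_def)
  obtain U5 where U5: "open U5" "x \<in> U5" "order_le U5 n P" using P by (auto simp: Dfilt_def)
  have "\<forall>kl\<in>?I. \<exists>V m. open V \<and> x \<in> V \<and> order_le V m (Q (fst kl) (snd kl))"
    using Q by (fastforce elim!: DstalkE)
  then obtain V m where V: "\<And>kl. kl \<in> ?I \<Longrightarrow> open (V kl)" "\<And>kl. kl \<in> ?I \<Longrightarrow> x \<in> V kl"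
    "\<And>kl. kl \<in> ?I \<Longrightarrow> order_le (V kl) (m kl) (Q (fst kl) (snd kl))"
    unfolding bchoice_iff by metis
  define U where "U = U1 \<inter> U2 \<inter> U3 \<inter> U4 \<inter> U5 \<inter> D \<inter> (\<Inter>kl\<in>?I. V kl)"
  have "open (\<Inter>kl\<in>?I. V kl)" using V(1) by (intro open_INT) auto
  then have "open U" unfolding U_def using U1(1) U2(1) U3(1) U4(1) U5(1) D(1) by (intro open_Int)
  moreover have "x \<in> (\<Inter>kl\<in>?I. V kl)" using V(2) by blast
  then have "x \<in> U" unfolding U_def using U1(2) U2(2) U3(2) U4(2) U5(2) D(2) by blast
  ultimately have U: "open U" "x \<in> U" .
  have U_sub: "U \<subseteq> U1" "U \<subseteq> U2" "U \<subseteq> U3" "U \<subseteq> U4" "U \<subseteq> U5" "U \<subseteq> D" "\<And>kl. kl \<in> ?I \<Longrightarrow> U \<subseteq> V kl"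
    unfolding U_def by auto
  have "P z y = A z y + B (\<lambda>y. z y ^ 2) y" if z: "cubic_branch z W" and W: "W \<subseteq> U" and y: "y \<in>
    W" for z W y
  proof -
    have oW: "open W" and hz: "holo_on z W" using z by (auto simp: cubic_branch_def)
    have hz2: "holo_on (\<lambda>y. z y ^ 2) W" using poly2_branch_holo[OF poly2_power[OF poly2_snd] z] .
    have eq1: "P z y = A z y + (\<Sum>kl\<in>?I. Q (fst kl) (snd kl) (R (fst kl) (snd kl) 1 z) y)"
    proof -
      have "P z y = (A + (\<Sum>kl\<in>?I. Q (fst kl) (snd kl) \<circ> R (fst kl) (snd kl) 1)) z y"
        using U1(3) oW hz y order_trans[OF W U_sub(1)] by blast
      then show ?thesis by (simp only: plus_fun_apply oper_sum_apply comp_apply)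
    qed
    have "(P \<circ> 0) (\<lambda>y. z y ^ 2) y = B (\<lambda>y. z y ^ 2) y + (\<Sum>kl\<in>?I. Q (fst kl) (snd kl) (R (fst kl)
      (snd kl) 2 (\<lambda>y. z y ^ 2)) y)"
    proof -
      have "(P \<circ> 0) (\<lambda>y. z y ^ 2) y = (B + (\<Sum>kl\<in>?I. Q (fst kl) (snd kl) \<circ> R (fst kl) (snd kl)
        2)) (\<lambda>y. z y ^ 2) y"
        using U2(3) oW hz2 y order_trans[OF W U_sub(2)] by blast
      then show ?thesis by (simp only: plus_fun_apply oper_sum_apply comp_apply)
    qed
    \<comment> \<open>The second component of \<open>P\<close> times \<open>(id, 0)\<close> is
      \<open>P \<circ> 0\<close>. On total functions this need not be the zero map, but
      \<open>P\<close> sends the zero function to zero on \<open>W\<close>.\<close>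
    moreover have "(P \<circ> 0) (\<lambda>y. z y ^ 2) y = 0"
      using order_le_zero_on[OF U5(3) oW _ y] W U_sub(5) by (simp add: zero_fun_def)
    ultimately have eq2: "0 = B (\<lambda>y. z y ^ 2) y + (\<Sum>kl\<in>?I. Q (fst kl) (snd kl) (R (fst kl) (snd
      kl) 2 (\<lambda>y. z y ^ 2)) y)"
      by simp
    have "Q (fst kl) (snd kl) (R (fst kl) (snd kl) 1 z) y + Q (fst kl) (snd kl) (R (fst kl) (snd
      kl) 2 (\<lambda>y. z y ^ 2)) y = 0"
      if kl: "kl \<in> ?I" for kl
    proof -
      let ?Q = "Q (fst kl) (snd kl)" and ?R = "R (fst kl) (snd kl)"
      have kl': "fst kl \<in> {1,2,3}" "snd kl \<in> {1,2}" using kl by auto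
      have WD: "W \<subseteq> D" and WV: "W \<subseteq> V kl" using W U_sub(6) U_sub(7)[OF kl] by auto
      have "1 \<in> {1,2::nat}" "2 \<in> {1,2::nat}" by simp_all
      then obtain m1 m2 where m: "order_le D m1 (?R 1)" "order_le D m2 (?R 2)"
        using R_order[OF kl', of 1] R_order[OF kl', of 2] by (elim meta_impE exE)
      have h: "holo_on (?R 1 z) W" "holo_on (?R 2 (\<lambda>y. z y ^ 2)) W"
        using order_le_holo_on[OF m(1) oW WD hz] order_le_holo_on[OF m(2) oW WD hz2] .
      have "?Q (?R 1 z) y + ?Q (?R 2 (\<lambda>y. z y ^ 2)) y = ?Q (\<lambda>t. ?R 1 z t + ?R 2 (\<lambda>y. z y ^ 2) t) y"
        by (rule order_le_add_on[OF V(3)[OF kl] oW WV h y, symmetric])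
      \<comment> \<open>The defining relation of \<open>R\<close> holds on \<open>W\<close> only, so
        the locality of the operator \<open>?Q\<close> is what allows replacing its argument by
        0.\<close>
      also have "\<dots> = ?Q (\<lambda>_. 0) y"
        by (rule order_le_cong_on[OF V(3)[OF kl] oW WV holo_on_add(1)[OF h] sol[OF kl' z WD] y])
      also have "\<dots> = 0" by (rule order_le_zero_on[OF V(3)[OF kl] oW WV y])
      finally show ?thesis .
    qed
    then have "(\<Sum>kl\<in>?I. Q (fst kl) (snd kl) (R (fst kl) (snd kl) 1 z) y) +
       (\<Sum>kl\<in>?I. Q (fst kl) (snd kl) (R (fst kl) (snd kl) 2 (\<lambda>y. z y ^ 2)) y) = 0"
      unfolding sum.distrib[symmetric] by (intro sum.neutral) blast
    \<comment> \<open>The second component contributes minus \<open>B z^2\<close>, and the two sums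
      over the relations cancel, so \<open>B\<close> enters the first equation with a plus
      sign.\<close>
    moreover have "u = v + w" if "u = v + s" "0 = w + t" "s + t = 0" for u v w s t :: complex
    proof -
      have "s = - t" "t = - w" using that by (simp_all add: eq_neg_iff_add_eq_0 add.commute)
      then show ?thesis using that(1) by simp
    qed
    ultimately show ?thesis using eq1 eq2 by blast
  qed
  then have "open U \<and> x \<in> U \<and> order_le U (n - 1) A \<and> order_le U (n - 1) B \<and>
    (\<forall>z W. cubic_branch z W \<and> W \<subseteq> U \<longrightarrow> (\<forall>y\<in>W. P z y = A z y + B (\<lambda>y. z y ^ 2) y))"
    using U order_le_subset[OF U3(3) U_sub(3)] order_le_subset[OF U4(3) U_sub(4)] by blast
  then show ?thesis by (intro exI)
qed

text \<open>At the cusp point the symbol vanishes by continuity along the curve.\<close>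

lemma has_symbol_conormal_zero:
  assumes U: "open U" "(3 * \<zeta> ^ 2, - 2 * \<zeta> ^ 3) \<in> U" and P: "has_symbol U n P \<sigma>"
    and 0: "\<And>\<eta>. \<eta> \<noteq> 0 \<Longrightarrow> (3 * \<eta> ^ 2, - 2 * \<eta> ^ 3) \<in> U \<Longrightarrow> \<sigma> ((3 * \<eta> ^ 2, - 2 * \<eta> ^ 3), (\<eta> * l, l)) = 0"
  shows "\<sigma> ((3 * \<zeta> ^ 2, - 2 * \<zeta> ^ 3), (\<zeta> * l, l)) = 0"
proof -
  define X :: "complex \<Rightarrow> point" where "X = (\<lambda>t. (3 * t ^ 2, - 2 * t ^ 3))"
  have X_cont: "isCont X t" for t unfolding X_def by (intro continuous_intros)
  obtain a where a: "\<And>i j. holo_on (a i j) U"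
    "\<And>W f x. open W \<Longrightarrow> W \<subseteq> U \<Longrightarrow> holo_on f W \<Longrightarrow> x \<in> W \<Longrightarrow>
       P f x = (\<Sum>(i, j) | int (i + j) \<le> n. a i j x * pd i j f x)"
    "\<And>x \<xi>1 \<xi>2. x \<in> U \<Longrightarrow>
       \<sigma> (x, (\<xi>1, \<xi>2)) = (\<Sum>(i, j) | int (i + j) = n. a i j x * \<xi>1 ^ i * \<xi>2 ^ j)"
    using has_symbolE[OF P] by blast
  define H where "H = (\<lambda>t. \<Sum>r\<in>{(i, j). int (i + j) = n}. a (fst r) (snd r) (X t) * (t * l) ^ fst
    r * l ^ snd r)"
  have H: "\<sigma> (X t, (t * l, l)) = H t" if "X t \<in> U" for t
    unfolding a(3)[OF that] H_def by (simp add: split_beta)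
  have coeff_cont: "isCont (\<lambda>t. b (X t)) \<zeta>" if "holo_on b U" for b
  proof (rule isCont_o2[OF X_cont])
    have "X \<zeta> \<in> U" using U(2) by (simp add: X_def)
    then show "isCont b (X \<zeta>)"
      using holo_on_has_derivative[OF that] has_derivative_continuous by blast
  qed
  have "isCont H \<zeta>"
    unfolding H_def
    by (intro isCont_sum ballI isCont_mult isCont_power coeff_cont a continuous_ident
      continuous_const)
  then have "(H \<longlongrightarrow> H \<zeta>) (at \<zeta>)" by (simp add: isCont_def)
  moreover have "\<forall>\<^sub>F t in at \<zeta>. H t = 0"
  proof -
    have "X \<zeta> \<in> U" using U(2) by (simp add: X_def)
    then have "\<forall>\<^sub>F t in at \<zeta>. X t \<in> U"
      using topological_tendstoD[OF X_cont[of \<zeta>, unfolded isCont_def] U(1)] by blast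
    moreover have "\<forall>\<^sub>F t in at \<zeta>. t \<noteq> 0"
    proof (cases "\<zeta> = 0")
      case True
      then show ?thesis using eventually_neq_at_within by metis
    next
      case False
      then show ?thesis by (intro tendsto_imp_eventually_ne[OF tendsto_ident_at])
    qed
    ultimately show ?thesis
    proof eventually_elim
      case (elim t)
      then show ?case using 0[of t] H[of t] by (simp add: X_def)
    qed
  qed
  ultimately have "H \<zeta> = 0"
    using tendsto_unique[OF trivial_limit_at] tendsto_eventually by blast
  then show ?thesis using H[of \<zeta>] U(2) by (simp add: X_def)
qed

text \<open>If \<open>b = 0\<close>, the first equation forces \<open>a = 0\<close>. Off the zero
  section the slope \<open>a / b\<close> is therefore defined, and it is the parameter of the
  cusp.\<close>

lemma symb_P_zero_imp_conormal:
  assumes 1: "symb_P 1 ((p, q), (a, b)) = 0" and 2: "symb_P 2 ((p, q), (a, b)) = 0" and nz: "(a,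
    b) \<noteq> (0, 0)"
  obtains z where "p = 3 * z ^ 2" "q = - 2 * z ^ 3" "a = z * b"
proof -
  have e1: "p * b ^ 2 = 3 * a ^ 2" and e2: "q * b ^ 3 = - 2 * a ^ 3"
    using 1 2 by (simp_all add: symb_P_def field_simps add_eq_0_iff)
  have b: "b \<noteq> 0" using e1 nz by auto
  show ?thesis
  proof (rule that[of "a / b"])
    show "p = 3 * (a / b) ^ 2" using e1 b by (simp add: field_simps)
    show "q = - 2 * (a / b) ^ 3" using e2 b by (simp add: field_simps)
    show "a = a / b * b" using b by simp
  qed
qed

theorem theorem6p3:
  fixes r1 r2 :: real
    and D :: "(complex \<times> complex) set"
    and R :: "nat \<Rightarrow> nat \<Rightarrow> nat \<Rightarrow> oper"
  assumes "0 < r1" and "0 < r2" and "D = ball 0 r1 \<times> ball 0 r2"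
    and "\<forall>k\<in>{1,2,3}. \<forall>i\<in>{1,2}. \<forall>j\<in>{1,2}. i \<noteq> j \<longrightarrow> order_le D (deg_P k - 1) (R k i j)"
    and "\<forall>k\<in>{1,2,3}. \<forall>i\<in>{1,2}. has_symbol D (deg_P k) (R k i i) (symb_P k)"
    and "\<forall>k\<in>{1,2,3}. \<forall>l\<in>{1,2}. \<forall>W z. open W \<and> W \<subseteq> D \<and> holo_on z W \<and>
           (\<forall>(p, q)\<in>W. z (p, q) ^ 3 = p * z (p, q) + q) \<longrightarrow>
           (\<forall>x\<in>W. R k l 1 z x + R k l 2 (\<lambda>y. z y ^ 2) x = 0)"
  shows "char_variety D (coker_phi R) - zero_section
           = (conormal \<Delta> \<inter> (D \<times> UNIV)) - zero_section"
proof -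
  have D: "open D" unfolding assms(3) by (intro open_Times open_ball)
  have off: "order_le D (deg_P k - 1) (R k i j)" if "k \<in> {1,2,3}" "i \<in> {1,2}" "j \<in> {1,2}" "i \<noteq> j" for k i j
    using assms(4) that by blast
  have diag: "has_symbol D (deg_P k) (R k i i) (symb_P k)" if "k \<in> {1,2,3}" "i \<in> {1,2}" for k i
    using assms(5) that by blast
  have R_order: "\<exists>m. order_le D m (R k i j)" if "k \<in> {1,2,3}" "i \<in> {1,2}" "j \<in> {1,2}" for k i j
    using off[OF that] has_symbol_imp_order_le[OF diag[OF that(1,2)]] by (cases "i = j") auto
  have sol: "R k l 1 z y + R k l 2 (\<lambda>y. z y ^ 2) y = 0"
    if "k \<in> {1,2,3}" "l \<in> {1,2}" "cubic_branch z W" "W \<subseteq> D" "y \<in> W" for k l W z y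
    using assms(6)[rule_format, OF that(1,2), of W z y] that(3-5) by (auto simp: cubic_branch_def)
  have coker: "coker R x" if "x \<in> D" for x
  proof
    show "R k l j \<in> Dstalk x" if "k \<in> {1,2,3}" "l \<in> {1,2}" "j \<in> {1,2}" for k l j
      using R_order[OF that] D \<open>x \<in> D\<close> unfolding Dstalk_def Dfilt_def by blast
  qed
  have fibre: "\<xi> \<in> char_fibre x (coker_phi R x) \<longleftrightarrow> (x, \<xi>) \<in> conormal \<Delta>" if x: "x \<in> D" and nz: "\<xi> \<noteq> (0, 0)" for x \<xi>
  proof
    interpret coker R x by (rule coker[OF x])
    obtain p q where pq: "x = (p, q)" by (cases x)
    obtain a b where ab: "\<xi> = (a, b)" by (cases \<xi>)
    assume \<xi>: "\<xi> \<in> char_fibre x (coker_phi R x)"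
    have "symb_P k (x, \<xi>) = 0" if k: "k \<in> {1,2,3}" for k
    proof (rule char_fibre_symbol_zero[OF std_filt_good D x diag[OF k] _ \<xi>])
      show "R k 1 1 \<odot>\<^bsub>coker_phi R x\<^esub> w \<in> std_filt R x (n + deg_P k - 1)" if "w \<in> std_filt R x n" for n w
        by (rule std_filt_lowered[OF k D x diag[OF k] diag[OF k] off[OF k] off[OF k] that]) simp_all
    qed simp
    then obtain z where "p = 3 * z ^ 2" "q = - 2 * z ^ 3" "a = z * b"
      using symb_P_zero_imp_conormal[of p q a b] nz unfolding pq ab by blast
    then show "(x, \<xi>) \<in> conormal \<Delta>" unfolding conormal_Delta pq ab by blast
  next
    interpret coker R x by (rule coker[OF x])
    assume "(x, \<xi>) \<in> conormal \<Delta>"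
    then obtain \<zeta> l where x_eq: "x = (3 * \<zeta> ^ 2, - 2 * \<zeta> ^ 3)" and \<xi>_eq: "\<xi> = (\<zeta> * l, l)"
      unfolding conormal_Delta by blast
    \<comment> \<open>Membership is witnessed by \<open>std_filt\<close>; of the lowering hypothesis
      only its effect on the generator \<open>(id, 0)\<close> in degree 0 is evaluated.\<close>
    have "\<sigma> (x, \<xi>) = 0"
      if U: "open U" "x \<in> U" and P: "has_symbol U n P \<sigma>"
        and low: "\<forall>j. \<forall>w\<in>std_filt R x j. P \<odot>\<^bsub>coker_phi R x\<^esub> w \<in> std_filt R x (j + n - 1)" for U n P \<sigma>
    proof -
      have "cls (id, 0) \<in> std_filt R x 0"
        unfolding std_filt_def using Dfilt_id Dfilt_zero by blast
      then have "P \<odot>\<^bsub>coker_phi R x\<^esub> cls (id, 0) \<in> std_filt R x (n - 1)" using low by fastforce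
      then have "\<exists>V A B. open V \<and> x \<in> V \<and> order_le V (n - 1) A \<and> order_le V (n - 1) B \<and>
          (\<forall>z W. cubic_branch z W \<and> W \<subseteq> V \<longrightarrow> (\<forall>y\<in>W. P z y = A z y + B (\<lambda>y. z y ^ 2) y))"
        by (rule lowering_imp_branch_equation[OF DfiltI[OF U P] _ D x]) (rule R_order sol; assumption)+
      then obtain V A B where V: "open V" "x \<in> V" and AB: "order_le V (n - 1) A" "order_le V (n - 1) B"
        and eq: "\<forall>z W. cubic_branch z W \<and> W \<subseteq> V \<longrightarrow> (\<forall>y\<in>W. P z y = A z y + B (\<lambda>y. z y ^ 2) y)"
        by (elim exE conjE)
      let ?V = "U \<inter> V"
      have V': "open ?V" "x \<in> ?V" using U V by auto
      \<comment> \<open>The operator \<open>A\<close> has order at most \<open>n - 1\<close>, so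
        subtracting it from \<open>P\<close> leaves the symbol in degree \<open>n\<close> unchanged
        and isolates the equation with \<open>B\<close> on the right.\<close>
      obtain \<tau> where "has_symbol V (n - 1) A \<tau>" using AB(1) by (auto simp: order_le_iff_has_symbol)
      then have "has_symbol ?V (n - 1) A \<tau>" by (rule has_symbol_subset) simp
      then have "has_symbol ?V n A (\<lambda>_. 0)" by (rule has_symbol_lift) simp
      then have "has_symbol ?V n (\<lambda>f x. P f x + - A f x) (\<lambda>z. \<sigma> z + - 0)"
        by (intro has_symbol_add has_symbol_uminus has_symbol_subset[OF P]) auto
      then have PA: "has_symbol ?V n (\<lambda>f x. P f x + - A f x) \<sigma>" by simp
      have B: "order_le ?V (n - 1) B" using AB(2) by (rule order_le_subset) simp
      show ?thesis
        unfolding x_eq \<xi>_eq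
      proof (rule has_symbol_conormal_zero[OF V'(1) V'(2)[unfolded x_eq] PA])
        show "\<sigma> ((3 * \<eta> ^ 2, - 2 * \<eta> ^ 3), (\<eta> * l, l)) = 0"
          if "\<eta> \<noteq> 0" "(3 * \<eta> ^ 2, - 2 * \<eta> ^ 3) \<in> ?V" for \<eta>
          by (rule branch_equation_symbol_zero[OF V'(1) that(2,1) PA B]) (use eq in auto)
      qed
    qed
    then show "\<xi> \<in> char_fibre x (coker_phi R x)"
      unfolding char_fibre_def using std_filt_good by blast
  qed
  show ?thesis
  proof (intro equalityI subsetI)
    fix y assume "y \<in> char_variety D (coker_phi R) - zero_section"
    then show "y \<in> (conormal \<Delta> \<inter> (D \<times> UNIV)) - zero_section"
      using fibre[of "fst y" "snd y"] unfolding char_variety_def zero_section_def by force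
  next
    fix y assume "y \<in> (conormal \<Delta> \<inter> (D \<times> UNIV)) - zero_section"
    then show "y \<in> char_variety D (coker_phi R) - zero_section"
      using fibre[of "fst y" "snd y"] unfolding char_variety_def zero_section_def by force
  qed
qed

end
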